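(* Let $S$ be a simple closed symmetric operator with equal (finite or infinite) defect numbers $(n,n)$ in the Hilbert space $\mathcal H$. Suppose that $A$ is a self-adjoint extension of $S$ in $\mathcal H$, that $\gamma(\lambda)$ is a defect family and that $m$ is a $Q$-function of $(S,A,\gamma)$, with values in $\mathcal B(\mathcal G)$. Furthermore, let $\tau\in\mathcal N_0(\mathcal G)$ be such that $m+\tau$ is regular. Let $\widetilde A$ be an $\mathcal H$-minimal self-adjoint extension of $S$ in a Hilbert space $\widetilde{\mathcal H}$ containing $\mathcal H$, such that $$P_{\mathcal H}(\widetilde A-\lambda)^{-1}|_{\mathcal H}=(A-\lambda)^{-1}-\gamma(\lambda)(m(\lambda)+\tau(\lambda))^{-1}\gamma(\overline\lambda)^+$$ holds for all $\lambda\in\mathbb C\setminus\mathbb R$, where $P_{\mathcal H}$ is the orthogonal projection of $\widetilde{\mathcal H}$ onto $\mathcal H$. Then a point $\alpha\in\mathbb R$ is an eigenvalue of $\widetilde A$ if and only if it is either a generalised zero of $m+\tau$, or a generalised pole of both $m$ and $\tau$ with a common pole vector. Furthermore, $\ker(m+\tau)(\alpha)$ is orthogonal to $\mathrm{mul}\,m(\alpha)\cap\mathrm{mul}\,\tau(\alpha)$, and there exists a linear bijection $$\widetilde\Psi:\ker(\widetilde A-\alpha)\to\ker(m+\tau)(\alpha)\oplus\big(\mathrm{mul}\,m(\alpha)\cap\mathrm{mul}\,\tau(\alpha)\big).$$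
   Context: Herglotz-Nevanlinna functions: a $\mathcal B(\mathcal G)$-valued function $Q$ ($\mathcal G$ a Hilbert space), meromorphic on $\mathbb C\setminus\mathbb R$ with $Q(\lambda)^*=Q(\overline\lambda)$, belongs to $\mathcal N_0(\mathcal G)$ if the kernel $K_Q(\lambda,\mu)=\frac{Q(\lambda)-Q(\mu)^*}{\lambda-\overline\mu}$ is nonnegative, i.e. all matrices $\big((K_Q(\lambda_i,\lambda_j)\xi_i,\xi_j)\big)_{i,j=1}^m$ with $\lambda_i\in\mathbb C^+$, $\xi_i\in\mathcal G$ have no negative eigenvalues. $\mathfrak h(Q)$ consists of the points of $\mathbb C\setminus\mathbb R$ where $Q$ is holomorphic and the real points to a neighbourhood of which $Q$ continues holomorphically. $Q$ is regular if $Q(\mu_0)$ is boundedly invertible for some $\mu_0\in\mathfrak h(Q)$. Linear relations are linear subspaces of products of spaces, elements written $(x;y)$; operators are identified with graphs; inverses, sums and products are in the sense of relations; $\ker T=\{x:(x;0)\in T\}$, $\mathrm{mul}\,T=\{y:(0;y)\in T\}$. Self-adjoint extensions may be relations; $\alpha$ is an eigenvalue of $B$ if $\ker(B-\alpha)\ne\{0\}$. $\gamma^+$ denotes the Hilbert space adjoint here. Setting: fix $\lambda_0\in\rho(A)\cap\mathbb C^+$, a Hilbert space $\mathcal G$ with $\dim\mathcal G=n$, and a linear bijection $\gamma\in\mathcal B(\mathcal G,\ker(S^*-\lambda_0))$. The defect family is $\gamma(\lambda)=(I+(\lambda-\lambda_0)(A-\lambda)^{-1})\gamma$, $\lambda\in\rho(A)$.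 $S$ is simple: $\mathcal H=\overline{\mathrm{span}}\{\ker(S^*-\lambda):\lambda\in\rho(A)\}$. A $Q$-function of $(S,A,\gamma)$ is a function $m$ (then in $\mathcal N_0(\mathcal G)$) with $\frac{m(\lambda)-m(\mu)^*}{\lambda-\overline\mu}=\gamma(\mu)^+\gamma(\lambda)$, $\lambda,\mu\in\rho(A)$; it is unique up to a self-adjoint additive constant. $\widetilde A$ is $\mathcal H$-minimal if $\widetilde{\mathcal H}=\overline{\mathrm{span}}\{(I+(\lambda-\lambda_0)(\widetilde A-\lambda)^{-1})\gamma x:\lambda\in\rho(\widetilde A),x\in\mathcal G\}$. Generalised value: a minimal realisation of $Q\in\mathcal N_0(\mathcal G)$ is $(\mathcal H',A',\gamma')$ with $\mathcal H'$ a Hilbert space, $A'$ a self-adjoint relation in $\mathcal H'$, $\gamma':\mathcal G\to\mathcal H'$ bounded linear, such that for some $\lambda_0\in\mathfrak h(Q)\cap\rho(A')\cap\mathbb C^+$: $Q(\lambda)=Q(\lambda_0)^*+(\lambda-\overline{\lambda_0})\gamma'^*(I+(\lambda-\lambda_0)(A'-\lambda)^{-1})\gamma'$ for $\lambda\in\mathfrak h(Q)\cap\rho(A')$, and $\mathcal H'=\overline{\mathrm{span}}\{(I+(\lambda-\lambda_0)(A'-\lambda)^{-1})\gamma'x:\lambda\in\rho(A'),x\in\mathcal G\}$. For $\alpha\in\mathbb R$, $Q(\alpha)$ is the linear relation $Q(\lambda_0)^*+(\alpha-\overline{\lambda_0})\gamma'^*(I+(\alpha-\lambda_0)(A'-\alpha)^{-1})\gamma'$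 in $\mathcal G\times\mathcal G$ (independent of the minimal realisation); $(m+\tau)(\alpha)$ is the generalised value of the function $m+\tau$. $\alpha$ is a generalised zero of $Q$ if there is $f_0\ne0$ with $(f_0;0)\in Q(\alpha)$; it is a generalised pole of $Q$ with pole vector $g_0\neq0$ if $(0;g_0)\in Q(\alpha)$. (Equivalently, these pairs are directional pairs: nontangential limits at $\alpha$ of $(f(\lambda);Q(\lambda)f(\lambda))$ for an analytic $\mathcal G$-valued function $f$, defined on the intersection of a neighbourhood of $\alpha$ with $\mathfrak h(Q)\cap\mathbb C^+$, for which $(K_Q(\lambda,\lambda)f(\lambda),f(\lambda))$ is bounded as $\lambda$ tends to $\alpha$ nontangentially.) *)

theory Defs
  imports "HOL-Analysis.Analysis" "HOL-Library.Equipollence" "Jordan_Normal_Form.Char_Poly"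
begin

section \<open>Complex Hilbert spaces\<close>

text \<open>
  A complex inner product space is a real inner product space carrying a compatible complex scalar
  multiplication and an inner product that is linear in its first argument, with
  \<open>inner x y = Re (cinner x y)\<close>; positivity, the norm and the topology are those of the real
  structure.
\<close>

class complex_inner = real_inner +
  fixes scaleC :: "complex \<Rightarrow> 'a \<Rightarrow> 'a"  (infixr "*\<^sub>C" 75)
    and cinner :: "'a \<Rightarrow> 'a \<Rightarrow> complex"
  assumes scaleC_add_right: "a *\<^sub>C (x + y) = a *\<^sub>C x + a *\<^sub>C y"
    and scaleC_add_left: "(a + b) *\<^sub>C x = a *\<^sub>C x + b *\<^sub>C x"
    and scaleC_scaleC: "a *\<^sub>C (b *\<^sub>C x) = (a * b) *\<^sub>C x"
    and scaleC_of_real: "complex_of_real r *\<^sub>C x = r *\<^sub>R x"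
    and cinner_commute: "cinner x y = cnj (cinner y x)"
    and cinner_add_left: "cinner (x + y) z = cinner x z + cinner y z"
    and cinner_scaleC_left: "cinner (a *\<^sub>C x) y = a * cinner x y"
    and inner_eq_Re_cinner: "inner x y = Re (cinner x y)"

class complex_hilbert = complex_inner + complete_space

instantiation prod :: (complex_inner, complex_inner) complex_inner
begin

definition scaleC_prod_def: "a *\<^sub>C p = (a *\<^sub>C fst p, a *\<^sub>C snd p)"

definition cinner_prod_def: "cinner p q = cinner (fst p) (fst q) + cinner (snd p) (snd q)"

instance
proof
  fix a b :: complex and r :: real and x y z :: "'a \<times> 'b"
  show "a *\<^sub>C (x + y) = a *\<^sub>C x + a *\<^sub>C y"
    by (simp add: scaleC_prod_def scaleC_add_right)
  show "(a + b) *\<^sub>C x = a *\<^sub>C x + b *\<^sub>C x"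
    by (simp add: scaleC_prod_def scaleC_add_left)
  show "a *\<^sub>C (b *\<^sub>C x) = (a * b) *\<^sub>C x"
    by (simp add: scaleC_prod_def scaleC_scaleC)
  show "complex_of_real r *\<^sub>C x = r *\<^sub>R x"
    by (simp add: scaleC_prod_def scaleC_of_real scaleR_prod_def)
  show "cinner x y = cnj (cinner y x)"
    unfolding cinner_prod_def
    by (simp add: cinner_commute [of "fst x" "fst y"] cinner_commute [of "snd x" "snd y"])
  show "cinner (x + y) z = cinner x z + cinner y z"
    by (simp add: cinner_prod_def cinner_add_left)
  show "cinner (a *\<^sub>C x) y = a * cinner x y"
    by (simp add: cinner_prod_def scaleC_prod_def cinner_scaleC_left algebra_simps)
  show "inner x y = Re (cinner x y)"
    by (simp add: cinner_prod_def inner_prod_def inner_eq_Re_cinner)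
qed

end

instance prod :: (complex_hilbert, complex_hilbert) complex_hilbert ..

definition csubspace :: "'a::complex_inner set \<Rightarrow> bool" where
  "csubspace M \<longleftrightarrow> 0 \<in> M \<and> (\<forall>x\<in>M. \<forall>y\<in>M. x + y \<in> M) \<and> (\<forall>a. \<forall>x\<in>M. a *\<^sub>C x \<in> M)"

definition closed_csubspace :: "'a::complex_inner set \<Rightarrow> bool" where
  "closed_csubspace M \<longleftrightarrow> csubspace M \<and> closed M"

definition closed_cspan :: "'a::complex_inner set \<Rightarrow> 'a set" where
  "closed_cspan X = closure (csubspace hull X)"

definition orth_proj :: "'a::complex_inner set \<Rightarrow> 'a \<Rightarrow> 'a" where
  "orth_proj M x = (THE y. y \<in> M \<and> (\<forall>z\<in>M. cinner (x - y) z = 0))"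

definition orthonormal_basis :: "'a::complex_inner set \<Rightarrow> 'a set \<Rightarrow> bool" where
  "orthonormal_basis M B \<longleftrightarrow>
     (\<forall>x\<in>B. norm x = 1) \<and> (\<forall>x\<in>B. \<forall>y\<in>B. x \<noteq> y \<longrightarrow> cinner x y = 0) \<and> closed_cspan B = M"

text \<open>Finite and infinite Hilbert space dimensions are represented by sets of that cardinality.\<close>

definition has_hilbert_dim :: "'a::complex_inner set \<Rightarrow> 'n set \<Rightarrow> bool" where
  "has_hilbert_dim M N \<longleftrightarrow> (\<exists>B. orthonormal_basis M B \<and> B \<approx> N)"

section \<open>Bounded operators\<close>

definition bounded_clinear :: "('a::complex_inner \<Rightarrow> 'b::complex_inner) \<Rightarrow> bool" where
  "bounded_clinear T \<longleftrightarrow> bounded_linear T \<and> (\<forall>a x. T (a *\<^sub>C x) = a *\<^sub>C T x)"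

text \<open>
  If the values of \<open>T\<close> lie in a closed subspace \<open>H\<close>, then the adjoint of \<open>T\<close> as an operator into
  \<open>H\<close> is the restriction of \<open>cadjoint T\<close> to \<open>H\<close>.
\<close>

definition cadjoint :: "('a::complex_inner \<Rightarrow> 'b::complex_inner) \<Rightarrow> 'b \<Rightarrow> 'a" where
  "cadjoint T = (THE T'. \<forall>x y. cinner (T x) y = cinner x (T' y))"

definition boundedly_invertible :: "('a::complex_inner \<Rightarrow> 'a) \<Rightarrow> bool" where
  "boundedly_invertible T \<longleftrightarrow>
     bounded_clinear T \<and> (\<exists>R. bounded_clinear R \<and> R \<circ> T = id \<and> T \<circ> R = id)"

section \<open>Linear relations\<close>

text \<open>
  Relations are sets of pairs. Inverse, product and identity on \<open>H\<close> are \<open>T\<inverse>\<close>, \<open>(O)\<close> and \<open>Id_on H\<close>,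
  where \<open>T O U\<close> applies \<open>T\<close> first. A Hilbert space \<open>H\<close> may sit as a closed subspace in a
  larger one; adjoints and resolvent sets are then taken relative to \<open>H\<close>.
\<close>

definition graph_on :: "'a set \<Rightarrow> ('a \<Rightarrow> 'b) \<Rightarrow> ('a \<times> 'b) set" where
  "graph_on M f = {(x, f x) | x. x \<in> M}"

definition rel_sum :: "('a \<times> 'b::plus) set \<Rightarrow> ('a \<times> 'b) set \<Rightarrow> ('a \<times> 'b) set" where
  "rel_sum T U = {(x, y + z) | x y z. (x, y) \<in> T \<and> (x, z) \<in> U}"

definition rel_scale :: "complex \<Rightarrow> ('a \<times> 'b::complex_inner) set \<Rightarrow> ('a \<times> 'b) set" where
  "rel_scale c T = {(x, c *\<^sub>C y) | x y. (x, y) \<in> T}"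

definition rel_shift :: "('a::complex_inner \<times> 'a) set \<Rightarrow> complex \<Rightarrow> ('a \<times> 'a) set" where
  "rel_shift T z = {(x, y - z *\<^sub>C x) | x y. (x, y) \<in> T}"

definition rel_ker :: "('a \<times> 'b::zero) set \<Rightarrow> 'a set" where
  "rel_ker T = {x. (x, 0) \<in> T}"

definition rel_mul :: "('a::zero \<times> 'b) set \<Rightarrow> 'b set" where
  "rel_mul T = {y. (0, y) \<in> T}"

definition rel_adjoint :: "'a::complex_inner set \<Rightarrow> ('a \<times> 'a) set \<Rightarrow> ('a \<times> 'a) set" where
  "rel_adjoint H T = {(x, y) \<in> H \<times> H. \<forall>(u, v) \<in> T. cinner v x = cinner u y}"

definition self_adjoint_rel :: "'a::complex_inner set \<Rightarrow> ('a \<times> 'a) set \<Rightarrow> bool" where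
  "self_adjoint_rel H A \<longleftrightarrow> A \<subseteq> H \<times> H \<and> rel_adjoint H A = A"

text \<open>The operator is not required to be densely defined, so its adjoint may be a relation.\<close>

definition closed_symmetric_operator :: "'a::complex_inner set \<Rightarrow> ('a \<times> 'a) set \<Rightarrow> bool" where
  "closed_symmetric_operator H S \<longleftrightarrow>
     S \<subseteq> H \<times> H \<and> csubspace S \<and> closed S \<and> rel_mul S = {0} \<and> S \<subseteq> rel_adjoint H S"

definition resolvent_set :: "'a::complex_inner set \<Rightarrow> ('a \<times> 'a) set \<Rightarrow> complex set" where
  "resolvent_set H A =
     {z. (\<forall>y\<in>H. \<exists>!x. (x, y) \<in> rel_shift A z) \<and>
         (\<exists>K. \<forall>(x, y) \<in> rel_shift A z. norm x \<le> K * norm y)}"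

definition resolvent :: "('a::complex_inner \<times> 'a) set \<Rightarrow> complex \<Rightarrow> 'a \<Rightarrow> 'a" where
  "resolvent A z y = (THE x. (x, y) \<in> rel_shift A z)"

definition is_eigenvalue :: "('a::complex_inner \<times> 'a) set \<Rightarrow> complex \<Rightarrow> bool" where
  "is_eigenvalue B \<alpha> \<longleftrightarrow> rel_ker (rel_shift B \<alpha>) \<noteq> {0}"

abbreviation defect_space :: "'a::complex_inner set \<Rightarrow> ('a \<times> 'a) set \<Rightarrow> complex \<Rightarrow> 'a set" where
  "defect_space H S z \<equiv> rel_ker (rel_shift (rel_adjoint H S) z)"

definition defect_numbers ::
    "'a::complex_inner set \<Rightarrow> ('a \<times> 'a) set \<Rightarrow> 'm set \<Rightarrow> 'n set \<Rightarrow> bool" where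
  "defect_numbers H S M N \<longleftrightarrow>
     (\<forall>z. Im z > 0 \<longrightarrow> has_hilbert_dim (defect_space H S z) M) \<and>
     (\<forall>z. Im z < 0 \<longrightarrow> has_hilbert_dim (defect_space H S z) N)"

section \<open>Herglotz-Nevanlinna functions\<close>

definition op_differentiable :: "(complex \<Rightarrow> 'g \<Rightarrow> 'g::complex_inner) \<Rightarrow> complex \<Rightarrow> bool" where
  "op_differentiable Q z \<longleftrightarrow>
     (\<exists>D. bounded_clinear D \<and>
       ((\<lambda>w. onorm (\<lambda>x. (1 / (w - z)) *\<^sub>C (Q w x - Q z x) - D x)) \<longlongrightarrow> 0) (at z))"

definition op_holomorphic_at :: "(complex \<Rightarrow> 'g \<Rightarrow> 'g::complex_inner) \<Rightarrow> complex \<Rightarrow> bool" where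
  "op_holomorphic_at Q z \<longleftrightarrow>
     (\<exists>e>0. \<forall>w\<in>ball z e. bounded_clinear (Q w) \<and> op_differentiable Q w)"

definition op_pole_at :: "(complex \<Rightarrow> 'g \<Rightarrow> 'g::complex_inner) \<Rightarrow> complex \<Rightarrow> bool" where
  "op_pole_at Q z \<longleftrightarrow>
     (\<exists>k>0. \<exists>F. op_holomorphic_at F z \<and> F z \<noteq> (\<lambda>x. 0) \<and>
       (\<forall>\<^sub>F w in at z. \<forall>x. Q w x = (1 / (w - z) ^ k) *\<^sub>C F w x))"

text \<open>
  An operator function on the complement of the real line is represented by a function on the
  whole plane whose values on the real line (and at poles) are irrelevant.
\<close>

definition op_continuation_at ::
    "(complex \<Rightarrow> 'g \<Rightarrow> 'g::complex_inner) \<Rightarrow> (complex \<Rightarrow> 'g \<Rightarrow> 'g) \<Rightarrow> complex \<Rightarrow> bool" where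
  "op_continuation_at Q F z \<longleftrightarrow>
     op_holomorphic_at F z \<and> (\<forall>\<^sub>F w in nhds z. Im w \<noteq> 0 \<longrightarrow> F w = Q w)"

definition hol_domain :: "(complex \<Rightarrow> 'g \<Rightarrow> 'g::complex_inner) \<Rightarrow> complex set" where
  "hol_domain Q = {z. Im z \<noteq> 0 \<and> op_holomorphic_at Q z} \<union>
                  {z. Im z = 0 \<and> (\<exists>F. op_continuation_at Q F z)}"

definition hol_value :: "(complex \<Rightarrow> 'g \<Rightarrow> 'g::complex_inner) \<Rightarrow> complex \<Rightarrow> 'g \<Rightarrow> 'g" where
  "hol_value Q z = (if Im z \<noteq> 0 then Q z else (THE T. \<exists>F. op_continuation_at Q F z \<and> T = F z))"

definition nevanlinna_kernel ::
    "(complex \<Rightarrow> 'g \<Rightarrow> 'g::complex_inner) \<Rightarrow> complex \<Rightarrow> complex \<Rightarrow> 'g \<Rightarrow> 'g" where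
  "nevanlinna_kernel Q z w x = (1 / (z - cnj w)) *\<^sub>C (Q z x - cadjoint (Q w) x)"

definition nevanlinna_N0 :: "(complex \<Rightarrow> 'g \<Rightarrow> 'g::complex_inner) \<Rightarrow> bool" where
  "nevanlinna_N0 Q \<longleftrightarrow>
     (\<forall>z. Im z \<noteq> 0 \<longrightarrow> op_holomorphic_at Q z \<or> op_pole_at Q z) \<and>
     (\<forall>z\<in>hol_domain Q. Im z \<noteq> 0 \<longrightarrow> cadjoint (Q z) = Q (cnj z)) \<and>
     (\<forall>n l \<xi>. (\<forall>i<n. Im (l i) > 0 \<and> l i \<in> hol_domain Q) \<longrightarrow>
        (\<forall>e::real. eigenvalue
            (mat n n (\<lambda>(i, j). cinner (nevanlinna_kernel Q (l i) (l j) (\<xi> i)) (\<xi> j)))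
            (complex_of_real e) \<longrightarrow> \<not> e < 0))"

definition regular_fun :: "(complex \<Rightarrow> 'g \<Rightarrow> 'g::complex_inner) \<Rightarrow> bool" where
  "regular_fun Q \<longleftrightarrow> (\<exists>w\<in>hol_domain Q. boundedly_invertible (hol_value Q w))"

section \<open>Square summable families\<close>

lemma mult_summable_of_square_summable:
  fixes f g :: "'i \<Rightarrow> complex"
  assumes "(\<lambda>i. (cmod (f i))\<^sup>2) summable_on UNIV" and "(\<lambda>i. (cmod (g i))\<^sup>2) summable_on UNIV"
  shows "(\<lambda>i. f i * cnj (g i)) summable_on UNIV"
proof -
  have s: "(\<lambda>i. (cmod (f i))\<^sup>2 + (cmod (g i))\<^sup>2) summable_on UNIV"
    using assms by (rule summable_on_add)
  have "(\<lambda>i. norm (f i * cnj (g i))) summable_on UNIV"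
  proof (rule summable_on_comparison_test [OF s])
    fix i
    have "0 \<le> (cmod (f i) - cmod (g i))\<^sup>2" by simp
    then have "2 * (cmod (f i) * cmod (g i)) \<le> (cmod (f i))\<^sup>2 + (cmod (g i))\<^sup>2"
      by (simp add: power2_diff)
    moreover have "0 \<le> cmod (f i) * cmod (g i)" by simp
    ultimately show "norm (f i * cnj (g i)) \<le> (cmod (f i))\<^sup>2 + (cmod (g i))\<^sup>2"
      unfolding norm_mult complex_mod_cnj by linarith
  qed simp
  then show ?thesis by (rule abs_summable_summable)
qed

lemma square_summable_add:
  fixes f g :: "'i \<Rightarrow> complex"
  assumes "(\<lambda>i. (cmod (f i))\<^sup>2) summable_on UNIV" and "(\<lambda>i. (cmod (g i))\<^sup>2) summable_on UNIV"
  shows "(\<lambda>i. (cmod (f i + g i))\<^sup>2) summable_on UNIV"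
proof (rule summable_on_comparison_test)
  show "(\<lambda>i. 2 * (cmod (f i))\<^sup>2 + 2 * (cmod (g i))\<^sup>2) summable_on UNIV"
    using assms by (intro summable_on_add summable_on_cmult_right)
next
  fix i
  have "(cmod (f i + g i))\<^sup>2 \<le> (cmod (f i) + cmod (g i))\<^sup>2"
    by (simp add: norm_triangle_ineq power_mono)
  moreover have "0 \<le> (cmod (f i) - cmod (g i))\<^sup>2" by simp
  ultimately show "(cmod (f i + g i))\<^sup>2 \<le> 2 * (cmod (f i))\<^sup>2 + 2 * (cmod (g i))\<^sup>2"
    unfolding power2_sum power2_diff by linarith
qed simp

lemma square_summable_scale:
  fixes f :: "'i \<Rightarrow> complex"
  assumes "(\<lambda>i. (cmod (f i))\<^sup>2) summable_on UNIV"
  shows "(\<lambda>i. (cmod (a * f i))\<^sup>2) summable_on UNIV"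
  unfolding norm_mult power_mult_distrib using assms by (rule summable_on_cmult_right)

typedef 'i ell2 = "{f :: 'i \<Rightarrow> complex. (\<lambda>i. (cmod (f i))\<^sup>2) summable_on UNIV}"
  morphisms ell2_coord Abs_ell2
  by (rule exI [of _ "\<lambda>_. 0"]) simp

setup_lifting type_definition_ell2

lemma ell2_eqI: "(\<And>i. ell2_coord x i = ell2_coord y i) \<Longrightarrow> x = y"
  by (metis ell2_coord_inject ext)

lemma ell2_square_summable: "(\<lambda>i. (cmod (ell2_coord x i))\<^sup>2) summable_on UNIV"
  using ell2_coord [of x] by simp

lemma ell2_mult_summable: "(\<lambda>i. ell2_coord x i * cnj (ell2_coord y i)) summable_on UNIV"
  by (intro mult_summable_of_square_summable ell2_square_summable)

instantiation ell2 :: (type) complex_inner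
begin

lift_definition zero_ell2 :: "'a ell2" is "\<lambda>_. 0" by simp

lift_definition plus_ell2 :: "'a ell2 \<Rightarrow> 'a ell2 \<Rightarrow> 'a ell2" is "\<lambda>f g i. f i + g i"
  by (rule square_summable_add)

lift_definition scaleC_ell2 :: "complex \<Rightarrow> 'a ell2 \<Rightarrow> 'a ell2" is "\<lambda>a f i. a * f i"
  by (rule square_summable_scale)

definition uminus_ell2_def: "- x = (- 1) *\<^sub>C (x :: 'a ell2)"
definition minus_ell2_def: "x - y = x + - (y :: 'a ell2)"
definition scaleR_ell2_def: "r *\<^sub>R x = complex_of_real r *\<^sub>C (x :: 'a ell2)"
definition cinner_ell2_def:
  "cinner x y = infsum (\<lambda>i. ell2_coord x i * cnj (ell2_coord y i)) UNIV"
definition inner_ell2_def: "inner x y = Re (cinner x (y :: 'a ell2))"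
definition norm_ell2_def: "norm x = sqrt (inner x (x :: 'a ell2))"
definition sgn_ell2_def: "sgn x = inverse (norm x) *\<^sub>R (x :: 'a ell2)"
definition dist_ell2_def: "dist x y = norm (x - (y :: 'a ell2))"
definition uniformity_ell2_def:
  "(uniformity :: ('a ell2 \<times> 'a ell2) filter) = (INF e\<in>{0<..}. principal {(x, y). dist x y < e})"
definition open_ell2_def:
  "open (U :: 'a ell2 set) = (\<forall>x\<in>U. \<forall>\<^sub>F (x', y) in uniformity. x' = x \<longrightarrow> y \<in> U)"

lemma coord_simps:
  "ell2_coord (0 :: 'a ell2) i = 0"
  "ell2_coord (x + y) i = ell2_coord x i + ell2_coord y i"
  "ell2_coord (a *\<^sub>C x) i = a * ell2_coord x i"
  "ell2_coord (r *\<^sub>R x) i = complex_of_real r * ell2_coord x i"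
  "ell2_coord (- x) i = - ell2_coord x i"
  "ell2_coord (x - y) i = ell2_coord x i - ell2_coord y i"
  by (simp_all add: zero_ell2.rep_eq plus_ell2.rep_eq scaleC_ell2.rep_eq scaleR_ell2_def
      uminus_ell2_def minus_ell2_def)

lemma inner_self_ell2: "inner x x = infsum (\<lambda>i. (cmod (ell2_coord x i))\<^sup>2) UNIV" for x :: "'a ell2"
proof -
  have "inner x x = infsum (\<lambda>i. Re (ell2_coord x i * cnj (ell2_coord x i))) UNIV"
    unfolding inner_ell2_def cinner_ell2_def by (simp only: infsum_Re ell2_mult_summable)
  then show ?thesis by (simp only: complex_norm_square [symmetric] Re_complex_of_real)
qed

instance
proof
  fix a b :: complex and r s :: real and x y z :: "'a ell2"
  show "x + y + z = x + (y + z)" "x + y = y + x" "0 + x = x" "- x + x = 0" "x - y = x + - y"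
    "r *\<^sub>R (x + y) = r *\<^sub>R x + r *\<^sub>R y" "(r + s) *\<^sub>R x = r *\<^sub>R x + s *\<^sub>R x"
    "r *\<^sub>R s *\<^sub>R x = (r * s) *\<^sub>R x" "1 *\<^sub>R x = x"
    by (rule ell2_eqI, simp add: coord_simps algebra_simps)+
  show "a *\<^sub>C (x + y) = a *\<^sub>C x + a *\<^sub>C y" "(a + b) *\<^sub>C x = a *\<^sub>C x + b *\<^sub>C x"
    "a *\<^sub>C (b *\<^sub>C x) = (a * b) *\<^sub>C x" "complex_of_real r *\<^sub>C x = r *\<^sub>R x"
    by (rule ell2_eqI, simp add: coord_simps algebra_simps)+
  show "dist x y = norm (x - y)" by (rule dist_ell2_def)
  show "sgn x = inverse (norm x) *\<^sub>R x" by (rule sgn_ell2_def)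
  show "(uniformity :: ('a ell2 \<times> 'a ell2) filter) =
      (INF e\<in>{0<..}. principal {(x, y). dist x y < e})"
    by (rule uniformity_ell2_def)
  show "open (U :: 'a ell2 set) = (\<forall>x\<in>U. \<forall>\<^sub>F (x', y) in uniformity. x' = x \<longrightarrow> y \<in> U)" for U
    by (rule open_ell2_def)
  show comm: "cinner x y = cnj (cinner y x)" for x y :: "'a ell2"
    unfolding cinner_ell2_def by (simp flip: infsum_cnj add: mult.commute)
  show add: "cinner (x + y) z = cinner x z + cinner y z"
    unfolding cinner_ell2_def coord_simps distrib_right
    by (intro infsum_add ell2_mult_summable)
  show scale: "cinner (a *\<^sub>C x) y = a * cinner x y" for a and x y :: "'a ell2"
    unfolding cinner_ell2_def coord_simps mult.assoc
    by (intro infsum_cmult_right ell2_mult_summable)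
  show "inner x y = Re (cinner x y)" by (rule inner_ell2_def)
  show "inner x y = inner y x"
    unfolding inner_ell2_def by (subst comm) simp
  show "inner (x + y) z = inner x z + inner y z"
    by (simp add: inner_ell2_def add)
  show "inner (r *\<^sub>R x) y = r * inner x y"
    by (simp add: inner_ell2_def scaleR_ell2_def scale)
  show "0 \<le> inner x x"
    unfolding inner_self_ell2 by (rule infsum_nonneg) simp
  show "inner x x = 0 \<longleftrightarrow> x = 0"
  proof
    assume "inner x x = 0"
    then have "(cmod (ell2_coord x i))\<^sup>2 = 0" for i
      unfolding inner_self_ell2
      by (intro nonneg_infsum_le_0D [where A = UNIV]) (auto intro: ell2_square_summable)
    then show "x = 0" by (intro ell2_eqI) (simp add: coord_simps)
  qed (simp add: inner_self_ell2 coord_simps)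
  show "norm x = sqrt (inner x x)" by (rule norm_ell2_def)
qed

end

lemma norm_ell2_square: "(norm x)\<^sup>2 = infsum (\<lambda>i. (cmod (ell2_coord x i))\<^sup>2) UNIV"
  for x :: "'i ell2"
  by (simp only: power2_norm_eq_inner inner_self_ell2)

lemma sum_coord_le_norm_ell2:
  "finite F \<Longrightarrow> (\<Sum>i\<in>F. (cmod (ell2_coord x i))\<^sup>2) \<le> (norm x)\<^sup>2" for x :: "'i ell2"
  unfolding norm_ell2_square by (intro finite_sum_le_infsum ell2_square_summable) auto

lemma coord_le_norm_ell2: "cmod (ell2_coord x i) \<le> norm x" for x :: "'i ell2"
  by (rule power2_le_imp_le) (use sum_coord_le_norm_ell2 [of "{i}" x] in simp_all)

instance ell2 :: (type) complex_hilbert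
proof
  fix X :: "nat \<Rightarrow> 'a ell2"
  assume X: "Cauchy X"
  have "Cauchy (\<lambda>n. ell2_coord (X n) i)" for i
  proof (rule CauchyI)
    fix e :: real assume "0 < e"
    then obtain M where M: "\<And>m n. m \<ge> M \<Longrightarrow> n \<ge> M \<Longrightarrow> norm (X m - X n) < e"
      using CauchyD [OF X] by blast
    have "norm (ell2_coord (X m) i - ell2_coord (X n) i) < e" if "m \<ge> M" "n \<ge> M" for m n
      using coord_le_norm_ell2 [of "X m - X n" i] M [OF that] by (simp add: coord_simps)
    then show "\<exists>M. \<forall>m\<ge>M. \<forall>n\<ge>M. norm (ell2_coord (X m) i - ell2_coord (X n) i) < e" by blast
  qed
  then have "\<exists>l. (\<lambda>n. ell2_coord (X n) i) \<longlonglongrightarrow> l" for i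
    using Cauchy_convergent convergent_def by blast
  then obtain f where f: "\<And>i. (\<lambda>n. ell2_coord (X n) i) \<longlonglongrightarrow> f i" by metis
  have bound: "(\<Sum>i\<in>F. (cmod (ell2_coord (X n) i - f i))\<^sup>2) \<le> e\<^sup>2"
    if "finite F" and "\<And>m. m \<ge> M \<Longrightarrow> norm (X n - X m) \<le> e" for F n M e
  proof (rule tendsto_upperbound)
    show "((\<lambda>m. \<Sum>i\<in>F. (cmod (ell2_coord (X n) i - ell2_coord (X m) i))\<^sup>2) \<longlongrightarrow>
        (\<Sum>i\<in>F. (cmod (ell2_coord (X n) i - f i))\<^sup>2)) sequentially"
      by (intro tendsto_intros f)
    show "\<forall>\<^sub>F m in sequentially.
        (\<Sum>i\<in>F. (cmod (ell2_coord (X n) i - ell2_coord (X m) i))\<^sup>2) \<le> e\<^sup>2"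
      unfolding eventually_sequentially
    proof (intro exI [of _ M] allI impI)
      fix m assume "m \<ge> M"
      have "(\<Sum>i\<in>F. (cmod (ell2_coord (X n) i - ell2_coord (X m) i))\<^sup>2) \<le> (norm (X n - X m))\<^sup>2"
        using sum_coord_le_norm_ell2 [OF that(1), of "X n - X m"] by (simp add: coord_simps)
      also have "\<dots> \<le> e\<^sup>2" using that(2) [OF \<open>m \<ge> M\<close>] by (intro power_mono) auto
      finally show "(\<Sum>i\<in>F. (cmod (ell2_coord (X n) i - ell2_coord (X m) i))\<^sup>2) \<le> e\<^sup>2" .
    qed
  qed simp
  have diff_summable: "(\<lambda>i. (cmod (ell2_coord (X n) i - f i))\<^sup>2) summable_on UNIV"
    if "\<And>m. m \<ge> M \<Longrightarrow> norm (X n - X m) \<le> e" for n M e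
    by (rule nonneg_bdd_above_summable_on)
      (auto intro!: bdd_aboveI [where M = "e\<^sup>2"] bound [where M = M] that)
  obtain M0 where M0: "\<And>m n. m \<ge> M0 \<Longrightarrow> n \<ge> M0 \<Longrightarrow> norm (X m - X n) < 1"
    using CauchyD [OF X, of 1] by auto
  have "(\<lambda>i. (cmod (ell2_coord (X M0) i + (- 1) * (ell2_coord (X M0) i - f i)))\<^sup>2) summable_on UNIV"
    by (intro square_summable_add square_summable_scale ell2_square_summable
        diff_summable [where M = M0 and e = 1]) (simp add: M0 less_imp_le)
  then have "(\<lambda>i. (cmod (f i))\<^sup>2) summable_on UNIV" by simp
  then have coord: "ell2_coord (Abs_ell2 f) = f" by (simp add: Abs_ell2_inverse)
  have "X \<longlonglongrightarrow> Abs_ell2 f"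
  proof (rule LIMSEQ_I)
    fix r :: real assume "0 < r"
    then obtain M where M: "\<And>m n. m \<ge> M \<Longrightarrow> n \<ge> M \<Longrightarrow> norm (X m - X n) < r / 2"
      using CauchyD [OF X, of "r / 2"] by auto
    have "norm (X n - Abs_ell2 f) < r" if "n \<ge> M" for n
    proof -
      have le: "norm (X n - X m) \<le> r / 2" if "m \<ge> M" for m
        using M [OF \<open>n \<ge> M\<close> that] by simp
      have "(norm (X n - Abs_ell2 f))\<^sup>2 = infsum (\<lambda>i. (cmod (ell2_coord (X n) i - f i))\<^sup>2) UNIV"
        by (simp add: norm_ell2_square coord_simps coord)
      also have "\<dots> \<le> (r / 2)\<^sup>2"
        using diff_summable [OF le] bound [OF _ le] by (rule infsum_le_finite_sums)
      finally have "norm (X n - Abs_ell2 f) \<le> r / 2"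
        by (rule power2_le_imp_le) (use \<open>0 < r\<close> in simp)
      then show ?thesis using \<open>0 < r\<close> by simp
    qed
    then show "\<exists>no. \<forall>n\<ge>no. norm (X n - Abs_ell2 f) < r" by blast
  qed
  then show "convergent X" by (auto simp: convergent_def)
qed

section \<open>Minimal realisations and generalised values\<close>

definition minimal_realisation ::
    "(complex \<Rightarrow> 'g \<Rightarrow> 'g::complex_hilbert) \<Rightarrow> complex \<Rightarrow> 'h::complex_hilbert set \<Rightarrow>
      ('h \<times> 'h) set \<Rightarrow> ('g \<Rightarrow> 'h) \<Rightarrow> bool" where
  "minimal_realisation Q z\<^sub>0 H A \<gamma> \<longleftrightarrow>
     closed_csubspace H \<and> self_adjoint_rel H A \<and> bounded_clinear \<gamma> \<and> range \<gamma> \<subseteq> H \<and>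
     z\<^sub>0 \<in> hol_domain Q \<inter> resolvent_set H A \<and> Im z\<^sub>0 > 0 \<and>
     (\<forall>z\<in>hol_domain Q \<inter> resolvent_set H A. \<forall>x.
        hol_value Q z x = cadjoint (Q z\<^sub>0) x +
          (z - cnj z\<^sub>0) *\<^sub>C cadjoint \<gamma> (\<gamma> x + (z - z\<^sub>0) *\<^sub>C resolvent A z (\<gamma> x))) \<and>
     H = closed_cspan {\<gamma> x + (z - z\<^sub>0) *\<^sub>C resolvent A z (\<gamma> x) | z x. z \<in> resolvent_set H A}"

definition value_via ::
    "(complex \<Rightarrow> 'g \<Rightarrow> 'g::complex_hilbert) \<Rightarrow> complex \<Rightarrow> 'h::complex_hilbert set \<Rightarrow>
      ('h \<times> 'h) set \<Rightarrow> ('g \<Rightarrow> 'h) \<Rightarrow> complex \<Rightarrow> ('g \<times> 'g) set" where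
  "value_via Q z\<^sub>0 H A \<gamma> \<alpha> =
     rel_sum (graph_on UNIV (cadjoint (Q z\<^sub>0)))
       (rel_scale (\<alpha> - cnj z\<^sub>0)
         (graph_on UNIV \<gamma> O
          rel_sum (Id_on H) (rel_scale (\<alpha> - z\<^sub>0) ((rel_shift A \<alpha>)\<inverse>)) O
          graph_on H (cadjoint \<gamma>)))"

text \<open>
  The state space of a minimal realisation is the closed linear span of a family indexed by
  \<open>complex \<times> 'g\<close>, so its Hilbert space dimension is at most the cardinality of \<open>complex \<times> 'g\<close>
  and it is unitarily equivalent to a closed subspace of \<open>(complex \<times> 'g) ell2\<close>. Hence it is no
  restriction to take realisations in such subspaces; the value does not depend on the choice of
  the minimal realisation.
\<close>

definition generalised_value ::
    "(complex \<Rightarrow> 'g \<Rightarrow> 'g::complex_hilbert) \<Rightarrow> complex \<Rightarrow> ('g \<times> 'g) set" where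
  "generalised_value Q \<alpha> =
     {p. \<exists>z\<^sub>0 (H :: (complex \<times> 'g) ell2 set) A \<gamma>.
        minimal_realisation Q z\<^sub>0 H A \<gamma> \<and> p \<in> value_via Q z\<^sub>0 H A \<gamma> \<alpha>}"

definition generalised_zero :: "(complex \<Rightarrow> 'g \<Rightarrow> 'g::complex_hilbert) \<Rightarrow> complex \<Rightarrow> bool" where
  "generalised_zero Q \<alpha> \<longleftrightarrow> (\<exists>f. f \<noteq> 0 \<and> (f, 0) \<in> generalised_value Q \<alpha>)"

definition generalised_pole ::
    "(complex \<Rightarrow> 'g \<Rightarrow> 'g::complex_hilbert) \<Rightarrow> complex \<Rightarrow> 'g \<Rightarrow> bool" where
  "generalised_pole Q \<alpha> g \<longleftrightarrow> g \<noteq> 0 \<and> (0, g) \<in> generalised_value Q \<alpha>"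

section \<open>Self-adjoint extensions and Q-functions\<close>

definition defect_family ::
    "('h::complex_inner \<times> 'h) set \<Rightarrow> complex \<Rightarrow> ('g \<Rightarrow> 'h) \<Rightarrow> complex \<Rightarrow> 'g \<Rightarrow> 'h" where
  "defect_family A z\<^sub>0 \<gamma> z x = \<gamma> x + (z - z\<^sub>0) *\<^sub>C resolvent A z (\<gamma> x)"

definition simple_operator ::
    "'h::complex_inner set \<Rightarrow> ('h \<times> 'h) set \<Rightarrow> ('h \<times> 'h) set \<Rightarrow> bool" where
  "simple_operator H S A \<longleftrightarrow> H = closed_cspan (\<Union>z\<in>resolvent_set H A. defect_space H S z)"

text \<open>
  The defining identity is multiplied by \<open>z - cnj w\<close>, so that it makes sense for
  \<open>z = cnj w\<close>, where it says that \<open>m\<close> is symmetric with respect to the real line.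
\<close>

definition Q_function ::
    "'h::complex_inner set \<Rightarrow> ('h \<times> 'h) set \<Rightarrow> complex \<Rightarrow> ('g::complex_inner \<Rightarrow> 'h) \<Rightarrow>
      (complex \<Rightarrow> 'g \<Rightarrow> 'g) \<Rightarrow> bool" where
  "Q_function H A z\<^sub>0 \<gamma> m \<longleftrightarrow>
     (\<forall>z\<in>resolvent_set H A. bounded_clinear (m z)) \<and>
     (\<forall>z\<in>resolvent_set H A. \<forall>w\<in>resolvent_set H A. \<forall>x.
        m z x - cadjoint (m w) x =
          (z - cnj w) *\<^sub>C
            cadjoint (defect_family A z\<^sub>0 \<gamma> w) (defect_family A z\<^sub>0 \<gamma> z x))"

definition minimal_extension ::
    "('k::complex_inner \<times> 'k) set \<Rightarrow> complex \<Rightarrow> ('g \<Rightarrow> 'k) \<Rightarrow> bool" where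
  "minimal_extension A z\<^sub>0 \<gamma> \<longleftrightarrow>
     closed_cspan {\<gamma> x + (z - z\<^sub>0) *\<^sub>C resolvent A z (\<gamma> x) | z x. z \<in> resolvent_set UNIV A} = UNIV"

definition clinear_on :: "'a::complex_inner set \<Rightarrow> ('a \<Rightarrow> 'b::complex_inner) \<Rightarrow> bool" where
  "clinear_on M \<Psi> \<longleftrightarrow>
     (\<forall>x\<in>M. \<forall>y\<in>M. \<Psi> (x + y) = \<Psi> x + \<Psi> y) \<and> (\<forall>a. \<forall>x\<in>M. \<Psi> (a *\<^sub>C x) = a *\<^sub>C \<Psi> x)"

definition subspace_sum :: "'a::plus set \<Rightarrow> 'a set \<Rightarrow> 'a set" where
  "subspace_sum M N = {x + y | x y. x \<in> M \<and> y \<in> N}"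

end

theory Submission
  imports Defs
begin

text \<open>
  Write \<open>Q = m + \<tau>\<close>. The defect family \<open>\<gamma>(z)\<close> of \<open>A\<close> and the resolvents of \<open>Atilde\<close> determine a family
  \<open>\<Gamma> z\<close> in the extension space with \<open>(Atilde - z)\<^sup>-\<^sup>1 h = (A - z)\<^sup>-\<^sup>1 h - \<Gamma> z (Q z)\<^sup>-\<^sup>1 \<gamma>(cnj z)\<^sup>* h\<close> for \<open>h\<close> in \<open>H\<close>.
  By Krein's formula and the resolvent identity the kernels of \<open>m\<close>, \<open>Q\<close> and \<open>\<tau>\<close> are the Gram matrices of
  \<open>\<gamma>(z)\<close>, of \<open>\<Gamma> z\<close>, and of the component \<open>\<Gamma> z - \<gamma>(z)\<close> of \<open>\<Gamma> z\<close> orthogonal to \<open>H\<close>. For any family with Gram matrix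
  the kernel of \<open>Q\<close>, a pair \<open>(c, d)\<close> is in the generalised value \<open>Q(\<alpha>)\<close> iff some vector \<open>h\<close> satisfies
  \<open>(\<alpha> - cnj z) \<langle>h, \<Gamma> z y\<rangle> = \<langle>d, y\<rangle> - \<langle>c, Q z y\<rangle>\<close> for all nonreal \<open>z\<close>. Every eigenvector \<open>v\<close> of \<open>Atilde\<close> at \<open>\<alpha>\<close>
  satisfies this with \<open>d = 0\<close> and a unique \<open>c\<close> in \<open>ker Q(\<alpha>)\<close>; the eigenvectors with \<open>c = 0\<close> are those orthogonal
  to all \<open>\<Gamma> z y\<close>, and they correspond to the common pole vectors through their components in \<open>H\<close>
  and its complement, which are then poles of \<open>m\<close> and \<open>\<tau>\<close> with the same vector.
\<close>

section \<open>Complex inner product spaces\<close>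

text \<open>The criterion for generalised values is the Gram identity \<open>(z - cnj w) * cinner
  (\<Gamma> z c) (\<Gamma> w y) = cinner (Q z c) y - cinner c (Q w y)\<close> continued to the real
  point: \<alpha> replaces \<open>z\<close>, the vector \<open>h\<close> replaces
  \<open>\<Gamma> z c\<close>, and \<open>d\<close> replaces \<open>Q z c\<close>. It involves inner
  products only, so it does not depend on the space that carries the family; this makes realisations
  in the fixed \<open>ell2\<close> space of the definition comparable with families in the extension
  space.

  The obstacle is that Krein's formula controls only the compression to \<open>H\<close> of the
  resolvent of \<open>Atilde\<close>. The rest is recovered from norms: where the compression agrees
  with the resolvent of \<open>A\<close>, the resolvent identity forces full agreement, and since
  the adjoints of the defect family map \<open>H\<close> onto the parameter space, \<Gamma> is then
  determined for every parameter.

  For the bijection, pole vectors belong only to eigenvectors with \<open>c = 0\<close>. An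
  orthogonal projection inside the eigenspace extends them linearly, and the orthogonality of the
  two target spaces gives injectivity.\<close>

lemma cinner_add_right: "cinner x (y + z) = cinner x y + cinner x z" for x :: "'a::complex_inner"
  by (subst (1 2 3) cinner_commute) (simp add: cinner_add_left)

lemma cinner_scaleC_right: "cinner x (a *\<^sub>C y) = cnj a * cinner x y" for x :: "'a::complex_inner"
  by (subst (1 2) cinner_commute) (simp add: cinner_scaleC_left)

lemma scaleC_one [simp]: "1 *\<^sub>C x = x" for x :: "'a::complex_inner"
  using scaleC_of_real [of 1 x] by simp

lemma scaleC_zero_left [simp]: "0 *\<^sub>C x = 0" for x :: "'a::complex_inner"
  using scaleC_of_real [of 0 x] by simp

lemma scaleC_zero_right [simp]: "a *\<^sub>C (0 :: 'a::complex_inner) = 0"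
  using scaleC_add_right [of a "0 :: 'a" 0] by simp

lemma scaleC_minus_one: "(- 1) *\<^sub>C x = - x" for x :: "'a::complex_inner"
  using scaleC_of_real [of "- 1" x] by simp

lemma scaleC_minus_right: "a *\<^sub>C (- x) = - (a *\<^sub>C x)" for x :: "'a::complex_inner"
  by (metis add.right_inverse minus_unique scaleC_add_right scaleC_zero_right)

lemma scaleC_minus_left: "(- a) *\<^sub>C x = - (a *\<^sub>C x)" for x :: "'a::complex_inner"
  by (metis add.right_inverse minus_unique scaleC_add_left scaleC_zero_left)

lemma scaleC_diff_right: "a *\<^sub>C (x - y) = a *\<^sub>C x - a *\<^sub>C y" for x :: "'a::complex_inner"
  using scaleC_add_right [of a x "- y"] by (simp add: scaleC_minus_right)

lemma scaleC_diff_left: "(a - b) *\<^sub>C x = a *\<^sub>C x - b *\<^sub>C x" for x :: "'a::complex_inner"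
  using scaleC_add_left [of a "- b" x] by (simp add: scaleC_minus_left)

lemma scaleR_scaleC: "r *\<^sub>R x = complex_of_real r *\<^sub>C x" for x :: "'a::complex_inner"
  by (simp add: scaleC_of_real)

lemma cinner_zero_left [simp]: "cinner 0 x = 0" for x :: "'a::complex_inner"
  using cinner_scaleC_left [of 0 0 x] by simp

lemma cinner_zero_right [simp]: "cinner x 0 = 0" for x :: "'a::complex_inner"
  using cinner_scaleC_right [of x 0 0] by simp

lemma cinner_minus_left: "cinner (- x) y = - cinner x y" for x :: "'a::complex_inner"
  using cinner_scaleC_left [of "- 1" x y] by (simp add: scaleC_minus_one)

lemma cinner_minus_right: "cinner x (- y) = - cinner x y" for x :: "'a::complex_inner"
  using cinner_scaleC_right [of x "- 1" y] by (simp add: scaleC_minus_one)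

lemma cinner_diff_left: "cinner (x - y) z = cinner x z - cinner y z" for x :: "'a::complex_inner"
  using cinner_add_left [of x "- y" z] by (simp add: cinner_minus_left)

lemma cinner_diff_right: "cinner x (y - z) = cinner x y - cinner x z" for x :: "'a::complex_inner"
  using cinner_add_right [of x y "- z"] by (simp add: cinner_minus_right)

lemmas cinner_linear = cinner_add_left cinner_add_right cinner_diff_left cinner_diff_right
  cinner_minus_left cinner_minus_right cinner_scaleC_left cinner_scaleC_right

lemmas scaleC_linear = scaleC_add_left scaleC_add_right scaleC_diff_left scaleC_diff_right
  scaleC_scaleC scaleC_minus_left scaleC_minus_right

lemma cinner_self: "cinner x x = complex_of_real ((norm x)\<^sup>2)" for x :: "'a::complex_inner"
proof (rule complex_eqI)
  show "Re (cinner x x) = Re (complex_of_real ((norm x)\<^sup>2))"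
    by (simp add: inner_eq_Re_cinner [symmetric] power2_norm_eq_inner)
  have "Im (cinner x x) = - Im (cinner x x)"
    by (metis cinner_commute cnj.simps(2))
  then show "Im (cinner x x) = Im (complex_of_real ((norm x)\<^sup>2))" by simp
qed

lemma cinner_self_eq_0 [simp]: "cinner x x = 0 \<longleftrightarrow> x = 0" for x :: "'a::complex_inner"
  unfolding cinner_self by (simp del: of_real_power)

lemma norm_scaleC [simp]: "norm (a *\<^sub>C x) = cmod a * norm x" for x :: "'a::complex_inner"
proof -
  have "complex_of_real ((norm (a *\<^sub>C x))\<^sup>2) = a * cnj a * complex_of_real ((norm x)\<^sup>2)"
    unfolding cinner_self [symmetric] by (simp add: cinner_linear)
  also have "\<dots> = complex_of_real ((cmod a * norm x)\<^sup>2)"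
    by (simp only: power_mult_distrib of_real_mult complex_norm_square [symmetric] of_real_power)
  finally have "(norm (a *\<^sub>C x))\<^sup>2 = (cmod a * norm x)\<^sup>2" by (simp only: of_real_eq_iff)
  then show ?thesis by (simp add: power2_eq_iff_nonneg)
qed

lemma cmod_cinner_le: "cmod (cinner x y) \<le> norm x * norm y" for x :: "'a::complex_inner"
proof (cases "cinner x y = 0")
  case False
  \<comment> \<open>A unimodular factor makes the product a nonnegative real number, where the real
    Cauchy-Schwarz inequality applies.\<close>
  define a where "a = cnj (cinner x y) / cmod (cinner x y)"
  have a1: "cmod a = 1" using False by (simp add: a_def norm_divide)
  have "cinner (a *\<^sub>C x) y = complex_of_real (cmod (cinner x y))"
    using False complex_norm_square [of "cinner x y"]
    by (simp add: a_def cinner_linear power2_eq_square field_simps)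
  then have "cmod (cinner x y) = inner (a *\<^sub>C x) y" by (simp add: inner_eq_Re_cinner)
  also have "\<dots> \<le> norm (a *\<^sub>C x) * norm y" by (rule norm_cauchy_schwarz)
  finally show ?thesis using a1 by simp
qed simp

lemma cinner_ext: "(\<And>y. cinner x y = cinner x' y) \<Longrightarrow> x = x'" for x :: "'a::complex_inner"
  by (metis cinner_diff_left cinner_self_eq_0 right_minus_eq)

lemma cinner_ext_left: "(\<And>y. cinner y x = cinner y x') \<Longrightarrow> x = x'" for x :: "'a::complex_inner"
  by (metis cinner_diff_right cinner_self_eq_0 right_minus_eq)

lemma bounded_linear_cinner_left: "bounded_linear (\<lambda>x. cinner x y)" for y :: "'a::complex_inner"
  by (rule bounded_linear_intro [of _ "norm y"])
    (simp_all add: cinner_linear scaleR_scaleC scaleR_conv_of_real cmod_cinner_le)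

lemma bounded_linear_cinner_right: "bounded_linear (\<lambda>x. cinner y x)" for y :: "'a::complex_inner"
  by (rule bounded_linear_intro [of _ "norm y"])
    (use cmod_cinner_le [of y] in \<open>simp_all add: cinner_linear scaleR_scaleC scaleR_conv_of_real mult.commute\<close>)

lemma bounded_linear_scaleC_right: "bounded_linear (\<lambda>x. a *\<^sub>C x)" for a
  by (rule bounded_linear_intro [of _ "cmod a"])
    (simp_all add: scaleC_linear scaleR_scaleC mult.commute)

lemmas tendsto_cinner_left [tendsto_intros] = bounded_linear.tendsto [OF bounded_linear_cinner_left]
lemmas tendsto_cinner_right [tendsto_intros] = bounded_linear.tendsto [OF bounded_linear_cinner_right]
lemmas tendsto_scaleC_right [tendsto_intros] = bounded_linear.tendsto [OF bounded_linear_scaleC_right]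

lemma cinner_Pair [simp]: "cinner (a, b) (c, d) = cinner a c + cinner b d"
  by (simp add: cinner_prod_def)

lemma scaleC_Pair [simp]: "a *\<^sub>C (x, y) = (a *\<^sub>C x, a *\<^sub>C y)"
  by (simp add: scaleC_prod_def)

subsection \<open>Subspaces\<close>

lemma csubspace_0: "csubspace M \<Longrightarrow> 0 \<in> M"
  and csubspace_add: "csubspace M \<Longrightarrow> x \<in> M \<Longrightarrow> y \<in> M \<Longrightarrow> x + y \<in> M"
  and csubspace_scaleC: "csubspace M \<Longrightarrow> x \<in> M \<Longrightarrow> a *\<^sub>C x \<in> M"
  by (auto simp: csubspace_def)

lemma csubspace_minus: "csubspace M \<Longrightarrow> x \<in> M \<Longrightarrow> - x \<in> M"
  by (metis csubspace_scaleC scaleC_minus_one)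

lemma csubspace_diff: "csubspace M \<Longrightarrow> x \<in> M \<Longrightarrow> y \<in> M \<Longrightarrow> x - y \<in> M"
  by (metis add_uminus_conv_diff csubspace_add csubspace_minus)

lemmas csubspace_intros = csubspace_0 csubspace_add csubspace_scaleC csubspace_minus csubspace_diff

lemma csubspaceI:
  assumes "0 \<in> M" "\<And>x y. x \<in> M \<Longrightarrow> y \<in> M \<Longrightarrow> x + y \<in> M" "\<And>a x. x \<in> M \<Longrightarrow> a *\<^sub>C x \<in> M"
  shows "csubspace M"
  using assms by (auto simp: csubspace_def)

lemma csubspace_closure: "csubspace M \<Longrightarrow> csubspace (closure M)"
proof (rule csubspaceI)
  assume M: "csubspace M"
  show "0 \<in> closure M" using M closure_subset csubspace_0 by blast
  show "x + y \<in> closure M" if xy: "x \<in> closure M" "y \<in> closure M" for x y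
  proof -
    obtain u v where "\<And>n. u n \<in> M" "u \<longlonglongrightarrow> x" "\<And>n. v n \<in> M" "v \<longlonglongrightarrow> y"
      using xy unfolding closure_sequential by blast
    then have "\<forall>n. u n + v n \<in> M" "(\<lambda>n. u n + v n) \<longlonglongrightarrow> x + y"
      using M by (auto intro: csubspace_add tendsto_add)
    then show ?thesis unfolding closure_sequential by (intro exI [of _ "\<lambda>n. u n + v n"]) simp
  qed
  show "a *\<^sub>C x \<in> closure M" if x: "x \<in> closure M" for a x
  proof -
    obtain u where "\<And>n. u n \<in> M" "u \<longlonglongrightarrow> x" using x unfolding closure_sequential by blast
    then have "\<forall>n. a *\<^sub>C u n \<in> M" "(\<lambda>n. a *\<^sub>C u n) \<longlonglongrightarrow> a *\<^sub>C x"
      using M by (auto intro: csubspace_scaleC tendsto_intros)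
    then show ?thesis unfolding closure_sequential by (intro exI [of _ "\<lambda>n. a *\<^sub>C u n"]) simp
  qed
qed

lemma csubspace_hull: "csubspace (csubspace hull X)"
  by (rule hull_in) (auto simp: csubspace_def)

lemma closed_csubspace_closed_cspan: "closed_csubspace (closed_cspan X)"
  by (simp add: closed_csubspace_def closed_cspan_def csubspace_closure csubspace_hull)

lemma closed_cspan_superset: "X \<subseteq> closed_cspan X"
  unfolding closed_cspan_def by (meson closure_subset hull_subset subset_trans)

lemma closed_cspan_minimal: "closed_csubspace M \<Longrightarrow> X \<subseteq> M \<Longrightarrow> closed_cspan X \<subseteq> M"
  unfolding closed_csubspace_def closed_cspan_def
  by (intro closure_minimal hull_minimal) auto

lemma closed_csubspace_orthogonal: "closed_csubspace {v. \<forall>x\<in>X. cinner v x = 0}"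
proof -
  have "csubspace {v. \<forall>x\<in>X. cinner v x = 0}"
    by (rule csubspaceI) (auto simp: cinner_linear)
  moreover have "closed {v. \<forall>x\<in>X. cinner v x = 0}"
    unfolding closed_sequential_limits
  proof safe
    fix f l x assume f: "\<forall>n. f n \<in> {v. \<forall>x\<in>X. cinner v x = 0}" "f \<longlonglongrightarrow> l" and x: "x \<in> X"
    have "(\<lambda>n. cinner (f n) x) \<longlonglongrightarrow> cinner l x" using f by (intro tendsto_intros)
    moreover have "(\<lambda>n. cinner (f n) x) = (\<lambda>_. 0)" using f x by auto
    ultimately show "cinner l x = 0" by (simp add: LIMSEQ_const_iff)
  qed
  ultimately show ?thesis by (simp add: closed_csubspace_def)
qed

lemma cinner_eq_0_commute: "cinner x y = 0 \<longleftrightarrow> cinner y x = 0" for x :: "'a::complex_inner"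
  using cinner_commute [of x y] by auto

lemma closed_cspan_orthogonal:
  assumes "\<And>x. x \<in> X \<Longrightarrow> cinner u x = 0" and "v \<in> closed_cspan X"
  shows "cinner u v = 0"
proof -
  have "closed_cspan X \<subseteq> {v. \<forall>x\<in>{u}. cinner v x = 0}"
    using assms(1) by (intro closed_cspan_minimal closed_csubspace_orthogonal)
      (auto simp: cinner_eq_0_commute)
  then show ?thesis using assms(2) by (auto simp: cinner_eq_0_commute)
qed

subsection \<open>Orthogonal projection, Riesz representation and adjoints\<close>

text \<open>A minimising sequence is Cauchy by the parallelogram law, because midpoints of its
  members stay in \<open>M\<close> and so keep distance at least \<open>d\<close> from
  \<open>x\<close>.\<close>

lemma nearest_point_exists:
  fixes x :: "'a::complex_hilbert"
  assumes M: "closed_csubspace M"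
  shows "\<exists>y\<in>M. \<forall>z\<in>M. norm (x - y) \<le> norm (x - z)"
proof -
  have sub: "csubspace M" and cl: "closed M" using M by (auto simp: closed_csubspace_def)
  define d where "d = (INF z\<in>M. norm (x - z))"
  have ne: "M \<noteq> {}" using csubspace_0 [OF sub] by auto
  have bdd: "bdd_below ((\<lambda>z. norm (x - z)) ` M)" by (rule bdd_belowI2 [of _ 0]) simp
  have d_le: "d \<le> norm (x - z)" if "z \<in> M" for z
    unfolding d_def by (rule cINF_lower [OF bdd that])
  have d0: "0 \<le> d" unfolding d_def by (rule cINF_greatest [OF ne]) simp
  have "\<exists>z\<in>M. norm (x - z) < d + inverse (real (Suc n))" for n
    using cINF_less_iff [OF ne bdd, of "d + inverse (real (Suc n))"] by (simp add: d_def)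
  then obtain y where yM: "\<And>n. y n \<in> M" and yd: "\<And>n. norm (x - y n) < d + inverse (real (Suc n))"
    by metis
  have lim_d: "(\<lambda>n. norm (x - y n)) \<longlonglongrightarrow> d"
  proof (rule tendsto_sandwich [of "\<lambda>_. d" _ _ "\<lambda>n. d + inverse (real (Suc n))"])
    show "(\<lambda>n. d + inverse (real (Suc n))) \<longlonglongrightarrow> d"
      using tendsto_add [OF tendsto_const LIMSEQ_inverse_real_of_nat, of d] by simp
  qed (intro tendsto_const always_eventually allI d_le yM less_imp_le [OF yd])+
  have par: "(norm (y m - y n))\<^sup>2 \<le> 2 * (norm (x - y m))\<^sup>2 + 2 * (norm (x - y n))\<^sup>2 - 4 * d\<^sup>2" for m n
  proof -
    define a b where "a = x - y m" and "b = x - y n"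
    have "(norm (a + b))\<^sup>2 + (norm (a - b))\<^sup>2 = 2 * (norm a)\<^sup>2 + 2 * (norm b)\<^sup>2"
      by (simp add: power2_norm_eq_inner inner_left_distrib inner_right_distrib
          inner_diff_left inner_diff_right inner_commute)
    moreover have "a + b = 2 *\<^sub>R (x - (1/2) *\<^sub>R (y m + y n))"
      by (simp add: a_def b_def algebra_simps scaleR_2)
    then have "norm (a + b) = 2 * norm (x - (1/2) *\<^sub>R (y m + y n))" by simp
    moreover have "(1/2) *\<^sub>R (y m + y n) \<in> M"
      unfolding scaleR_scaleC using sub yM by (intro csubspace_intros)
    then have "d \<le> norm (x - (1/2) *\<^sub>R (y m + y n))" by (rule d_le)
    then have "d\<^sup>2 \<le> (norm (x - (1/2) *\<^sub>R (y m + y n)))\<^sup>2" using d0 by (intro power_mono)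
    ultimately show ?thesis
      by (simp add: a_def b_def power_mult_distrib norm_minus_commute)
  qed
  have "Cauchy y"
  proof (rule CauchyI)
    fix e :: real assume e: "0 < e"
    have "(\<lambda>n. (norm (x - y n))\<^sup>2) \<longlonglongrightarrow> d\<^sup>2" by (intro tendsto_intros lim_d)
    moreover have "d\<^sup>2 < d\<^sup>2 + e\<^sup>2 / 4" using e by simp
    ultimately have "\<forall>\<^sub>F n in sequentially. (norm (x - y n))\<^sup>2 < d\<^sup>2 + e\<^sup>2 / 4"
      by (rule order_tendstoD)
    then obtain N where N: "\<And>n. n \<ge> N \<Longrightarrow> (norm (x - y n))\<^sup>2 < d\<^sup>2 + e\<^sup>2 / 4"
      unfolding eventually_sequentially by auto
    have "norm (y m - y n) < e" if "m \<ge> N" "n \<ge> N" for m n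
    proof -
      have "(norm (y m - y n))\<^sup>2 < e\<^sup>2" using par [of m n] N [OF that(1)] N [OF that(2)] by simp
      then show ?thesis using e by (simp add: power2_less_imp_less)
    qed
    then show "\<exists>N. \<forall>m\<ge>N. \<forall>n\<ge>N. norm (y m - y n) < e" by blast
  qed
  then obtain l where l: "y \<longlonglongrightarrow> l" using Cauchy_convergent convergent_def by blast
  have "l \<in> M" using cl l yM by (meson closed_sequential_limits)
  moreover have "(\<lambda>n. norm (x - y n)) \<longlonglongrightarrow> norm (x - l)" by (intro tendsto_intros l)
  then have "norm (x - l) = d" using lim_d LIMSEQ_unique by blast
  ultimately show ?thesis using d_le by auto
qed

lemma orth_decomposition:
  fixes x :: "'a::complex_hilbert"
  assumes M: "closed_csubspace M"
  shows "\<exists>y\<in>M. \<forall>z\<in>M. cinner (x - y) z = 0"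
proof -
  have sub: "csubspace M" using M by (simp add: closed_csubspace_def)
  obtain y where y: "y \<in> M" and near: "\<And>z. z \<in> M \<Longrightarrow> norm (x - y) \<le> norm (x - z)"
    using nearest_point_exists [OF M] by blast
  have "cinner (x - y) z = 0" if z: "z \<in> M" for z
  proof (rule ccontr)
    define c where "c = cinner (x - y) z"
    assume "cinner (x - y) z \<noteq> 0"
    then have c: "c \<noteq> 0" and z0: "z \<noteq> 0" by (auto simp: c_def)
    \<comment> \<open>The Fourier coefficient of \<open>x - y\<close> along \<open>z\<close>:
      removing this component lowers the squared distance by
      \<open>(cmod c)\<^sup>2 / (norm z)\<^sup>2\<close>, against the minimality of
      \<open>y\<close>.\<close>
    define a where "a = c / complex_of_real ((norm z)\<^sup>2)"
    have "y + a *\<^sub>C z \<in> M" using sub y z by (intro csubspace_intros)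
    then have "norm (x - y) \<le> norm (x - y - a *\<^sub>C z)" using near by (simp add: diff_diff_add)
    then have le: "(norm (x - y))\<^sup>2 \<le> (norm (x - y - a *\<^sub>C z))\<^sup>2" by (intro power_mono) auto
    have "complex_of_real ((norm (x - y - a *\<^sub>C z))\<^sup>2) =
        cinner (x - y) (x - y) - cnj a * c - a * cnj c + a * cnj a * cinner z z"
      unfolding cinner_self [symmetric] c_def
      by (subst cinner_commute [of "x - y" z, symmetric] | simp add: cinner_linear algebra_simps)+
        (simp add: cinner_linear cinner_commute [of x z] cinner_commute [of y z] algebra_simps)
    also have "\<dots> = complex_of_real ((norm (x - y))\<^sup>2) - c * cnj c / complex_of_real ((norm z)\<^sup>2)"
      using z0 by (simp add: cinner_self a_def field_simps power2_eq_square)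
    also have "\<dots> = complex_of_real ((norm (x - y))\<^sup>2 - (cmod c)\<^sup>2 / (norm z)\<^sup>2)"
      using complex_norm_square [of c] by simp
    finally have "(norm (x - y - a *\<^sub>C z))\<^sup>2 = (norm (x - y))\<^sup>2 - (cmod c)\<^sup>2 / (norm z)\<^sup>2"
      by (simp only: of_real_eq_iff)
    moreover have "(cmod c)\<^sup>2 / (norm z)\<^sup>2 > 0" using c z0 by simp
    ultimately show False using le by linarith
  qed
  then show ?thesis using y by blast
qed

text \<open>The part of \<open>u\<close> orthogonal to the span lies in \<open>H\<close> again, so
  totality inside \<open>H\<close> suffices for density.\<close>

lemma closed_cspan_eqI:
  fixes H :: "'a::complex_hilbert set"
  assumes H: "closed_csubspace H" and X: "X \<subseteq> H"
    and total: "\<And>u. u \<in> H \<Longrightarrow> (\<And>x. x \<in> X \<Longrightarrow> cinner u x = 0) \<Longrightarrow> u = 0"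
  shows "closed_cspan X = H"
proof (rule antisym [OF closed_cspan_minimal [OF H X]], rule subsetI)
  fix u assume u: "u \<in> H"
  obtain p where p: "p \<in> closed_cspan X" and orth: "\<And>z. z \<in> closed_cspan X \<Longrightarrow> cinner (u - p) z = 0"
    using orth_decomposition [OF closed_csubspace_closed_cspan, of X u] by blast
  have "u - p \<in> H"
    using u p closed_cspan_minimal [OF H X] H by (auto simp: closed_csubspace_def intro: csubspace_diff)
  then have "u - p = 0" using orth closed_cspan_superset by (intro total) auto
  then show "u \<in> closed_cspan X" using p by simp
qed

lemma riesz_representation:
  fixes f :: "'a::complex_hilbert \<Rightarrow> complex"
  assumes add: "\<And>x y. f (x + y) = f x + f y" and scale: "\<And>a x. f (a *\<^sub>C x) = a * f x"
    and bound: "\<And>x. cmod (f x) \<le> K * norm x"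
  shows "\<exists>y. \<forall>x. f x = cinner x y"
proof -
  have f0: "f 0 = 0" using scale [of 0 0] by simp
  have fdiff: "f (x - y) = f x - f y" for x y
    using add [of x "(- 1) *\<^sub>C y"] scale [of "- 1" y] by (simp add: scaleC_minus_one)
  have "bounded_linear f"
  proof (rule bounded_linear_intro [of _ K])
    show "norm (f x) \<le> norm x * K" for x using bound [of x] by (simp add: mult.commute)
    show "f (r *\<^sub>R x) = r *\<^sub>R f x" for r x
      unfolding scaleR_scaleC by (simp add: scale scaleR_conv_of_real)
  qed (rule add)
  then have "closed {x. f x = 0}"
    by (intro closed_Collect_eq linear_continuous_on continuous_on_const)
  then have M: "closed_csubspace {x. f x = 0}"
    by (simp add: closed_csubspace_def csubspace_def f0 add scale)
  show ?thesis
  proof (cases "\<forall>x. f x = 0")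
    case True
    then show ?thesis by (intro exI [of _ 0]) simp
  next
    case False
    then obtain x0 where x0: "f x0 \<noteq> 0" by blast
    obtain p where p: "f p = 0" and orth: "\<And>z. f z = 0 \<Longrightarrow> cinner (x0 - p) z = 0"
      using orth_decomposition [OF M, of x0] by auto
    define q where "q = x0 - p"
    have fq: "f q \<noteq> 0" using x0 p by (simp add: q_def fdiff)
    then have q0: "q \<noteq> 0" using f0 by auto
    \<comment> \<open>The vector \<open>q\<close> spans the orthogonal complement of the kernel of
      \<open>f\<close>; the scalar normalises it so that both sides agree at
      \<open>q\<close>.\<close>
    have "f x = cinner x ((cnj (f q) / complex_of_real ((norm q)\<^sup>2)) *\<^sub>C q)" for x
    proof -
      have "f (x - (f x / f q) *\<^sub>C q) = 0" using fq by (simp add: fdiff scale)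
      then have "cinner (x - (f x / f q) *\<^sub>C q) q = 0"
        using orth cinner_eq_0_commute unfolding q_def by metis
      then have "cinner x q = f x / f q * complex_of_real ((norm q)\<^sup>2)"
        by (simp add: cinner_linear cinner_self)
      then show ?thesis using fq q0 by (simp add: cinner_linear)
    qed
    then show ?thesis by blast
  qed
qed

lemma bounded_clinearI:
  assumes "\<And>x y. T (x + y) = T x + T y" "\<And>a x. T (a *\<^sub>C x) = a *\<^sub>C T x"
    and "\<And>x. norm (T x) \<le> K * norm x"
  shows "bounded_clinear T"
  unfolding bounded_clinear_def
proof (intro conjI bounded_linear_intro [of _ K] allI)
  show "norm (T x) \<le> norm x * K" for x using assms(3) [of x] by (simp add: mult.commute)
  show "T (r *\<^sub>R x) = r *\<^sub>R T x" for r x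
    unfolding scaleR_scaleC by (rule assms(2))
qed (fact assms(1) assms(2))+

lemma bounded_clinear_add: "bounded_clinear T \<Longrightarrow> T (x + y) = T x + T y"
  and bounded_clinear_diff: "bounded_clinear T \<Longrightarrow> T (x - y) = T x - T y"
  and bounded_clinear_zero: "bounded_clinear T \<Longrightarrow> T 0 = 0"
  and bounded_clinear_scaleC: "bounded_clinear T \<Longrightarrow> T (a *\<^sub>C x) = a *\<^sub>C T x"
  unfolding bounded_clinear_def
  by (blast intro: linear_add linear_diff linear_0 bounded_linear.linear)+

lemma bounded_clinear_bound:
  assumes "bounded_clinear T"
  obtains K where "K > 0" "\<And>x. norm (T x) \<le> K * norm x"
proof -
  have "bounded_linear T" using assms by (simp add: bounded_clinear_def)
  then obtain K where "K > 0" "\<And>x. norm (T x) \<le> norm x * K"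
    using bounded_linear.pos_bounded by blast
  then show ?thesis using that by (metis mult.commute)
qed

lemma cadjoint_unique:
  assumes "\<And>x y. cinner (T x) y = cinner x (T' y)"
  shows "cadjoint T = T'"
  unfolding cadjoint_def
proof (rule the_equality)
  show "\<forall>x y. cinner (T x) y = cinner x (T' y)" using assms by blast
  fix T'' assume "\<forall>x y. cinner (T x) y = cinner x (T'' y)"
  then have "cinner x (T'' y) = cinner x (T' y)" for x y using assms by metis
  then show "T'' = T'" by (intro ext cinner_ext_left)
qed

lemma cinner_cadjoint:
  fixes T :: "'a::complex_hilbert \<Rightarrow> 'b::complex_inner"
  assumes T: "bounded_clinear T"
  shows "cinner (T x) y = cinner x (cadjoint T y)"
proof -
  obtain K where K: "K > 0" "\<And>x. norm (T x) \<le> K * norm x" using bounded_clinear_bound [OF T] by blast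
  have "\<exists>z. \<forall>x. cinner (T x) y = cinner x z" for y
  proof (rule riesz_representation [of "\<lambda>x. cinner (T x) y" "K * norm y"])
    fix x
    have "cmod (cinner (T x) y) \<le> K * norm x * norm y"
      using order_trans [OF cmod_cinner_le mult_right_mono [OF K(2)]] by simp
    then show "cmod (cinner (T x) y) \<le> K * norm y * norm x" by (simp only: mult_ac)
  qed (simp_all add: bounded_clinear_add [OF T] bounded_clinear_scaleC [OF T] cinner_linear)
  then obtain T' where T': "\<And>x y. cinner (T x) y = cinner x (T' y)" by metis
  then show ?thesis using cadjoint_unique [of T T'] by simp
qed

lemma cinner_cadjoint_left:
  fixes T :: "'a::complex_hilbert \<Rightarrow> 'b::complex_inner"
  assumes T: "bounded_clinear T"
  shows "cinner (cadjoint T y) x = cinner y (T x)"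
  by (metis T cinner_cadjoint cinner_commute)

lemma bounded_clinear_cadjoint:
  fixes T :: "'a::complex_hilbert \<Rightarrow> 'b::complex_inner"
  assumes T: "bounded_clinear T"
  shows "bounded_clinear (cadjoint T)"
proof -
  obtain K where K: "K > 0" "\<And>x. norm (T x) \<le> K * norm x" using bounded_clinear_bound [OF T] by blast
  show ?thesis
  proof (rule bounded_clinearI [of _ K])
    show "cadjoint T (x + y) = cadjoint T x + cadjoint T y" for x y
      by (rule cinner_ext) (simp add: cinner_cadjoint_left [OF T] cinner_linear)
    show "cadjoint T (a *\<^sub>C x) = a *\<^sub>C cadjoint T x" for a x
      by (rule cinner_ext) (simp add: cinner_cadjoint_left [OF T] cinner_linear)
    show "norm (cadjoint T x) \<le> K * norm x" for x
    proof -
      let ?y = "cadjoint T x"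
      have "norm ?y * norm ?y = cmod (cinner ?y ?y)"
        by (simp add: cinner_self norm_mult power2_eq_square)
      also have "\<dots> = cmod (cinner x (T ?y))" by (simp add: cinner_cadjoint_left [OF T])
      also have "\<dots> \<le> norm x * (K * norm ?y)"
        using order_trans [OF cmod_cinner_le mult_left_mono [OF K(2)]] by simp
      finally have "norm ?y * norm ?y \<le> (K * norm x) * norm ?y" by (simp add: mult_ac)
      then show ?thesis
        by (cases "?y = 0") (use K in \<open>auto simp: mult_le_cancel_right\<close>)
    qed
  qed
qed

subsection \<open>Operators bounded from below\<close>

lemma csubspace_subspace: "csubspace M \<Longrightarrow> subspace M"
  by (simp add: subspace_def csubspace_def scaleR_scaleC)

lemma csubspace_image:
  assumes T: "bounded_clinear T" and M: "csubspace M"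
  shows "csubspace (T ` M)"
proof (rule csubspaceI)
  show "0 \<in> T ` M"
    using csubspace_0 [OF M] bounded_clinear_zero [OF T] by (metis imageI)
  show "x + y \<in> T ` M" if "x \<in> T ` M" "y \<in> T ` M" for x y
    using that csubspace_add [OF M] by (auto simp flip: bounded_clinear_add [OF T])
  show "a *\<^sub>C x \<in> T ` M" if "x \<in> T ` M" for a x
    using that csubspace_scaleC [OF M] by (auto simp flip: bounded_clinear_scaleC [OF T])
qed

lemma csubspace_UNIV: "csubspace UNIV"
  by (simp add: csubspace_def)

text \<open>The lower bound pulls Cauchy sequences in the image back to \<open>M\<close>, so the
  image is complete.\<close>

lemma closed_csubspace_image:
  fixes T :: "'a::complex_hilbert \<Rightarrow> 'b::complex_inner"
  assumes T: "bounded_clinear T" and M: "closed_csubspace M"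
    and c: "c > 0" "\<And>x. x \<in> M \<Longrightarrow> c * norm x \<le> norm (T x)"
  shows "closed_csubspace (T ` M)"
proof -
  have "complete (T ` M)"
    using assms by (intro complete_isometric_image [of c])
      (auto simp: bounded_clinear_def closed_csubspace_def csubspace_subspace complete_eq_closed)
  then show ?thesis
    using T M by (auto simp: closed_csubspace_def csubspace_image intro: complete_imp_closed)
qed

text \<open>The Lax-Milgram argument: coercivity bounds \<open>T\<close> from below, hence the range
  is closed, and a vector orthogonal to the range makes its own quadratic form vanish.\<close>

lemma coercive_bij:
  fixes T :: "'a::complex_hilbert \<Rightarrow> 'a"
  assumes T: "bounded_clinear T" and c: "c > 0" "\<And>x. c * (norm x)\<^sup>2 \<le> cmod (cinner (T x) x)"
  shows "bij T"
proof (rule bijI)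
  have below: "c * norm x \<le> norm (T x)" for x
  proof -
    have "c * norm x * norm x \<le> norm (T x) * norm x"
      using order_trans [OF c(2) cmod_cinner_le, of x] by (simp add: power2_eq_square mult.assoc)
    then show ?thesis by (cases "x = 0") (auto simp: mult_le_cancel_right)
  qed
  show "inj T"
  proof (rule injI)
    fix x y assume "T x = T y"
    then have "c * norm (x - y) \<le> 0" using below [of "x - y"] by (simp add: bounded_clinear_diff [OF T])
    then show "x = y" using c(1) by (simp add: mult_le_0_iff)
  qed
  have cl: "closed_csubspace (range T)"
    by (rule closed_csubspace_image [OF T _ c(1) below])
      (simp add: closed_csubspace_def csubspace_UNIV)
  have "y \<in> range T" for y
  proof -
    obtain p where p: "p \<in> range T" and orth: "\<And>z. z \<in> range T \<Longrightarrow> cinner (y - p) z = 0"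
      using orth_decomposition [OF cl, of y] by blast
    have "cinner (T (y - p)) (y - p) = 0" using orth [of "T (y - p)"] cinner_eq_0_commute by blast
    then have "c * (norm (y - p))\<^sup>2 \<le> 0" using c(2) [of "y - p"] by simp
    then have "y = p" using c(1) by (simp add: mult_le_0_iff)
    then show ?thesis using p by simp
  qed
  then show "surj T" by blast
qed

text \<open>By the gliding hump argument.\<close>

lemma weakly_bounded_imp_bounded:
  fixes X :: "'a::complex_hilbert set"
  assumes weak: "\<And>u. \<exists>K. \<forall>n\<in>X. cmod (cinner u n) \<le> K"
  shows "\<exists>C>0. \<forall>n\<in>X. norm n \<le> C"
proof (rule ccontr)
  assume neg: "\<not> (\<exists>C>0. \<forall>n\<in>X. norm n \<le> C)"
  \<comment> \<open>The threshold fits the final estimate: the partial sum through hump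
    \<open>k\<close> pairs with \<open>n k\<close> to at least \<open>norm (n k) / 3 ^ k\<close>,
    the later humps take away at most half of this, and \<open>Suc k\<close> must remain.\<close>
  have "\<exists>n\<in>X. norm n > 2 * real (Suc k) * 3 ^ k" for k
  proof -
    have "(0 :: real) < 2 * real (Suc k) * 3 ^ k" by simp
    with neg show ?thesis by (meson not_le)
  qed
  then obtain n where nX: "\<And>k. n k \<in> X" and n: "\<And>k. norm (n k) > 2 * real (Suc k) * 3 ^ k" by metis
  have npos: "norm (n k) > 0" for k
    by (rule le_less_trans [OF _ n]) simp
  define v where "v k = complex_of_real (1 / 3 ^ k / norm (n k)) *\<^sub>C n k" for k
  \<comment> \<open>Of the two signs for the new hump, at least one gives a pairing with
    \<open>n k\<close> no smaller than that of the hump alone, by the triangle inequality.\<close>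
  define U where "U = rec_nat 0 (\<lambda>k u. if cmod (cinner (v k) (n k)) \<le> cmod (cinner (u + v k) (n k))
      then u + v k else u - v k)"
  have U_Suc: "U (Suc k) = (if cmod (cinner (v k) (n k)) \<le> cmod (cinner (U k + v k) (n k))
      then U k + v k else U k - v k)" for k
    by (simp add: U_def)
  have vn: "cinner (v k) (n k) = complex_of_real (norm (n k) / 3 ^ k)" for k
    using npos [of k] by (simp add: v_def cinner_linear cinner_self power2_eq_square)
  have norm_v: "norm (v k) = 1 / 3 ^ k" for k
    using npos [of k] by (simp add: v_def norm_divide norm_mult norm_power)
  have big: "norm (n k) / 3 ^ k \<le> cmod (cinner (U (Suc k)) (n k))" for k
  proof -

    have "2 * cinner (v k) (n k) = cinner (U k + v k) (n k) - cinner (U k - v k) (n k)"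
      by (simp add: cinner_linear)
    then have "2 * cmod (cinner (v k) (n k)) \<le> cmod (cinner (U k + v k) (n k)) + cmod (cinner (U k - v k) (n k))"
      by (metis norm_mult norm_numeral norm_triangle_ineq4)
    then have "cmod (cinner (v k) (n k)) \<le> cmod (cinner (U (Suc k)) (n k))"
      by (simp add: U_Suc)
    then show ?thesis by (simp add: vn norm_divide norm_power)
  qed
  have step: "norm (U (Suc k) - U k) = 1 / 3 ^ k" for k
    by (simp add: U_Suc norm_v)
  have tail: "norm (U m - U j) \<le> 3 / 2 * (1 / 3 ^ j - 1 / 3 ^ m)" if "j \<le> m" for j m
    using that
  proof (induction m rule: dec_induct)
    case (step m)
    have "norm (U (Suc m) - U j) \<le> norm (U (Suc m) - U m) + norm (U m - U j)"
      using norm_triangle_ineq [of "U (Suc m) - U m" "U m - U j"] by simp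
    also have "\<dots> \<le> 1 / 3 ^ m + 3 / 2 * (1 / 3 ^ j - 1 / 3 ^ m)"
      using step.IH \<open>\<And>k. norm (U (Suc k) - U k) = 1 / 3 ^ k\<close> [of m] by simp
    also have "\<dots> = 3 / 2 * (1 / 3 ^ j - 1 / 3 ^ Suc m)" by (simp add: right_diff_distrib)
    finally show ?case .
  qed simp
  have tail': "norm (U m - U j) \<le> 3 / 2 * (1 / 3) ^ j" if "j \<le> m" for j m
  proof -
    have "3 / 2 * (1 / 3 ^ j - 1 / 3 ^ m) \<le> 3 / 2 * ((1 / 3 :: real) ^ j)"
      by (simp add: power_one_over)
    then show ?thesis using tail [OF that] by linarith
  qed
  have "Cauchy U"
  proof (rule metric_CauchyI)
    fix e :: real assume e: "0 < e"
    have "(\<lambda>j. 3 / 2 * (1 / 3 :: real) ^ j) \<longlonglongrightarrow> 3 / 2 * 0"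
      by (intro tendsto_intros LIMSEQ_power_zero) simp
    then have "\<forall>\<^sub>F j in sequentially. 3 / 2 * (1 / 3 :: real) ^ j < e / 2"
      by (rule order_tendstoD(2)) (use e in simp)
    then obtain J where J: "3 / 2 * (1 / 3 :: real) ^ J < e / 2"
      unfolding eventually_sequentially by blast
    have "dist (U m) (U k) < e" if "m \<ge> J" "k \<ge> J" for m k
    proof -
      have "dist (U m) (U k) \<le> dist (U m) (U J) + dist (U k) (U J)" by (rule dist_triangle2)
      then show ?thesis using tail' [OF that(1)] tail' [OF that(2)] J by (simp add: dist_norm)
    qed
    then show "\<exists>M. \<forall>m\<ge>M. \<forall>n\<ge>M. dist (U m) (U n) < e" by blast
  qed
  then obtain u where u: "U \<longlonglongrightarrow> u" by (meson Cauchy_convergent convergent_def)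
  have lim: "norm (u - U (Suc k)) \<le> 1 / 2 * (1 / 3) ^ k" for k
  proof (rule tendsto_upperbound)
    show "(\<lambda>m. norm (U m - U (Suc k))) \<longlonglongrightarrow> norm (u - U (Suc k))" by (intro tendsto_intros u)
    have "norm (U m - U (Suc k)) \<le> 1 / 2 * (1 / 3) ^ k" if "Suc k \<le> m" for m
      using tail' [OF that] by simp
    then show "\<forall>\<^sub>F m in sequentially. norm (U m - U (Suc k)) \<le> 1 / 2 * (1 / 3) ^ k"
      unfolding eventually_sequentially by blast
  qed simp
  have "real (Suc k) \<le> cmod (cinner u (n k))" for k
  proof -
    have "cinner (U (Suc k)) (n k) = cinner u (n k) - cinner (u - U (Suc k)) (n k)"
      by (simp add: cinner_linear)
    then have "cmod (cinner (U (Suc k)) (n k)) \<le> cmod (cinner u (n k)) + cmod (cinner (u - U (Suc k)) (n k))"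
      by (metis norm_triangle_ineq4)
    also have "\<dots> \<le> cmod (cinner u (n k)) + 1 / 2 * (1 / 3) ^ k * norm (n k)"
      using order_trans [OF cmod_cinner_le mult_right_mono [OF lim]] by simp
    also have "1 / 2 * (1 / 3) ^ k * norm (n k) = norm (n k) / 3 ^ k / 2"
      by (simp add: power_one_over)
    finally have "norm (n k) / 3 ^ k / 2 \<le> cmod (cinner u (n k))"
      using big [of k] by linarith
    moreover have "real (Suc k) \<le> norm (n k) / 3 ^ k / 2"
      using less_imp_le [OF n [of k]] by (simp add: pos_le_divide_eq algebra_simps)
    ultimately show ?thesis by linarith
  qed
  note large = this
  obtain K where K: "\<forall>n\<in>X. cmod (cinner u n) \<le> K" using weak by blast
  obtain k where "K < real k" using reals_Archimedean2 by blast
  moreover have "cmod (cinner u (n k)) \<le> K" using K nX by blast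
  ultimately show False using large [of k] by simp
qed

text \<open>The bounded inverse theorem by duality. On the range of \<open>T\<close>, the vectors
  with adjoint image in the unit ball are weakly bounded, since \<open>u\<close> with projection
  \<open>T x\<close> pairs with \<open>n\<close> as \<open>cinner x (?S n)\<close>; hence the
  adjoint is bounded below there. By injectivity of \<open>T\<close> the adjoint maps that range
  onto the whole space, and \<open>cinner x x = cinner (T x) n\<close> with \<open>x = ?S n\<close>
  returns a lower bound for \<open>T\<close>.\<close>

lemma closed_range_bounded_below:
  fixes T :: "'a::complex_hilbert \<Rightarrow> 'b::complex_hilbert"
  assumes T: "bounded_clinear T" and inj: "inj T" and cl: "closed (range T)"
  obtains c where "c > 0" "\<And>x. c * norm x \<le> norm (T x)"
proof -
  have N: "closed_csubspace (range T)"
    using cl csubspace_image [OF T csubspace_UNIV] by (simp add: closed_csubspace_def)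
  let ?S = "cadjoint T"
  have S: "bounded_clinear ?S" by (rule bounded_clinear_cadjoint [OF T])
  have "\<exists>K. \<forall>n\<in>{n \<in> range T. norm (?S n) \<le> 1}. cmod (cinner u n) \<le> K" for u
  proof -
    obtain p where p: "p \<in> range T" and orth: "\<And>z. z \<in> range T \<Longrightarrow> cinner (u - p) z = 0"
      using orth_decomposition [OF N, of u] by blast
    obtain x where x: "p = T x" using p by blast
    have "cmod (cinner u n) \<le> norm x" if n: "n \<in> range T" "norm (?S n) \<le> 1" for n
    proof -
      have "cinner u n = cinner x (?S n)"
        using orth [OF n(1)] by (simp add: cinner_linear x cinner_cadjoint [OF T])
      then have "cmod (cinner u n) \<le> norm x * norm (?S n)" by (simp add: cmod_cinner_le)
      also have "\<dots> \<le> norm x * 1" using n(2) by (intro mult_left_mono) auto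
      finally show ?thesis by simp
    qed
    then show ?thesis by blast
  qed
  then have "\<exists>C>0. \<forall>n\<in>{n \<in> range T. norm (?S n) \<le> 1}. norm n \<le> C"
    by (rule weakly_bounded_imp_bounded)
  then obtain C where C: "C > 0" "\<And>n. n \<in> range T \<Longrightarrow> norm (?S n) \<le> 1 \<Longrightarrow> norm n \<le> C"
    by blast
  have below: "norm n \<le> C * norm (?S n)" if n: "n \<in> range T" for n
  proof (cases "?S n = 0")
    case True
    have "cinner z n = 0" if "z \<in> range T" for z
      using that True by (auto simp: cinner_cadjoint [OF T])
    then have "n = 0" using n cinner_self_eq_0 by blast
    then show ?thesis using C by simp
  next
    case False
    let ?a = "complex_of_real (1 / norm (?S n))"
    have "?a *\<^sub>C n \<in> range T" using n N by (auto simp: closed_csubspace_def intro: csubspace_intros)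
    moreover have "norm (?S (?a *\<^sub>C n)) \<le> 1"
      using False by (simp add: bounded_clinear_scaleC [OF S] norm_divide)
    ultimately have "norm (?a *\<^sub>C n) \<le> C" by (rule C(2))
    then show ?thesis using False by (simp add: norm_divide field_simps)
  qed
  have W: "closed_csubspace (?S ` range T)"
    by (rule closed_csubspace_image [OF S N, of "1 / C"]) (use C below in \<open>auto simp: field_simps\<close>)
  have onto: "\<exists>n\<in>range T. x = ?S n" for x
  proof -
    obtain p where p: "p \<in> ?S ` range T" and orth: "\<And>z. z \<in> ?S ` range T \<Longrightarrow> cinner (x - p) z = 0"
      using orth_decomposition [OF W, of x] by blast
    have "cinner (T (x - p)) (T (x - p)) = cinner (x - p) (?S (T (x - p)))"
      by (rule cinner_cadjoint [OF T])
    also have "\<dots> = 0" by (rule orth) blast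
    finally have "T (x - p) = T 0" by (simp add: bounded_clinear_zero [OF T])
    then have "x = p" using injD [OF inj] by fastforce
    then show ?thesis using p by blast
  qed
  have "1 / C * norm x \<le> norm (T x)" for x
  proof -
    obtain n where n: "n \<in> range T" "x = ?S n" using onto by blast
    have "norm x * norm x = cmod (cinner x x)" by (simp add: cinner_self norm_mult power2_eq_square)
    also have "\<dots> = cmod (cinner (T x) n)" using n cinner_cadjoint [OF T] by metis
    also have "\<dots> \<le> norm (T x) * norm n" by (rule cmod_cinner_le)
    also have "\<dots> \<le> norm (T x) * (C * norm x)" using below n by (intro mult_left_mono) auto
    finally have "norm x * norm x \<le> (C * norm (T x)) * norm x" by (simp add: mult_ac)
    then have "norm x \<le> C * norm (T x)"
      using C(1) by (cases "x = 0") (auto simp: mult_le_cancel_right)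
    then show ?thesis using C(1) by (simp add: field_simps)
  qed
  then show ?thesis using that [of "1 / C"] C(1) by simp
qed

subsection \<open>Gram matrices\<close>

lemma cinner_sum_left: "cinner (\<Sum>i\<in>F. f i) x = (\<Sum>i\<in>F. cinner (f i) x)"
  for x :: "'a::complex_inner"
  by (induction F rule: infinite_finite_induct) (simp_all add: cinner_add_left)

lemma cinner_sum_right: "cinner x (\<Sum>i\<in>F. f i) = (\<Sum>i\<in>F. cinner x (f i))"
  for x :: "'a::complex_inner"
  by (induction F rule: infinite_finite_induct) (simp_all add: cinner_add_right)

text \<open>The hypothesis \<open>normalised\<close> allows each vector to be a unit vector or zero,
  which is what Gram-Schmidt delivers for a family with dependent members.\<close>

lemma bessel_inequality:
  fixes e :: "'i \<Rightarrow> 'a::complex_inner"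
  assumes orth: "\<And>i j. i \<noteq> j \<Longrightarrow> cinner (e i) (e j) = 0"
    and normalised: "\<And>i w. cinner (e i) (e i) * cinner (e i) w = cinner (e i) w"
    and F: "finite F"
  shows "(\<Sum>i\<in>F. (cmod (cinner v (e i)))\<^sup>2) \<le> (norm v)\<^sup>2"
proof -
  define B where "B = (\<Sum>i\<in>F. (cmod (cinner v (e i)))\<^sup>2)"
  define s where "s = (\<Sum>i\<in>F. cinner v (e i) *\<^sub>C e i)"
  have vs: "cinner v s = complex_of_real B"
    unfolding s_def cinner_sum_right B_def of_real_sum
    by (intro sum.cong refl) (simp add: cinner_scaleC_right complex_norm_square mult.commute del: of_real_power)
  have es: "cinner (e i) s = cinner (e i) v" if "i \<in> F" for i
  proof -
    have "cinner (e i) s = (\<Sum>j\<in>F. if j = i then cnj (cinner v (e i)) * cinner (e i) (e i) else 0)"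
      unfolding s_def cinner_sum_right
      by (intro sum.cong refl) (use orth in \<open>auto simp: cinner_scaleC_right\<close>)
    also have "\<dots> = cinner (e i) (e i) * cinner (e i) v"
      using F that by (simp add: cinner_commute [of "e i" v] mult.commute)
    finally show ?thesis by (simp add: normalised)
  qed
  have "cinner s s = (\<Sum>i\<in>F. cinner v (e i) * cinner (e i) s)"
    by (simp add: s_def cinner_sum_left cinner_scaleC_left)
  also have "\<dots> = (\<Sum>i\<in>F. cinner v (e i) * cinner (e i) v)"
    by (intro sum.cong refl) (simp add: es)
  also have "\<dots> = complex_of_real B"
    unfolding B_def of_real_sum
    by (intro sum.cong refl) (simp add: complex_norm_square cinner_commute [of _ v] del: of_real_power)
  finally have ss: "cinner s s = complex_of_real B" .
  have "cinner (v - s) (v - s) = cinner v v - cinner v s - cnj (cinner v s) + cinner s s"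
    by (simp add: cinner_linear cinner_commute [of s v])
  also have "\<dots> = complex_of_real ((norm v)\<^sup>2 - B)"
    unfolding vs ss cinner_self [of v] by simp
  finally have "(norm (v - s))\<^sup>2 = (norm v)\<^sup>2 - B"
    unfolding cinner_self by (simp only: of_real_eq_iff)
  then have "0 \<le> (norm v)\<^sup>2 - B" by (metis zero_le_power2)
  then show ?thesis by (simp add: B_def)
qed

text \<open>
  The Gram--Schmidt process along a well-order of the index set; vectors depending on their
  predecessors yield zero entries of the orthonormal family (\<open>1 / 0 = 0\<close>).
\<close>

lemma gram_matrix_in_ell2:
  fixes a :: "'i \<Rightarrow> 'h::complex_hilbert"
  shows "\<exists>b :: 'i \<Rightarrow> 'i ell2. \<forall>i j. cinner (b i) (b j) = cinner (a i) (a j)"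
proof -
  obtain r :: "'i rel" where r: "well_order_on UNIV r" using well_order_on by blast
  have wf: "wf (r - Id)" and total: "total_on UNIV r" and tr: "trans r" and anti: "antisym r"
    using r unfolding well_order_on_def linear_order_on_def partial_order_on_def preorder_on_def
    by blast+
  have tot: "(i, j) \<in> r - Id \<or> (j, i) \<in> r - Id" if "i \<noteq> j" for i j
    using total that by (auto simp: total_on_def)
  have trans: "(i, k) \<in> r - Id" if "(i, j) \<in> r - Id" "(j, k) \<in> r - Id" for i j k
    using that by (metis DiffD1 DiffD2 DiffI IdI antisymD [OF anti] pair_in_Id_conv transD [OF tr])
  \<comment> \<open>An initial segment of the well-order may be infinite, so the span of the strict
    predecessors is closed before projecting onto it.\<close>
  define M where "M i = closed_cspan (a ` {j. (j, i) \<in> r - Id})" for i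
  have "\<exists>y\<in>M i. \<forall>z\<in>M i. cinner (a i - y) z = 0" for i
    unfolding M_def by (rule orth_decomposition [OF closed_csubspace_closed_cspan])
  then obtain p where p: "\<And>i. p i \<in> M i" and porth: "\<And>i z. z \<in> M i \<Longrightarrow> cinner (a i - p i) z = 0"
    by metis
  define e where "e i = complex_of_real (1 / norm (a i - p i)) *\<^sub>C (a i - p i)" for i
  have a_eq: "a i = p i + complex_of_real (norm (a i - p i)) *\<^sub>C e i" for i
    by (cases "a i = p i") (simp_all add: e_def scaleC_scaleC)
  have e_orth: "cinner (e i) z = 0" if "z \<in> M i" for i z
    using porth [OF that] by (simp add: e_def cinner_scaleC_left)
  have cs: "csubspace (M i)" for i
    using closed_csubspace_closed_cspan [of "a ` {j. (j, i) \<in> r - Id}"]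
    by (simp add: M_def closed_csubspace_def)
  have e_in: "e i \<in> M j" if ij: "(i, j) \<in> r - Id" for i j
  proof -
    have sub: "a ` {k. (k, j) \<in> r - Id} \<subseteq> M j" unfolding M_def by (rule closed_cspan_superset)
    then have "a i \<in> M j" using ij by blast
    moreover have "a ` {k. (k, i) \<in> r - Id} \<subseteq> M j" using sub trans [OF _ ij] by blast
    then have "M i \<subseteq> M j"
      unfolding M_def by (intro closed_cspan_minimal closed_csubspace_closed_cspan)
    ultimately show ?thesis
      unfolding e_def using p [of i] by (intro csubspace_scaleC csubspace_diff cs) auto
  qed
  have orth: "cinner (e i) (e j) = 0" if "i \<noteq> j" for i j
    using tot [OF that] e_orth [OF e_in] cinner_eq_0_commute [of "e i" "e j"] by blast
  have normalised: "cinner (e i) (e i) * cinner (e i) w = cinner (e i) w" for i w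
  proof (cases "a i = p i")
    case True
    then show ?thesis by (simp add: e_def)
  next
    case False
    then have "norm (e i) = 1" by (simp add: e_def norm_divide)
    then show ?thesis by (simp add: cinner_self)
  qed
  note bessel = bessel_inequality [OF orth normalised]
  have summable: "(\<lambda>i. (cmod (cinner v (e i)))\<^sup>2) summable_on UNIV" for v
  proof (rule nonneg_bdd_above_summable_on)
    show "bdd_above (sum (\<lambda>i. (cmod (cinner v (e i)))\<^sup>2) ` {F. F \<subseteq> UNIV \<and> finite F})"
      by (rule bdd_aboveI2 [of _ _ "(norm v)\<^sup>2"]) (simp add: bessel)
  qed simp
  define V where "V v = Abs_ell2 (\<lambda>i. cinner v (e i))" for v
  have coord: "ell2_coord (V v) i = cinner v (e i)" for v i
    by (simp add: V_def Abs_ell2_inverse summable)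
  have V: "bounded_clinear V"
  proof (rule bounded_clinearI [of _ 1])
    show "V (x + y) = V x + V y" for x y
      by (rule ell2_eqI) (simp add: coord coord_simps cinner_add_left)
    show "V (c *\<^sub>C x) = c *\<^sub>C V x" for c x
      by (rule ell2_eqI) (simp add: coord coord_simps cinner_scaleC_left)
    have le: "(norm (V x))\<^sup>2 \<le> (norm x)\<^sup>2" for x
      unfolding norm_ell2_square coord
      by (rule infsum_le_finite_sums [OF summable]) (rule bessel)
    show "norm (V x) \<le> 1 * norm x" for x
      using power2_le_imp_le [OF le [of x] norm_ge_zero] by simp
  qed
  \<comment> \<open>The coordinate map \<open>V\<close> is only a contraction on the whole space.
    The vectors whose inner products with everything it preserves form a closed subspace; it
    contains all \<open>e i\<close>, and well-founded induction then puts every \<open>a i\<close>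
    into it.\<close>
  define Z where "Z = {v. \<forall>w. cinner (V v) (V w) = cinner v w}"
  have Z: "closed_csubspace Z"
    unfolding closed_csubspace_def
  proof
    show "csubspace Z"
    proof (rule csubspaceI)
      show "0 \<in> Z" by (simp add: Z_def bounded_clinear_zero [OF V])
      show "x + y \<in> Z" if "x \<in> Z" "y \<in> Z" for x y
        using that unfolding Z_def mem_Collect_eq bounded_clinear_add [OF V] cinner_add_left by metis
      show "c *\<^sub>C x \<in> Z" if "x \<in> Z" for c x
        using that unfolding Z_def mem_Collect_eq bounded_clinear_scaleC [OF V] cinner_scaleC_left by metis
    qed
    show "closed Z"
      unfolding closed_sequential_limits
    proof (intro allI impI, elim conjE)
      fix f l assume f: "\<forall>n. f n \<in> Z" and lim: "f \<longlonglongrightarrow> l"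
      have Vlim: "(\<lambda>n. V (f n)) \<longlonglongrightarrow> V l"
        by (rule bounded_linear.tendsto [of V]) (use V lim in \<open>simp_all add: bounded_clinear_def\<close>)
      have "cinner (V l) (V w) = cinner l w" for w
      proof (rule LIMSEQ_unique)
        show "(\<lambda>n. cinner (V (f n)) (V w)) \<longlonglongrightarrow> cinner (V l) (V w)"
          by (intro tendsto_intros Vlim)
        have "(\<lambda>n. cinner (f n) w) \<longlonglongrightarrow> cinner l w" by (intro tendsto_intros lim)
        then show "(\<lambda>n. cinner (V (f n)) (V w)) \<longlonglongrightarrow> cinner l w" using f by (simp add: Z_def)
      qed
      then show "l \<in> Z" by (simp add: Z_def)
    qed
  qed
  have eZ: "e i \<in> Z" for i
  proof -
    have "cinner (V (e i)) (V w) = cinner (e i) w" for w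
    proof -
      have "cinner (V (e i)) (V w) = infsum (\<lambda>k. cinner (e i) (e k) * cnj (cinner w (e k))) UNIV"
        by (simp add: cinner_ell2_def coord)
      also have "\<dots> = infsum (\<lambda>k. cinner (e i) (e k) * cnj (cinner w (e k))) {i}"
      proof (rule infsum_cong_neutral)
        fix k assume "k \<in> UNIV - {i}"
        then have "cinner (e i) (e k) = 0" by (intro orth) auto
        then show "cinner (e i) (e k) * cnj (cinner w (e k)) = 0" by simp
      qed simp_all
      also have "\<dots> = cinner (e i) (e i) * cnj (cinner w (e i))" by simp
      also have "\<dots> = cinner (e i) w"
        using normalised [of i w] by (simp add: cinner_commute [of "e i" w])
      finally show ?thesis .
    qed
    then show ?thesis by (simp add: Z_def)
  qed
  have csZ: "csubspace Z" using Z by (simp add: closed_csubspace_def)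
  have aZ: "a i \<in> Z" for i
    using wf
  proof (induction i rule: wf_induct_rule)
    case (less i)
    have "M i \<subseteq> Z" unfolding M_def by (rule closed_cspan_minimal [OF Z]) (use less in blast)
    then have "p i \<in> Z" using p by blast
    then have "p i + complex_of_real (norm (a i - p i)) *\<^sub>C e i \<in> Z"
      by (intro csubspace_add [OF csZ] csubspace_scaleC [OF csZ] eZ)
    then show ?case by (simp flip: a_eq)
  qed
  show ?thesis
    by (rule exI [of _ "\<lambda>i. V (a i)"]) (use aZ in \<open>simp add: Z_def\<close>)
qed

text \<open>
  The closed span of the pairs \<open>(a i, b i)\<close> is the graph of an isometry, and projecting
  \<open>(h, 0)\<close> onto it gives half of the image of \<open>h\<close>.
\<close>

lemma gram_transfer:
  fixes a :: "'i \<Rightarrow> 'h::complex_hilbert" and b :: "'i \<Rightarrow> 'k::complex_hilbert"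
  assumes gram: "\<And>i j. cinner (a i) (a j) = cinner (b i) (b j)"
  shows "\<exists>k. \<forall>i. cinner k (b i) = cinner h (a i)"
proof -
  define L where "L = closed_cspan (range (\<lambda>i. (a i, b i)))"
  \<comment> \<open>The sign flip expresses equality of the two Gram matrices as orthogonality, a
    closed condition that passes to \<open>L\<close>.\<close>
  have sub: "L \<subseteq> {v. \<forall>x\<in>range (\<lambda>i. (a i, - b i)). cinner v x = 0}"
    unfolding L_def
  proof (rule closed_cspan_minimal [OF closed_csubspace_orthogonal], safe)
    fix j i
    show "cinner (a j, b j) (a i, - b i) = 0" by (simp add: cinner_minus_right gram [of j i])
  qed
  have L: "cinner u (a i) = cinner v (b i)" if "(u, v) \<in> L" for u v i
  proof -
    have "cinner (u, v) (a i, - b i) = 0" using subsetD [OF sub that] by blast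
    then show ?thesis by (simp add: cinner_minus_right)
  qed
  have "\<exists>y\<in>L. \<forall>z\<in>L. cinner ((h, 0) - y) z = 0"
    unfolding L_def by (rule orth_decomposition [OF closed_csubspace_closed_cspan])
  then obtain q where q: "q \<in> L" and qorth: "\<forall>z\<in>L. cinner ((h, 0) - q) z = 0" by blast
  obtain u v where quv: "q = (u, v)" by (cases q)
  have uv: "(u, v) \<in> L" and orth: "\<And>z. z \<in> L \<Longrightarrow> cinner ((h, 0) - (u, v)) z = 0"
    using q qorth unfolding quv by blast+
  have "cinner (2 *\<^sub>C v) (b i) = cinner h (a i)" for i
  proof -
    have "(a i, b i) \<in> L" unfolding L_def by (rule subsetD [OF closed_cspan_superset]) (rule rangeI)
    then have "cinner ((h, 0) - (u, v)) (a i, b i) = 0" by (rule orth)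
    then have "cinner h (a i) = cinner u (a i) + cinner v (b i)"
      by (simp add: cinner_diff_left cinner_minus_left algebra_simps)
    then show ?thesis using L [OF uv, of i] by (simp add: cinner_scaleC_left)
  qed
  then show ?thesis by blast
qed

section \<open>Self-adjoint relations\<close>

lemma rel_shift_iff: "(x, y) \<in> rel_shift A z \<longleftrightarrow> (x, y + z *\<^sub>C x) \<in> A"
  unfolding rel_shift_def
proof safe
  fix x' y'
  assume "(x', y') \<in> A"
  then show "(x', y' - z *\<^sub>C x' + z *\<^sub>C x') \<in> A" by simp
next
  assume "(x, y + z *\<^sub>C x) \<in> A"
  then show "\<exists>x' y'. (x, y) = (x', y' - z *\<^sub>C x') \<and> (x', y') \<in> A"
    by (intro exI [of _ x] exI [of _ "y + z *\<^sub>C x"]) simp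
qed

lemma scaleC_cancel: "a \<noteq> 0 \<Longrightarrow> a *\<^sub>C x = a *\<^sub>C y \<Longrightarrow> x = y" for x :: "'a::complex_inner"
  by (metis left_inverse scaleC_one scaleC_scaleC)

locale self_adjoint_relation =
  fixes H :: "'h::complex_hilbert set" and A :: "('h \<times> 'h) set"
  assumes H: "closed_csubspace H" and self_adjoint: "self_adjoint_rel H A"
begin

lemma csubspace_H: "csubspace H"
  using H by (simp add: closed_csubspace_def)

lemma A_memI:
  assumes "f \<in> H" "g \<in> H" "\<And>u v. (u, v) \<in> A \<Longrightarrow> cinner v f = cinner u g"
  shows "(f, g) \<in> A"
proof -
  have "(f, g) \<in> rel_adjoint H A" using assms unfolding rel_adjoint_def by blast
  then show ?thesis using self_adjoint by (simp add: self_adjoint_rel_def)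
qed

lemma A_sub: "(f, g) \<in> A \<Longrightarrow> f \<in> H" "(f, g) \<in> A \<Longrightarrow> g \<in> H"
  using self_adjoint unfolding self_adjoint_rel_def by blast+

lemma symmetric:
  assumes "(f, g) \<in> A" "(f', g') \<in> A"
  shows "cinner g f' = cinner f g'"
proof -
  have "(f', g') \<in> rel_adjoint H A" using assms self_adjoint by (simp add: self_adjoint_rel_def)
  then show ?thesis using assms(1) unfolding rel_adjoint_def by blast
qed

lemma A_add: "(f, g) \<in> A \<Longrightarrow> (f', g') \<in> A \<Longrightarrow> (f + f', g + g') \<in> A"
  by (rule A_memI) (simp_all add: A_sub csubspace_add [OF csubspace_H] cinner_add_right symmetric)

lemma A_diff: "(f, g) \<in> A \<Longrightarrow> (f', g') \<in> A \<Longrightarrow> (f - f', g - g') \<in> A"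
  by (rule A_memI) (simp_all add: A_sub csubspace_diff [OF csubspace_H] cinner_diff_right symmetric)

lemma A_scaleC: "(f, g) \<in> A \<Longrightarrow> (a *\<^sub>C f, a *\<^sub>C g) \<in> A"
  by (rule A_memI) (simp_all add: A_sub csubspace_scaleC [OF csubspace_H] cinner_scaleC_right symmetric)

lemma A_zero: "(0, 0) \<in> A"
  by (rule A_memI) (simp_all add: csubspace_0 [OF csubspace_H])

text \<open>A self-adjoint relation is its own adjoint, and the equations defining an adjoint are
  linear and continuous in the pair.\<close>

lemma closed_csubspace_A: "closed_csubspace A"
  unfolding closed_csubspace_def
proof
  show "csubspace A"
  proof (rule csubspaceI)
    show "0 \<in> A" using A_zero by (simp add: zero_prod_def)
    show "x + y \<in> A" if "x \<in> A" "y \<in> A" for x y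
      using that A_add [of "fst x" "snd x" "fst y" "snd y"] by (simp add: plus_prod_def)
    show "a *\<^sub>C x \<in> A" if "x \<in> A" for a x
      using that A_scaleC [of "fst x" "snd x" a] by (simp add: scaleC_prod_def)
  qed
  show "closed A"
    unfolding closed_sequential_limits
  proof (intro allI impI, elim conjE)
    fix F l assume F: "\<forall>n. F n \<in> A" and lim: "F \<longlonglongrightarrow> l"
    have lim1: "(\<lambda>n. fst (F n)) \<longlonglongrightarrow> fst l" and lim2: "(\<lambda>n. snd (F n)) \<longlonglongrightarrow> snd l"
      by (rule tendsto_fst [OF lim], rule tendsto_snd [OF lim])
    have mem: "(fst (F n), snd (F n)) \<in> A" for n using F by simp
    have clH: "closed H" using H by (simp add: closed_csubspace_def)
    have "(fst l, snd l) \<in> A"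
    proof (rule A_memI)
      show "fst l \<in> H"
        by (rule closed_sequentially [OF clH _ lim1]) (rule A_sub(1) [OF mem])
      show "snd l \<in> H"
        by (rule closed_sequentially [OF clH _ lim2]) (rule A_sub(2) [OF mem])
      fix u v assume uv: "(u, v) \<in> A"
      have "(\<lambda>n. cinner v (fst (F n))) \<longlonglongrightarrow> cinner v (fst l)"
        by (rule tendsto_cinner_right [OF lim1])
      moreover have "(\<lambda>n. cinner u (snd (F n))) \<longlonglongrightarrow> cinner u (snd l)"
        by (rule tendsto_cinner_right [OF lim2])
      moreover have "cinner v (fst (F n)) = cinner u (snd (F n))" for n
        by (rule symmetric [OF uv mem])
      ultimately show "cinner v (fst l) = cinner u (snd l)" by (simp add: LIMSEQ_unique)
    qed
    then show "l \<in> A" by simp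
  qed
qed

text \<open>For a pair in \<open>A\<close> the number \<open>cinner g f\<close> is real, so the
  imaginary part of \<open>cinner (g - z *\<^sub>C f) f\<close> comes from the shift alone.\<close>

lemma norm_shift_ge:
  assumes "(f, g) \<in> A"
  shows "\<bar>Im z\<bar> * norm f \<le> norm (g - z *\<^sub>C f)"
proof (cases "f = 0")
  case False
  have "cinner g f = cnj (cinner g f)"
    using symmetric [OF assms assms] cinner_commute [of f g] by simp
  then have "Im (cinner g f) = 0" by (metis Reals_cnj_iff complex_is_Real_iff)
  then have "Im (cinner (g - z *\<^sub>C f) f) = - (Im z * (norm f)\<^sup>2)"
    by (simp add: cinner_diff_left cinner_scaleC_left cinner_self del: of_real_power)
  then have "\<bar>Im z\<bar> * (norm f)\<^sup>2 = \<bar>Im (cinner (g - z *\<^sub>C f) f)\<bar>" by (simp add: abs_mult)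
  also have "\<dots> \<le> norm (g - z *\<^sub>C f) * norm f"
    by (rule order_trans [OF abs_Im_le_cmod cmod_cinner_le])
  finally have "(\<bar>Im z\<bar> * norm f) * norm f \<le> norm (g - z *\<^sub>C f) * norm f"
    by (simp add: power2_eq_square mult.assoc)
  then show ?thesis using False by (simp add: mult_le_cancel_right)
qed simp

text \<open>The map \<open>(f, g)\<close> to \<open>g - z *\<^sub>C f\<close> is bounded below on
  the graph, so its range is closed. A vector of \<open>H\<close> orthogonal to the range would be
  an eigenvector of \<open>A\<close> at the nonreal point \<open>cnj z\<close>.\<close>

lemma shift_onto:
  assumes z: "Im z \<noteq> 0" and y: "y \<in> H"
  shows "\<exists>f. (f, y + z *\<^sub>C f) \<in> A"
proof -
  define T where "T p = snd p - z *\<^sub>C fst p" for p :: "'h \<times> 'h"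
  have T: "bounded_clinear T"
  proof (rule bounded_clinearI [of _ "1 + cmod z"])
    fix p q :: "'h \<times> 'h" and a
    show "T (p + q) = T p + T q" by (simp add: T_def scaleC_add_right)
    show "T (a *\<^sub>C p) = a *\<^sub>C T p"
      by (simp add: T_def scaleC_prod_def scaleC_diff_right scaleC_scaleC mult.commute)
    have "norm (T p) \<le> norm (snd p) + cmod z * norm (fst p)"
      unfolding T_def using norm_triangle_ineq4 [of "snd p" "z *\<^sub>C fst p"] by simp
    also have "\<dots> \<le> norm p + cmod z * norm p"
    proof (intro add_mono mult_left_mono)
      show "norm (snd p) \<le> norm p" by (metis norm_snd_le prod.collapse)
      show "norm (fst p) \<le> norm p" by (metis norm_fst_le prod.collapse)
    qed simp
    finally show "norm (T p) \<le> (1 + cmod z) * norm p" by (simp add: distrib_right)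
  qed
  \<comment> \<open>The graph norm is at most \<open>norm f + norm g\<close>; here
    \<open>norm f\<close> is at most \<open>norm (T p) / \<bar>Im z\<bar>\<close>, and
    \<open>norm g\<close> at most \<open>norm (T p) + cmod z * norm f\<close>.\<close>
  define C where "C = 1 + (1 + cmod z) / \<bar>Im z\<bar>"
  have C: "C > 0" using z by (simp add: C_def add_pos_nonneg)
  have below: "1 / C * norm p \<le> norm (T p)" if p: "p \<in> A" for p
  proof -
    obtain f g where fg: "p = (f, g)" by (cases p)
    have le: "\<bar>Im z\<bar> * norm f \<le> norm (T p)"
      using norm_shift_ge [of f g z] p by (simp add: fg T_def)
    then have f: "norm f \<le> norm (T p) / \<bar>Im z\<bar>" using z by (simp add: field_simps)
    have "g = T p + z *\<^sub>C f" by (simp add: fg T_def)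
    then have "norm g \<le> norm (T p) + cmod z * norm f" using norm_triangle_ineq [of "T p" "z *\<^sub>C f"] by simp
    then have "norm p \<le> norm (T p) + (1 + cmod z) * norm f"
      using norm_Pair_le [of f g] by (simp add: fg distrib_right)
    also have "\<dots> \<le> norm (T p) + (1 + cmod z) * (norm (T p) / \<bar>Im z\<bar>)"
      by (intro add_left_mono mult_left_mono f) simp
    also have "\<dots> = C * norm (T p)" by (simp add: C_def distrib_right)
    finally show ?thesis using C by (simp add: field_simps)
  qed
  have cl: "closed_csubspace (T ` A)"
    by (rule closed_csubspace_image [OF T closed_csubspace_A _ below]) (use C in simp)
  obtain p where p: "p \<in> T ` A" and orth: "\<forall>v\<in>T ` A. cinner (y - p) v = 0"
    using orth_decomposition [OF cl, of y] by blast
  obtain f g where fg: "(f, g) \<in> A" "p = g - z *\<^sub>C f" using p by (auto simp: T_def)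
  define u where "u = y - p"
  have uH: "u \<in> H"
    unfolding u_def fg(2)
    by (intro csubspace_diff csubspace_scaleC csubspace_H y A_sub [OF fg(1)])
  have "(u, cnj z *\<^sub>C u) \<in> A"
  proof (rule A_memI [OF uH])
    show "cnj z *\<^sub>C u \<in> H" by (rule csubspace_scaleC [OF csubspace_H uH])
    fix a b assume "(a, b) \<in> A"
    then have "b - z *\<^sub>C a \<in> T ` A" by (force simp: T_def)
    then have "cinner u (b - z *\<^sub>C a) = 0" using orth u_def by blast
    then have "cinner (b - z *\<^sub>C a) u = 0" by (simp only: cinner_eq_0_commute [of u])
    then show "cinner b u = cinner a (cnj z *\<^sub>C u)"
      by (simp add: cinner_diff_left cinner_scaleC_left cinner_scaleC_right)
  qed
  then have "\<bar>Im z\<bar> * norm u \<le> 0" using norm_shift_ge [of u "cnj z *\<^sub>C u" "cnj z"] by simp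
  then have "u = 0" using z by (simp add: mult_le_0_iff)
  then have "g = y + z *\<^sub>C f" by (simp add: u_def fg(2) algebra_simps)
  then show ?thesis using fg(1) by blast
qed

lemma nonreal_resolvent_set: "Im z \<noteq> 0 \<Longrightarrow> z \<in> resolvent_set H A"
proof -
  assume z: "Im z \<noteq> 0"
  have bound: "norm f \<le> 1 / \<bar>Im z\<bar> * norm y" if "(f, y + z *\<^sub>C f) \<in> A" for f y
    using norm_shift_ge [OF that, of z] z by (simp add: field_simps)
  have "\<exists>!f. (f, y + z *\<^sub>C f) \<in> A" if y: "y \<in> H" for y
  proof -
    obtain f where f: "(f, y + z *\<^sub>C f) \<in> A" using shift_onto [OF z y] by blast
    have "f' = f" if f': "(f', y + z *\<^sub>C f') \<in> A" for f'
    proof -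
      have "(f' - f, 0 + z *\<^sub>C (f' - f)) \<in> A"
        using A_diff [OF f' f] by (simp add: scaleC_diff_right)
      then show ?thesis using bound [of "f' - f" 0] by simp
    qed
    then show ?thesis using f by blast
  qed
  moreover have "norm (fst p) \<le> 1 / \<bar>Im z\<bar> * norm (snd p)" if "p \<in> rel_shift A z" for p
    using that bound [of "fst p" "snd p"] rel_shift_iff [of "fst p" "snd p" A z] by simp
  then have "\<exists>K. \<forall>(x, y)\<in>rel_shift A z. norm x \<le> K * norm y"
    by (intro exI [of _ "1 / \<bar>Im z\<bar>"]) (simp add: case_prod_beta)
  ultimately show ?thesis
    unfolding resolvent_set_def mem_Collect_eq rel_shift_iff by blast
qed

abbreviation (input) R where "R \<equiv> resolvent A"

lemma resolvent_unique:
  assumes z: "z \<in> resolvent_set H A" and f: "(f, y + z *\<^sub>C f) \<in> A"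
  shows "R z y = f"
proof -
  have "y + z *\<^sub>C f - z *\<^sub>C f \<in> H"
    by (intro csubspace_diff csubspace_scaleC csubspace_H A_sub [OF f])
  then have "y \<in> H" by simp
  then have "\<exists>!x. (x, y + z *\<^sub>C x) \<in> A"
    using z unfolding resolvent_set_def rel_shift_iff by blast
  then show ?thesis unfolding resolvent_def rel_shift_iff using f by (rule the1_equality)
qed

lemma resolvent_eq:
  assumes z: "z \<in> resolvent_set H A" and fg: "(f, g) \<in> A"
  shows "R z (g - z *\<^sub>C f) = f"
  by (rule resolvent_unique [OF z]) (use fg in simp)

lemma resolvent_mem:
  assumes z: "z \<in> resolvent_set H A" and y: "y \<in> H"
  shows "(R z y, y + z *\<^sub>C R z y) \<in> A"
proof -
  have "\<exists>!x. (x, y + z *\<^sub>C x) \<in> A"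
    using z y unfolding resolvent_set_def rel_shift_iff by blast
  then show ?thesis unfolding resolvent_def rel_shift_iff by (rule theI')
qed

lemma resolvent_in_H: "z \<in> resolvent_set H A \<Longrightarrow> y \<in> H \<Longrightarrow> R z y \<in> H"
  using resolvent_mem A_sub(1) by blast

lemma resolvent_add:
  assumes "z \<in> resolvent_set H A" "x \<in> H" "y \<in> H"
  shows "R z (x + y) = R z x + R z y"
  using A_add [OF resolvent_mem [OF assms(1,2)] resolvent_mem [OF assms(1,3)]]
  by (intro resolvent_unique [OF assms(1)]) (simp add: scaleC_add_right algebra_simps)

lemma resolvent_scaleC:
  assumes "z \<in> resolvent_set H A" "x \<in> H"
  shows "R z (a *\<^sub>C x) = a *\<^sub>C R z x"
  using A_scaleC [OF resolvent_mem [OF assms], of a]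
  by (intro resolvent_unique [OF assms(1)]) (simp add: scaleC_add_right scaleC_scaleC mult.commute)

lemma resolvent_diff:
  assumes "z \<in> resolvent_set H A" "x \<in> H" "y \<in> H"
  shows "R z (x - y) = R z x - R z y"
  using A_diff [OF resolvent_mem [OF assms(1,2)] resolvent_mem [OF assms(1,3)]]
  by (intro resolvent_unique [OF assms(1)]) (simp add: scaleC_diff_right algebra_simps)

lemma resolvent_bound:
  assumes z: "z \<in> resolvent_set H A"
  obtains K where "K > 0" "\<And>y. y \<in> H \<Longrightarrow> norm (R z y) \<le> K * norm y"
proof -
  obtain K where K: "\<forall>(x, y)\<in>rel_shift A z. norm x \<le> K * norm y"
    using z unfolding resolvent_set_def by blast
  have "norm (R z y) \<le> (\<bar>K\<bar> + 1) * norm y" if "y \<in> H" for y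
  proof -
    have "(R z y, y) \<in> rel_shift A z" unfolding rel_shift_iff by (rule resolvent_mem [OF z that])
    then have "norm (R z y) \<le> K * norm y" using K by blast
    also have "\<dots> \<le> (\<bar>K\<bar> + 1) * norm y" by (intro mult_right_mono) auto
    finally show ?thesis .
  qed
  then show ?thesis using that [of "\<bar>K\<bar> + 1"] by simp
qed

lemma resolvent_bound_nonreal:
  assumes z: "Im z \<noteq> 0" and y: "y \<in> H"
  shows "\<bar>Im z\<bar> * norm (R z y) \<le> norm y"
  using norm_shift_ge [OF resolvent_mem [OF nonreal_resolvent_set [OF z] y], of z] by simp

lemma resolvent_adjoint:
  assumes z: "z \<in> resolvent_set H A" "cnj z \<in> resolvent_set H A" and xy: "x \<in> H" "y \<in> H"
  shows "cinner (R z x) y = cinner x (R (cnj z) y)"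
  using symmetric [OF resolvent_mem [OF z(1) xy(1)] resolvent_mem [OF z(2) xy(2)]]
  by (simp add: cinner_add_left cinner_add_right cinner_scaleC_left cinner_scaleC_right)

end

text \<open>The steps lead away from the real axis, so the points are nonreal even when
  \<open>z\<close> is real. They serve to extend identities by continuity to points where a factor
  such as \<open>z - cnj w\<close> vanishes, and to real points of a resolvent set.\<close>

definition approach :: "complex \<Rightarrow> nat \<Rightarrow> complex" where
  "approach z n = z + complex_of_real ((if Im z \<ge> 0 then 1 else - 1) / real (Suc n)) * \<i>"

lemma approach_nonreal: "Im (approach z n) \<noteq> 0"
proof (cases "Im z \<ge> 0")
  case True
  moreover have "0 < 1 / real (Suc n)" by simp
  ultimately have "Im z + 1 / real (Suc n) > 0" by linarith
  then show ?thesis using True by (simp add: approach_def)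
next
  case False
  moreover have "0 < 1 / real (Suc n)" by simp
  ultimately have "Im z - 1 / real (Suc n) < 0" by linarith
  then show ?thesis using False by (simp add: approach_def)
qed

lemma approach_neq: "approach z n \<noteq> z"
proof -
  have "(if Im z \<ge> 0 then 1 else - 1) / real (Suc n) \<noteq> 0" by simp
  then show ?thesis by (simp only: approach_def add_cancel_left_right mult_eq_0_iff of_real_eq_0_iff) simp
qed

lemma approach_tendsto: "approach z \<longlonglongrightarrow> z"
proof -
  have "(\<lambda>n. z + complex_of_real ((if Im z \<ge> 0 then 1 else - 1) * inverse (real (Suc n))) * \<i>)
      \<longlonglongrightarrow> z + complex_of_real ((if Im z \<ge> 0 then 1 else - 1) * 0) * \<i>"
    by (intro tendsto_intros LIMSEQ_inverse_real_of_nat)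
  then show ?thesis by (simp add: approach_def [abs_def] divide_inverse)
qed

section \<open>Continuity of defect vectors in the spectral parameter\<close>

context self_adjoint_relation
begin

text \<open>Since \<open>z *\<^sub>C u - w *\<^sub>C v = (z - w) *\<^sub>C u + w *\<^sub>C (u -
  v)\<close>, membership of this pair in \<open>A\<close> is a resolvent equation in
  disguise.\<close>

lemma resolvent_of_difference:
  assumes "w \<in> resolvent_set H A" and "(u - v, z *\<^sub>C u - w *\<^sub>C v) \<in> A"
  shows "resolvent A w ((z - w) *\<^sub>C u) = u - v"
  by (rule resolvent_unique [OF assms(1)])
    (use assms(2) in \<open>simp add: scaleC_diff_left scaleC_diff_right\<close>)

lemma defect_relation:
  assumes z: "z \<in> resolvent_set H A" and g: "g \<in> H"
  shows "(g + (z - z\<^sub>0) *\<^sub>C resolvent A z g - g,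
    z *\<^sub>C (g + (z - z\<^sub>0) *\<^sub>C resolvent A z g) - z\<^sub>0 *\<^sub>C g) \<in> A"
  using A_scaleC [OF resolvent_mem [OF z g], of "z - z\<^sub>0"]
  by (simp add: scaleC_linear algebra_simps)

text \<open>The difference \<open>v n - u\<close> is the resolvent at \<open>z\<close> applied to
  \<open>(w n - z) *\<^sub>C v n\<close>. Only the bound of the resolvent at the limit point enters,
  so real limit points in the resolvent set are covered.\<close>

lemma family_continuous:
  assumes z: "z \<in> resolvent_set H A" and u: "u \<in> H" and w: "w \<longlonglongrightarrow> z"
    and rel: "\<And>n. (v n - u, w n *\<^sub>C v n - z *\<^sub>C u) \<in> A"
  shows "v \<longlonglongrightarrow> u"
proof -
  obtain K where K: "K > 0" "\<And>y. y \<in> H \<Longrightarrow> norm (resolvent A z y) \<le> K * norm y"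
    using resolvent_bound [OF z] by blast
  have vH: "v n \<in> H" for n
    using csubspace_add [OF csubspace_H A_sub(1) [OF rel [of n]] u] by simp
  have le: "norm (v n - u) \<le> K * (cmod (w n - z) * norm (v n))" for n
  proof -
    have "v n - u = resolvent A z ((w n - z) *\<^sub>C v n)"
      by (rule resolvent_of_difference [OF z rel, symmetric])
    moreover have "norm (resolvent A z ((w n - z) *\<^sub>C v n)) \<le> K * norm ((w n - z) *\<^sub>C v n)"
      by (intro K csubspace_scaleC csubspace_H vH)
    ultimately show ?thesis by simp
  qed
  have wz: "(\<lambda>n. cmod (w n - z)) \<longlonglongrightarrow> 0"
    using tendsto_norm_zero [OF LIM_zero [OF w]] .
  have "\<forall>\<^sub>F n in sequentially. cmod (w n - z) < 1 / (2 * K)"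
    by (rule order_tendstoD(2) [OF wz]) (use K in simp)
  then have "\<forall>\<^sub>F n in sequentially. norm (v n - u) \<le> 2 * K * norm u * cmod (w n - z)"
  proof eventually_elim
    fix n assume "cmod (w n - z) < 1 / (2 * K)"
    \<comment> \<open>Once this factor is at most one half, the term with
      \<open>norm (v n - u)\<close> on the right is absorbed into the left side, at the price of a
      factor 2.\<close>
    then have half: "K * cmod (w n - z) \<le> 1 / 2" using K(1) by (simp add: field_simps)
    have "norm (v n - u) \<le> (K * cmod (w n - z)) * norm (v n)" using le [of n] by (simp add: mult.assoc)
    also have "\<dots> \<le> (K * cmod (w n - z)) * (norm u + norm (v n - u))"
      using K(1) norm_triangle_ineq [of u "v n - u"] by (intro mult_left_mono) auto
    also have "\<dots> = (K * cmod (w n - z)) * norm u + (K * cmod (w n - z)) * norm (v n - u)"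
      by (rule distrib_left)
    also have "\<dots> \<le> (K * cmod (w n - z)) * norm u + 1 / 2 * norm (v n - u)"
      by (intro add_left_mono mult_right_mono half) simp
    finally show "norm (v n - u) \<le> 2 * K * norm u * cmod (w n - z)" by (simp add: mult_ac)
  qed
  moreover have "(\<lambda>n. 2 * K * norm u * cmod (w n - z)) \<longlonglongrightarrow> 0"
    by (rule tendsto_mult_right_zero [OF wz])
  ultimately have "(\<lambda>n. v n - u) \<longlonglongrightarrow> 0" by (rule Lim_null_comparison)
  then show ?thesis by (rule LIM_zero_cancel)
qed

text \<open>Minimality and simplicity refer to the whole resolvent set, which may contain real
  points, whereas the Gram identities live at nonreal ones; continuity bridges the two.\<close>

lemma defect_orthogonal:
  assumes g: "g \<in> H" and z: "z \<in> resolvent_set H A"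
    and orth: "\<And>w. Im w \<noteq> 0 \<Longrightarrow> cinner u (g + (w - z\<^sub>0) *\<^sub>C resolvent A w g) = 0"
  shows "cinner u (g + (z - z\<^sub>0) *\<^sub>C resolvent A z g) = 0"
proof -
  define F where "F w = g + (w - z\<^sub>0) *\<^sub>C resolvent A w g" for w
  have lim: "(\<lambda>n. F (approach z n)) \<longlonglongrightarrow> F z"
  proof (rule family_continuous [OF z _ approach_tendsto])
    show "F z \<in> H"
      unfolding F_def by (intro csubspace_add csubspace_scaleC csubspace_H g resolvent_in_H z)
    fix n
    show "(F (approach z n) - F z, approach z n *\<^sub>C F (approach z n) - z *\<^sub>C F z) \<in> A"
      using A_diff [OF defect_relation [OF nonreal_resolvent_set [OF approach_nonreal] g, of z n z\<^sub>0]
          defect_relation [OF z g, of z\<^sub>0]]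
      by (simp only: F_def [symmetric] diff_diff_eq2 diff_add_cancel)
  qed
  have "(\<lambda>n. cinner u (F (approach z n))) \<longlonglongrightarrow> cinner u (F z)"
    by (rule tendsto_cinner_right [OF lim])
  moreover have "cinner u (F (approach z n)) = 0" for n
    unfolding F_def by (rule orth [OF approach_nonreal])
  ultimately show ?thesis unfolding F_def by (simp add: LIMSEQ_const_iff)
qed

end

text \<open>The relation \<open>F_rel\<close> encodes
  \<open>F z = (I + (z - w) (A - z)^-1) F w\<close> without naming a resolvent. It covers the defect
  family of \<open>A\<close>, the family of a minimal realisation, a Gram family in its own span,
  and \<Theta> for \<open>Atilde\<close>.\<close>

locale resolvent_family = self_adjoint_relation H A
  for H :: "'h::complex_hilbert set" and A +
  fixes F :: "complex \<Rightarrow> 'x \<Rightarrow> 'h"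
  assumes F_mem: "Im z \<noteq> 0 \<Longrightarrow> F z x \<in> H"
    and F_rel: "Im z \<noteq> 0 \<Longrightarrow> Im w \<noteq> 0 \<Longrightarrow> (F z x - F w x, z *\<^sub>C F z x - w *\<^sub>C F w x) \<in> A"
begin

definition L where "L = closed_cspan {F z x |z x. Im z \<noteq> 0}"

lemma closed_csubspace_L: "closed_csubspace L"
  unfolding L_def by (rule closed_csubspace_closed_cspan)

lemma csubspace_L: "csubspace L"
  using closed_csubspace_L by (simp add: closed_csubspace_def)

lemma F_L: "Im z \<noteq> 0 \<Longrightarrow> F z x \<in> L"
  unfolding L_def by (rule subsetD [OF closed_cspan_superset]) blast

lemma L_subset: "L \<subseteq> H"
  unfolding L_def by (rule closed_cspan_minimal [OF H]) (use F_mem in blast)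

lemma F_continuous:
  assumes z: "Im z \<noteq> 0" and w: "w \<longlonglongrightarrow> z" "\<And>n. Im (w n) \<noteq> 0"
  shows "(\<lambda>n. F (w n) x) \<longlonglongrightarrow> F z x"
  by (rule family_continuous [OF nonreal_resolvent_set [OF z] F_mem [OF z] w(1) F_rel [OF w(2) z]])

text \<open>Algebra with resolvent identities produces a factor that vanishes at one point
  \<open>w\<close>; continuity supplies that point.\<close>

lemma orthogonal_except_one:
  assumes orth: "\<And>z x. Im z \<noteq> 0 \<Longrightarrow> z \<noteq> w \<Longrightarrow> cinner u (F z x) = 0" and z: "Im z \<noteq> 0"
  shows "cinner u (F z x) = 0"
proof (cases "z = w")
  case True
  have "(\<lambda>n. cinner u (F (approach z n) x)) \<longlonglongrightarrow> cinner u (F z x)"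
    by (rule tendsto_cinner_right [OF F_continuous [OF z approach_tendsto approach_nonreal]])
  moreover have "cinner u (F (approach z n) x) = 0" for n
    using True approach_neq by (intro orth approach_nonreal) simp
  ultimately show ?thesis by (simp add: LIMSEQ_const_iff)
next
  case False
  then show ?thesis by (rule orth [OF z])
qed

lemma orthogonal_L:
  assumes "\<And>z x. Im z \<noteq> 0 \<Longrightarrow> cinner u (F z x) = 0" and "v \<in> L"
  shows "cinner u v = 0"
  by (rule closed_cspan_orthogonal [OF _ assms(2) [unfolded L_def]]) (use assms(1) in blast)

text \<open>For \<open>z \<noteq> w\<close> the resolvent at \<open>w\<close> sends
  \<open>(z - w) *\<^sub>C F z x\<close> to \<open>F z x - F w x\<close>, which lies in the span;
  the case \<open>z = w\<close> follows by continuity, and the preimage of \<open>L\<close> is a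
  closed subspace.\<close>

lemma resolvent_L:
  assumes w: "Im w \<noteq> 0" and u: "u \<in> L"
  shows "resolvent A w u \<in> L"
proof -
  note wr = nonreal_resolvent_set [OF w]
  define N where "N = {u \<in> H. resolvent A w u \<in> L}"
  have clL: "closed L" and clH: "closed H"
    using closed_csubspace_L H by (simp_all add: closed_csubspace_def)
  have R0: "resolvent A w 0 = 0"
    using resolvent_unique [OF wr, of 0 0] A_zero by simp
  obtain K where K: "K > 0" "\<And>y. y \<in> H \<Longrightarrow> norm (resolvent A w y) \<le> K * norm y"
    using resolvent_bound [OF wr] by blast
  have clN: "closed N"
    unfolding closed_sequential_limits
  proof (intro allI impI, elim conjE)
    fix f l assume f: "\<forall>n. f n \<in> N" and lim: "f \<longlonglongrightarrow> l"
    have fH: "f n \<in> H" and fL: "resolvent A w (f n) \<in> L" for n using f by (auto simp: N_def)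
    have lH: "l \<in> H" by (rule closed_sequentially [OF clH fH lim])
    have "(\<lambda>n. resolvent A w (f n) - resolvent A w l) \<longlonglongrightarrow> 0"
    proof (rule Lim_null_comparison)
      show "\<forall>\<^sub>F n in sequentially. norm (resolvent A w (f n) - resolvent A w l) \<le> K * norm (f n - l)"
        using K(2) [OF csubspace_diff [OF csubspace_H fH lH]]
        by (simp add: resolvent_diff [OF wr fH lH])
      show "(\<lambda>n. K * norm (f n - l)) \<longlonglongrightarrow> 0"
        by (rule tendsto_mult_right_zero [OF tendsto_norm_zero [OF LIM_zero [OF lim]]])
    qed
    then have "(\<lambda>n. resolvent A w (f n)) \<longlonglongrightarrow> resolvent A w l" by (rule LIM_zero_cancel)
    then have "resolvent A w l \<in> L" by (rule closed_sequentially [OF clL fL])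
    then show "l \<in> N" using lH by (simp add: N_def)
  qed
  have csN: "csubspace N"
  proof (rule csubspaceI)
    show "0 \<in> N" by (simp add: N_def R0 csubspace_0 [OF csubspace_H] csubspace_0 [OF csubspace_L])
    show "x + y \<in> N" if "x \<in> N" "y \<in> N" for x y
      using that
      by (simp add: N_def resolvent_add [OF wr] csubspace_add [OF csubspace_H] csubspace_add [OF csubspace_L])
    show "a *\<^sub>C x \<in> N" if "x \<in> N" for a x
      using that
      by (simp add: N_def resolvent_scaleC [OF wr] csubspace_scaleC [OF csubspace_H]
          csubspace_scaleC [OF csubspace_L])
  qed
  have neq: "F z x \<in> N" if z: "Im z \<noteq> 0" "z \<noteq> w" for z x
  proof -
    have "resolvent A w ((z - w) *\<^sub>C F z x) = F z x - F w x"
      by (rule resolvent_of_difference [OF wr F_rel [OF z(1) w]])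
    then have "(z - w) *\<^sub>C F z x \<in> N"
      by (simp add: N_def csubspace_scaleC [OF csubspace_H F_mem [OF z(1)]]
          csubspace_diff [OF csubspace_L F_L [OF z(1)] F_L [OF w]])
    then have "(1 / (z - w)) *\<^sub>C ((z - w) *\<^sub>C F z x) \<in> N" by (rule csubspace_scaleC [OF csN])
    then show ?thesis using z(2) by (simp add: scaleC_scaleC)
  qed
  have "F z x \<in> N" if z: "Im z \<noteq> 0" for z x
  proof (cases "z = w")
    case True
    have "F (approach z n) x \<in> N" for n
      using True approach_neq by (intro neq approach_nonreal) simp
    then show ?thesis
      by (rule closed_sequentially [OF clN _ F_continuous [OF z approach_tendsto approach_nonreal]])
  next
    case False
    then show ?thesis by (rule neq [OF z])
  qed
  then have "L \<subseteq> N"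
    unfolding L_def by (intro closed_cspan_minimal) (auto simp: closed_csubspace_def clN csN)
  then show ?thesis using u by (auto simp: N_def)
qed

text \<open>Inside the closed span it suffices to test symmetry against the family. The pair is
  compared with the element of \<open>A\<close> that has the same image under the shift by
  \<open>\<i>\<close>; the difference of the first components is orthogonal to the family and lies
  in its span.\<close>

lemma mem_A_if_family:
  assumes f: "f \<in> L" and g: "g \<in> L"
    and eq: "\<And>z w x. Im z \<noteq> 0 \<Longrightarrow> Im w \<noteq> 0 \<Longrightarrow>
      cinner g (F z x - F w x) = cinner f (z *\<^sub>C F z x - w *\<^sub>C F w x)"
  shows "(f, g) \<in> A"
proof -
  have ii: "Im \<i> \<noteq> 0" "Im (- \<i>) \<noteq> 0" by simp_all
  define h where "h = g - \<i> *\<^sub>C f"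
  have hL: "h \<in> L" unfolding h_def by (intro csubspace_diff csubspace_scaleC csubspace_L f g)
  define k where "k = resolvent A \<i> h"
  have kL: "k \<in> L" unfolding k_def by (rule resolvent_L [OF ii(1) hL])
  have kA: "(k, h + \<i> *\<^sub>C k) \<in> A"
    unfolding k_def by (rule resolvent_mem [OF nonreal_resolvent_set [OF ii(1)]]) (use hL L_subset in blast)
  have uL: "f - k \<in> L" by (intro csubspace_diff csubspace_L f kL)
  have "cinner (f - k) (F z x) = 0" if z: "Im z \<noteq> 0" "z \<noteq> - \<i>" for z x
  proof -
    have 1: "cinner g (F z x) - cinner g (F (- \<i>) x) = cnj z * cinner f (F z x) - \<i> * cinner f (F (- \<i>) x)"
      using eq [OF z(1) ii(2), of x]
      by (simp add: cinner_diff_right cinner_scaleC_right)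
    have 2: "cinner (h + \<i> *\<^sub>C k) (F z x) - cinner (h + \<i> *\<^sub>C k) (F (- \<i>) x) =
        cnj z * cinner k (F z x) - \<i> * cinner k (F (- \<i>) x)"
      using symmetric [OF kA F_rel [OF z(1) ii(2), of x]]
      by (simp add: cinner_diff_right cinner_scaleC_right)
    \<comment> \<open>The second family point is \<open>- \<i>\<close> because the conjugate of its
      parameter equals the shift \<open>\<i>\<close>, so that all terms at this point cancel when
      the two identities are subtracted.\<close>
    have comb: "(i - c) * (fz - kz) = 0"
      if "gz - gw = c * fz - i * fw" "gz - i * fz + i * kz - (gw - i * fw + i * kw) = c * kz - i * kw"
      for i c fz kz gz gw fw kw :: complex
    proof -
      have "(i - c) * (fz - kz) = (gz - gw - (c * fz - i * fw)) -
          (gz - i * fz + i * kz - (gw - i * fw + i * kw) - (c * kz - i * kw))"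
        by (simp add: algebra_simps)
      then show ?thesis unfolding that by simp
    qed
    have "(\<i> - cnj z) * (cinner f (F z x) - cinner k (F z x)) = 0"
      by (rule comb [OF 1 2 [unfolded h_def cinner_add_left cinner_diff_left cinner_scaleC_left]])
    then have "(\<i> - cnj z) * cinner (f - k) (F z x) = 0" by (simp only: cinner_diff_left)
    moreover have "\<i> - cnj z \<noteq> 0" using z(2) by (auto simp: complex_eq_iff)
    ultimately show ?thesis by simp
  qed
  then have "cinner (f - k) (F z x) = 0" if "Im z \<noteq> 0" for z x
    using that by (rule orthogonal_except_one)
  then have "cinner (f - k) (f - k) = 0" by (rule orthogonal_L [OF _ uL])
  then have "f = k" by simp
  then show ?thesis using kA by (simp add: h_def)
qed

end

section \<open>Generalised values\<close>

lemma bounded_clinear_op_diff: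
  assumes "bounded_clinear T" "bounded_clinear U"
  shows "bounded_clinear (\<lambda>x. T x - U x)"
  using assms bounded_linear_sub [of T U] by (simp add: bounded_clinear_def scaleC_diff_right)

lemma bounded_clinear_op_add:
  assumes "bounded_clinear T" "bounded_clinear U"
  shows "bounded_clinear (\<lambda>x. T x + U x)"
  using assms bounded_linear_add [of T U] by (simp add: bounded_clinear_def scaleC_add_right)

lemma bounded_clinear_op_scaleC:
  assumes "bounded_clinear T"
  shows "bounded_clinear (\<lambda>x. a *\<^sub>C T x)"
  using assms bounded_linear_compose [OF bounded_linear_scaleC_right [of a], of T]
  by (simp add: bounded_clinear_def scaleC_scaleC mult.commute)

lemma op_holomorphic_bounded: "op_holomorphic_at F z \<Longrightarrow> bounded_clinear (F z)"
  unfolding op_holomorphic_at_def by (metis centre_in_ball)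

lemma op_holomorphic_tendsto:
  assumes "op_holomorphic_at F z"
  shows "((\<lambda>w. F w x) \<longlongrightarrow> F z x) (at z)"
proof -
  obtain e where e: "e > 0" "\<And>w. w \<in> ball z e \<Longrightarrow> bounded_clinear (F w)" and "op_differentiable F z"
    using assms unfolding op_holomorphic_at_def by (metis centre_in_ball)
  then obtain D where D: "bounded_clinear D"
    and lim: "((\<lambda>w. onorm (\<lambda>x. (1 / (w - z)) *\<^sub>C (F w x - F z x) - D x)) \<longlongrightarrow> 0) (at z)"
    unfolding op_differentiable_def by blast
  define N where "N w = onorm (\<lambda>x. (1 / (w - z)) *\<^sub>C (F w x - F z x) - D x)" for w
  have lim0: "((\<lambda>w. cmod (w - z) * (N w * norm x + norm (D x))) \<longlongrightarrow> 0 * (0 * norm x + norm (D x))) (at z)"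
    by (intro tendsto_intros lim [folded N_def] tendsto_norm_zero LIM_zero)
  have "((\<lambda>w. F w x - F z x) \<longlongrightarrow> 0) (at z)"
  proof (rule Lim_null_comparison)
    show "\<forall>\<^sub>F w in at z. norm (F w x - F z x) \<le> cmod (w - z) * (N w * norm x + norm (D x))"
      unfolding eventually_at
    proof (intro exI [of _ e] conjI ballI impI e(1))
      fix w assume w: "w \<noteq> z \<and> dist w z < e"
      define E where "E = (\<lambda>x. (1 / (w - z)) *\<^sub>C (F w x - F z x) - D x)"
      have "bounded_clinear (F w)" "bounded_clinear (F z)" using e w by (simp_all add: dist_commute)
      then have "bounded_clinear E"
        unfolding E_def by (intro bounded_clinear_op_diff bounded_clinear_op_scaleC D)
      then have "norm (E x) \<le> N w * norm x"
        unfolding N_def E_def [symmetric] by (intro onorm) (simp add: bounded_clinear_def)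
      moreover have "F w x - F z x = (w - z) *\<^sub>C (E x + D x)"
        using w by (simp add: E_def scaleC_scaleC)
      moreover have "norm (E x + D x) \<le> norm (E x) + norm (D x)" by (rule norm_triangle_ineq)
      ultimately show "norm (F w x - F z x) \<le> cmod (w - z) * (N w * norm x + norm (D x))"
        by (simp add: mult_left_mono)
    qed
    show "((\<lambda>w. cmod (w - z) * (N w * norm x + norm (D x))) \<longlongrightarrow> 0) (at z)" using lim0 by simp
  qed
  then show ?thesis by (rule LIM_zero_cancel)
qed

lemma op_holomorphic_seq:
  assumes "op_holomorphic_at F z" "w \<longlonglongrightarrow> z" "\<And>n. w n \<noteq> z"
  shows "(\<lambda>n. F (w n) x) \<longlonglongrightarrow> F z x"
  using op_holomorphic_tendsto [OF assms(1), of x] assms(2,3)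
  by (auto simp: tendsto_at_iff_sequentially comp_def)

text \<open>The identity is multiplied out so that it also covers \<open>z = cnj w\<close>, where it
  states the symmetry of \<open>Q\<close>. Linearity, boundedness and continuity of \<Gamma> at
  nonreal points are not assumed; they are forced by the Gram identity.\<close>

locale gram_family =
  fixes Q :: "complex \<Rightarrow> 'g \<Rightarrow> 'g::complex_hilbert" and \<Gamma> :: "complex \<Rightarrow> 'g \<Rightarrow> 'h::complex_hilbert"
  assumes holomorphic: "Im z \<noteq> 0 \<Longrightarrow> op_holomorphic_at Q z"
    and gram: "Im z \<noteq> 0 \<Longrightarrow> Im w \<noteq> 0 \<Longrightarrow>
      (z - cnj w) * cinner (\<Gamma> z x) (\<Gamma> w y) = cinner (Q z x) y - cinner x (Q w y)"
begin

lemma Q_bounded: "Im z \<noteq> 0 \<Longrightarrow> bounded_clinear (Q z)"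
  by (rule op_holomorphic_bounded [OF holomorphic])

lemma Q_symmetric: "Im z \<noteq> 0 \<Longrightarrow> cinner (Q z x) y = cinner x (Q (cnj z) y)"
  using gram [of z "cnj z" x y] by simp

lemma nonreal_diff_cnj: "Im z \<noteq> 0 \<Longrightarrow> z - cnj z \<noteq> 0"
  by (simp add: complex_eq_iff)

lemma cinner_\<Gamma>:
  "Im z \<noteq> 0 \<Longrightarrow> cinner (\<Gamma> z x) (\<Gamma> z y) = (cinner (Q z x) y - cinner x (Q z y)) / (z - cnj z)"
  using gram [of z z x y] nonreal_diff_cnj [of z] by (simp add: field_simps)

lemma \<Gamma>_add:
  assumes z: "Im z \<noteq> 0"
  shows "\<Gamma> z (x + y) = \<Gamma> z x + \<Gamma> z y"
proof -
  \<comment> \<open>The defect of additivity is a combination of vectors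
    \<open>\<Gamma> z v\<close>, and by the Gram formula it is orthogonal to all of them.\<close>
  define d where "d = \<Gamma> z (x + y) - (\<Gamma> z x + \<Gamma> z y)"
  have d: "cinner d (\<Gamma> z v) = 0" for v
    unfolding d_def cinner_diff_left cinner_add_left cinner_\<Gamma> [OF z] bounded_clinear_add [OF Q_bounded [OF z]]
    by (simp add: add_divide_distrib diff_divide_distrib)
  have "cinner d d = cinner d (\<Gamma> z (x + y)) - (cinner d (\<Gamma> z x) + cinner d (\<Gamma> z y))"
    by (subst (2) d_def) (simp only: cinner_diff_right cinner_add_right)
  then have "d = 0" by (simp add: d)
  then show ?thesis by (simp add: d_def)
qed

lemma \<Gamma>_scaleC:
  assumes z: "Im z \<noteq> 0"
  shows "\<Gamma> z (a *\<^sub>C x) = a *\<^sub>C \<Gamma> z x"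
proof -
  define d where "d = \<Gamma> z (a *\<^sub>C x) - a *\<^sub>C \<Gamma> z x"
  have d: "cinner d (\<Gamma> z v) = 0" for v
    unfolding d_def cinner_diff_left cinner_scaleC_left cinner_\<Gamma> [OF z]
      bounded_clinear_scaleC [OF Q_bounded [OF z]]
    by (simp add: right_diff_distrib)
  have "cinner d d = cinner d (\<Gamma> z (a *\<^sub>C x)) - cnj a * cinner d (\<Gamma> z x)"
    by (subst (2) d_def) (simp only: cinner_diff_right cinner_scaleC_right)
  then have "d = 0" by (simp add: d)
  then show ?thesis by (simp add: d_def)
qed

lemma \<Gamma>_bounded:
  assumes z: "Im z \<noteq> 0"
  shows "bounded_clinear (\<Gamma> z)"
proof -
  obtain K where K: "K > 0" "\<And>x. norm (Q z x) \<le> K * norm x"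
    using bounded_clinear_bound [OF Q_bounded [OF z]] by blast
  define c where "c = cmod (z - cnj z)"
  have c: "c > 0" using nonreal_diff_cnj [OF z] by (simp add: c_def)
  have "norm (\<Gamma> z x) \<le> sqrt (2 * K / c) * norm x" for x
  proof (rule power2_le_imp_le)
    have "c * (norm (\<Gamma> z x))\<^sup>2 = cmod ((z - cnj z) * cinner (\<Gamma> z x) (\<Gamma> z x))"
      by (simp add: norm_mult c_def cinner_self norm_power)
    also have "\<dots> = cmod (cinner (Q z x) x - cinner x (Q z x))" by (simp only: gram [OF z z])
    also have "\<dots> \<le> cmod (cinner (Q z x) x) + cmod (cinner x (Q z x))" by (rule norm_triangle_ineq4)
    also have "\<dots> \<le> norm (Q z x) * norm x + norm x * norm (Q z x)"
      by (intro add_mono cmod_cinner_le)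
    also have "\<dots> \<le> 2 * (K * norm x * norm x)"
      using mult_right_mono [OF K(2) norm_ge_zero, of x x] by (simp add: mult.commute)
    finally have "(norm (\<Gamma> z x))\<^sup>2 \<le> 2 * K / c * (norm x)\<^sup>2"
      using c by (simp add: field_simps power2_eq_square)
    also have "\<dots> = (sqrt (2 * K / c) * norm x)\<^sup>2"
      using K c by (simp add: power_mult_distrib)
    finally show "(norm (\<Gamma> z x))\<^sup>2 \<le> (sqrt (2 * K / c) * norm x)\<^sup>2" .
    show "0 \<le> sqrt (2 * K / c) * norm x" using K c by simp
  qed
  then show ?thesis by (intro bounded_clinearI \<Gamma>_add [OF z] \<Gamma>_scaleC [OF z])
qed

text \<open>The four Gram entries in the squared norm of the difference converge to the same value
  because \<open>Q\<close> is continuous. The quotient form of the identity requires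
  \<open>cnj (w n) \<noteq> z\<close>, which holds eventually since \<open>z\<close> is
  nonreal.\<close>

lemma \<Gamma>_approach:
  assumes z: "Im z \<noteq> 0"
  shows "(\<lambda>n. \<Gamma> (approach z n) y) \<longlonglongrightarrow> \<Gamma> z y"
proof -
  define w where "w = approach z"
  have w: "Im (w n) \<noteq> 0" "w n \<noteq> z" for n by (simp_all add: w_def approach_nonreal approach_neq)
  have wz: "w \<longlonglongrightarrow> z" by (simp add: w_def approach_tendsto)
  define q where "q n = cinner (Q (w n) y) y" for n
  define q0 where "q0 = cinner (Q z y) y"
  have q: "q \<longlonglongrightarrow> q0"
    unfolding q_def [abs_def] q0_def
    by (rule tendsto_cinner_left [OF op_holomorphic_seq [OF holomorphic [OF z] wz w(2)]])
  have gr: "cinner (\<Gamma> a y) (\<Gamma> b y) = (cinner (Q a y) y - cnj (cinner (Q b y) y)) / (a - cnj b)"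
    if "Im a \<noteq> 0" "Im b \<noteq> 0" "a \<noteq> cnj b" for a b
    using gram [OF that(1,2), of y y] that(3) by (simp add: cinner_commute [of y "Q b y"] field_simps)
  have zz: "z \<noteq> cnj z" and ww: "w n \<noteq> cnj (w n)" for n
    using z w(1) [of n] by (auto simp: complex_eq_iff)
  have "(\<lambda>n. cnj (w n)) \<longlonglongrightarrow> cnj z" using wz by (rule tendsto_cnj)
  then have "\<forall>\<^sub>F n in sequentially. cnj (w n) \<noteq> z"
    by (rule tendsto_imp_eventually_ne) (use zz in simp)
  then have ev: "\<forall>\<^sub>F n in sequentially. (q n - cnj (q n)) / (w n - cnj (w n)) - (q n - cnj q0) / (w n - cnj z)
      - (q0 - cnj (q n)) / (z - cnj (w n)) + (q0 - cnj q0) / (z - cnj z) =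
      complex_of_real ((norm (\<Gamma> (w n) y - \<Gamma> z y))\<^sup>2)"
  proof eventually_elim
    fix n assume ne: "cnj (w n) \<noteq> z"
    have ne': "w n \<noteq> cnj z" "z \<noteq> cnj (w n)" using ne by auto
    show "(q n - cnj (q n)) / (w n - cnj (w n)) - (q n - cnj q0) / (w n - cnj z)
      - (q0 - cnj (q n)) / (z - cnj (w n)) + (q0 - cnj q0) / (z - cnj z) =
      complex_of_real ((norm (\<Gamma> (w n) y - \<Gamma> z y))\<^sup>2)"
      unfolding cinner_self [symmetric] cinner_diff_left cinner_diff_right
        gr [OF w(1) w(1) ww] gr [OF w(1) z ne'(1)] gr [OF z w(1) ne'(2)] gr [OF z z zz]
        q_def [symmetric] q0_def [symmetric]
      by (simp only: diff_diff_eq2 diff_add_eq) simp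
  qed
  have "(\<lambda>n. (q n - cnj (q n)) / (w n - cnj (w n)) - (q n - cnj q0) / (w n - cnj z)
      - (q0 - cnj (q n)) / (z - cnj (w n)) + (q0 - cnj q0) / (z - cnj z)) \<longlonglongrightarrow>
      (q0 - cnj q0) / (z - cnj z) - (q0 - cnj q0) / (z - cnj z)
      - (q0 - cnj q0) / (z - cnj z) + (q0 - cnj q0) / (z - cnj z)"
    by (intro tendsto_intros q wz) (use zz in simp_all)
  then have "(\<lambda>n. complex_of_real ((norm (\<Gamma> (w n) y - \<Gamma> z y))\<^sup>2)) \<longlonglongrightarrow> complex_of_real 0"
    using tendsto_cong [OF ev] by simp
  then have "(\<lambda>n. (norm (\<Gamma> (w n) y - \<Gamma> z y))\<^sup>2) \<longlonglongrightarrow> 0" by (simp only: tendsto_of_real_iff)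
  then have "(\<lambda>n. sqrt ((norm (\<Gamma> (w n) y - \<Gamma> z y))\<^sup>2)) \<longlonglongrightarrow> sqrt 0" by (rule tendsto_real_sqrt)
  then have "(\<lambda>n. \<Gamma> (w n) y - \<Gamma> z y) \<longlonglongrightarrow> 0" by (simp add: tendsto_norm_zero_iff)
  then show ?thesis unfolding w_def by (rule LIM_zero_cancel)
qed

lemma orthogonal_except_one:
  assumes orth: "\<And>z x. Im z \<noteq> 0 \<Longrightarrow> z \<noteq> w \<Longrightarrow> cinner u (\<Gamma> z x) = 0" and z: "Im z \<noteq> 0"
  shows "cinner u (\<Gamma> z x) = 0"
proof (cases "z = w")
  case True
  have "(\<lambda>n. cinner u (\<Gamma> (approach z n) x)) \<longlonglongrightarrow> cinner u (\<Gamma> z x)"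
    by (rule tendsto_cinner_right [OF \<Gamma>_approach [OF z]])
  moreover have "cinner u (\<Gamma> (approach z n) x) = 0" for n
    using True approach_neq by (intro orth approach_nonreal) simp
  ultimately show ?thesis by (simp add: LIMSEQ_const_iff)
next
  case False
  then show ?thesis by (rule orth [OF z])
qed

end

subsection \<open>The realisation on the span of a Gram family\<close>

context gram_family
begin

definition K where "K = closed_cspan {\<Gamma> z x |z x. Im z \<noteq> 0}"

text \<open>This is the adjoint, formed within \<open>K\<close>, of the relation generated by the
  pairs \<open>(\<Gamma> z x - \<Gamma> w x, z *\<^sub>C \<Gamma> z x - w *\<^sub>C \<Gamma> w
  x)\<close>; the closed span of these pairs is \<open>T\<close> below.\<close>

definition B where "B = {(f, g) \<in> K \<times> K. \<forall>z w x. Im z \<noteq> 0 \<longrightarrow> Im w \<noteq> 0 \<longrightarrow>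
  cinner g (\<Gamma> z x - \<Gamma> w x) = cinner f (z *\<^sub>C \<Gamma> z x - w *\<^sub>C \<Gamma> w x)}"

lemma closed_csubspace_K: "closed_csubspace K"
  unfolding K_def by (rule closed_csubspace_closed_cspan)

lemma csubspace_K: "csubspace K"
  using closed_csubspace_K by (simp add: closed_csubspace_def)

lemma \<Gamma>_K: "Im z \<noteq> 0 \<Longrightarrow> \<Gamma> z x \<in> K"
  unfolding K_def by (rule subsetD [OF closed_cspan_superset]) blast

lemma orthogonal_K:
  assumes "\<And>z x. Im z \<noteq> 0 \<Longrightarrow> cinner u (\<Gamma> z x) = 0" and "v \<in> K"
  shows "cinner u v = 0"
  by (rule closed_cspan_orthogonal [OF _ assms(2) [unfolded K_def]]) (use assms(1) in blast)

lemma B_memI: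
  assumes "f \<in> K" "g \<in> K"
    and "\<And>z w x. Im z \<noteq> 0 \<Longrightarrow> Im w \<noteq> 0 \<Longrightarrow>
      cinner g (\<Gamma> z x - \<Gamma> w x) = cinner f (z *\<^sub>C \<Gamma> z x - w *\<^sub>C \<Gamma> w x)"
  shows "(f, g) \<in> B"
  using assms unfolding B_def by blast

lemma B_K: "(f, g) \<in> B \<Longrightarrow> f \<in> K" "(f, g) \<in> B \<Longrightarrow> g \<in> K"
  unfolding B_def by blast+

lemma B_eq:
  assumes "(f, g) \<in> B" "Im z \<noteq> 0" "Im w \<noteq> 0"
  shows "cinner g (\<Gamma> z x - \<Gamma> w x) = cinner f (z *\<^sub>C \<Gamma> z x - w *\<^sub>C \<Gamma> w x)"
  using assms unfolding B_def by blast

text \<open>The generating pairs are symmetric to each other: in each of the four products the Gram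
  identity exchanges a left parameter for a conjugated right one at the cost of terms in
  \<open>Q\<close>, and these terms cancel in the alternating sum.\<close>

lemma \<Gamma>_B:
  assumes z: "Im z \<noteq> 0" and w: "Im w \<noteq> 0"
  shows "(\<Gamma> z x - \<Gamma> w x, z *\<^sub>C \<Gamma> z x - w *\<^sub>C \<Gamma> w x) \<in> B"
proof (rule B_memI)
  show "\<Gamma> z x - \<Gamma> w x \<in> K" "z *\<^sub>C \<Gamma> z x - w *\<^sub>C \<Gamma> w x \<in> K"
    by (intro csubspace_diff csubspace_scaleC csubspace_K \<Gamma>_K z w)+
  fix z' w' y assume z': "Im z' \<noteq> 0" and w': "Im w' \<noteq> 0"
  have split: "(a - cnj b) * c = d - e \<Longrightarrow> a * c = cnj b * c + (d - e)" for a b c d e :: complex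
    by (simp add: algebra_simps)
  note g = split [OF gram [OF z z', of x y]] split [OF gram [OF z w', of x y]]
    split [OF gram [OF w z', of x y]] split [OF gram [OF w w', of x y]]
  show "cinner (z *\<^sub>C \<Gamma> z x - w *\<^sub>C \<Gamma> w x) (\<Gamma> z' y - \<Gamma> w' y) =
      cinner (\<Gamma> z x - \<Gamma> w x) (z' *\<^sub>C \<Gamma> z' y - w' *\<^sub>C \<Gamma> w' y)"
    unfolding cinner_diff_left cinner_diff_right cinner_scaleC_left cinner_scaleC_right right_diff_distrib g
    by simp
qed

definition T where
  "T = closed_cspan {(\<Gamma> z x - \<Gamma> w x, z *\<^sub>C \<Gamma> z x - w *\<^sub>C \<Gamma> w x) |z w x. Im z \<noteq> 0 \<and> Im w \<noteq> 0}"

lemma T_symmetric: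
  assumes fg: "(f, g) \<in> T" and uv: "(u, v) \<in> B"
  shows "cinner g u = cinner f v"
proof -
  have "T \<subseteq> {p. \<forall>x\<in>{(v, - u)}. cinner p x = 0}"
    unfolding T_def
  proof (rule closed_cspan_minimal [OF closed_csubspace_orthogonal], safe)
    fix z w :: complex and x assume zw: "Im z \<noteq> 0" "Im w \<noteq> 0"
    have "cinner (v, - u) (\<Gamma> z x - \<Gamma> w x, z *\<^sub>C \<Gamma> z x - w *\<^sub>C \<Gamma> w x) = 0"
      using B_eq [OF uv zw, of x] by (simp add: cinner_minus_left)
    then show "cinner (\<Gamma> z x - \<Gamma> w x, z *\<^sub>C \<Gamma> z x - w *\<^sub>C \<Gamma> w x) (v, - u) = 0"
      by (rule iffD1 [OF cinner_eq_0_commute])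
  qed
  then have "cinner (f, g) (v, - u) = 0" using fg by blast
  then show ?thesis by (simp add: cinner_minus_right)
qed

text \<open>Both deficiency vectors of an element orthogonal to the closure vanish by totality.\<close>

lemma B_subset_T: "B \<subseteq> T"
proof
  fix q assume q: "q \<in> B"
  obtain p where p: "p \<in> T" and orth: "\<forall>v\<in>T. cinner (q - p) v = 0"
    using orth_decomposition [OF closed_csubspace_closed_cspan] unfolding T_def by blast
  have TK: "T \<subseteq> K \<times> K"
    unfolding T_def
  proof (rule closed_cspan_minimal)
    show "closed_csubspace (K \<times> K)"
      using closed_csubspace_K
      by (auto simp: closed_csubspace_def csubspace_def closed_Times zero_prod_def plus_prod_def scaleC_prod_def)
  qed (auto intro!: csubspace_diff csubspace_scaleC csubspace_K \<Gamma>_K)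
  obtain a b where ab: "q - p = (a, b)" by (cases "q - p")
  have aK: "a \<in> K" and bK: "b \<in> K"
  proof -
    have "fst q - fst p \<in> K" "snd q - snd p \<in> K"
      using q p TK B_K [of "fst q" "snd q"] by (auto intro!: csubspace_diff [OF csubspace_K])
    then show "a \<in> K" "b \<in> K" using ab by (metis fst_conv fst_diff, metis snd_conv snd_diff)
  qed
  have ortho: "cinner a (\<Gamma> z x - \<Gamma> w x) = - cinner b (z *\<^sub>C \<Gamma> z x - w *\<^sub>C \<Gamma> w x)"
    if zw: "Im z \<noteq> 0" "Im w \<noteq> 0" for z w x
  proof -
    have "(\<Gamma> z x - \<Gamma> w x, z *\<^sub>C \<Gamma> z x - w *\<^sub>C \<Gamma> w x) \<in> T"
      unfolding T_def by (rule subsetD [OF closed_cspan_superset]) (use zw in blast)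
    then have "cinner (a, b) (\<Gamma> z x - \<Gamma> w x, z *\<^sub>C \<Gamma> z x - w *\<^sub>C \<Gamma> w x) = 0"
      using orth ab by metis
    then show ?thesis by (simp add: eq_neg_iff_add_eq_0)
  qed
  have symm: "cinner b (\<Gamma> z x - \<Gamma> w x) = cinner a (z *\<^sub>C \<Gamma> z x - w *\<^sub>C \<Gamma> w x)"
    if zw: "Im z \<noteq> 0" "Im w \<noteq> 0" for z w x
  proof -
    have 1: "cinner (snd q) (\<Gamma> z x - \<Gamma> w x) = cinner (fst q) (z *\<^sub>C \<Gamma> z x - w *\<^sub>C \<Gamma> w x)"
      using q by (intro B_eq zw) simp
    have 2: "cinner (snd p) (\<Gamma> z x - \<Gamma> w x) = cinner (fst p) (z *\<^sub>C \<Gamma> z x - w *\<^sub>C \<Gamma> w x)"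
      by (rule T_symmetric [OF _ \<Gamma>_B [OF zw]]) (use p in simp)
    have "a = fst q - fst p" "b = snd q - snd p" using ab by (metis fst_conv fst_diff, metis snd_conv snd_diff)
    then show ?thesis using 1 2 by (simp only: cinner_diff_left)
  qed
  \<comment> \<open>With \<open>- s\<close> as second family point, the two relations for
    \<open>(a, b)\<close> combine to \<open>(s - cnj z) * cinner c (\<Gamma> z x) = 0\<close>,
    because \<open>cnj s = - s\<close> removes the terms at \<open>- s\<close>. The two signs of
    \<open>s\<close> together determine \<open>a\<close> and \<open>b\<close>.\<close>
  have zero: "b + s *\<^sub>C a = 0" if s: "s = \<i> \<or> s = - \<i>" for s
  proof -
    define c where "c = b + s *\<^sub>C a"
    have ss: "s * s = - 1" "cnj s = - s" "Im s \<noteq> 0" using s by auto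
    have cK: "c \<in> K" unfolding c_def by (intro csubspace_add csubspace_scaleC csubspace_K aK bK)
    have "cinner c (\<Gamma> z x) = 0" if z: "Im z \<noteq> 0" "z \<noteq> - s" for z x
    proof -
      have w: "Im (- s) \<noteq> 0" using ss(3) by simp
      let ?d = "\<Gamma> z x - \<Gamma> (- s) x" and ?e = "z *\<^sub>C \<Gamma> z x - (- s) *\<^sub>C \<Gamma> (- s) x"
      have "cinner c ?e = cinner b ?e + s * cinner a ?e"
        by (simp only: c_def cinner_add_left cinner_scaleC_left)
      also have "\<dots> = (s * s) * cinner a ?d + s * cinner b ?d"
        unfolding ss(1) using ortho [OF z(1) w, of x] symm [OF z(1) w, of x] by simp
      also have "\<dots> = s * cinner c ?d"
        by (simp add: c_def cinner_add_left cinner_scaleC_left algebra_simps)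
      finally have "(s - cnj z) * cinner c (\<Gamma> z x) = 0"
        by (auto simp: cinner_diff_right cinner_minus_right cinner_scaleC_right ss(2) algebra_simps)
      moreover have "s \<noteq> cnj z" using z(2) ss(2) by (metis complex_cnj_cnj)
      ultimately show ?thesis by simp
    qed
    then have "cinner c (\<Gamma> z x) = 0" if "Im z \<noteq> 0" for z x
      using that by (rule orthogonal_except_one)
    then have "cinner c c = 0" by (rule orthogonal_K [OF _ cK])
    then show ?thesis by (simp add: c_def)
  qed
  have "b + \<i> *\<^sub>C a = 0" "b + (- \<i>) *\<^sub>C a = 0" by (rule zero; simp)+
  then have "2 *\<^sub>C b = 0" "b + \<i> *\<^sub>C a = 0"
    by (simp_all add: scaleC_minus_left scaleC_add_left [of 1 1, simplified])
  then have "b = 0" using scaleC_cancel [of 2 b 0] by simp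
  then have "\<i> *\<^sub>C a = \<i> *\<^sub>C 0" using \<open>b + \<i> *\<^sub>C a = 0\<close> by simp
  then have "a = 0" by (rule scaleC_cancel [rotated]) simp
  then have "q = p" using ab \<open>b = 0\<close> by (simp add: zero_prod_def [symmetric])
  then show "q \<in> T" using p by simp
qed

lemma self_adjoint_B: "self_adjoint_rel K B"
  unfolding self_adjoint_rel_def
proof
  show "B \<subseteq> K \<times> K" unfolding B_def by blast
  show "rel_adjoint K B = B"
  proof
    show "B \<subseteq> rel_adjoint K B"
    proof (rule subrelI)
      fix f g assume fg: "(f, g) \<in> B"
      have "cinner v f = cinner u g" if "(u, v) \<in> B" for u v
        using that B_subset_T by (intro T_symmetric fg) blast
      then show "(f, g) \<in> rel_adjoint K B"
        using B_K [OF fg] unfolding rel_adjoint_def by blast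
    qed
    show "rel_adjoint K B \<subseteq> B"
    proof (rule subrelI)
      fix f g assume fg: "(f, g) \<in> rel_adjoint K B"
      show "(f, g) \<in> B"
      proof (rule B_memI)
        show "f \<in> K" "g \<in> K" using fg unfolding rel_adjoint_def by blast+
        fix z w :: complex and x assume zw: "Im z \<noteq> 0" "Im w \<noteq> 0"
        have "cinner (z *\<^sub>C \<Gamma> z x - w *\<^sub>C \<Gamma> w x) f = cinner (\<Gamma> z x - \<Gamma> w x) g"
          using fg \<Gamma>_B [OF zw, of x] unfolding rel_adjoint_def by blast
        then show "cinner g (\<Gamma> z x - \<Gamma> w x) = cinner f (z *\<^sub>C \<Gamma> z x - w *\<^sub>C \<Gamma> w x)"
          by (metis cinner_commute)
      qed
    qed
  qed
qed

sublocale realisation: resolvent_family K B \<Gamma>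
  by unfold_locales (simp_all add: closed_csubspace_K self_adjoint_B \<Gamma>_K \<Gamma>_B)

lemma defect_family_\<Gamma>:
  assumes z\<^sub>0: "Im z\<^sub>0 \<noteq> 0" and z: "Im z \<noteq> 0"
  shows "\<Gamma> z\<^sub>0 x + (z - z\<^sub>0) *\<^sub>C resolvent B z (\<Gamma> z\<^sub>0 x) = \<Gamma> z x"
proof -
  note zr = realisation.nonreal_resolvent_set [OF z]
  have "(z\<^sub>0 - z) *\<^sub>C resolvent B z (\<Gamma> z\<^sub>0 x) = resolvent B z ((z\<^sub>0 - z) *\<^sub>C \<Gamma> z\<^sub>0 x)"
    by (rule realisation.resolvent_scaleC [OF zr \<Gamma>_K [OF z\<^sub>0], symmetric])
  also have "\<dots> = \<Gamma> z\<^sub>0 x - \<Gamma> z x"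
    by (rule realisation.resolvent_of_difference [OF zr \<Gamma>_B [OF z\<^sub>0 z]])
  finally show ?thesis by (simp add: scaleC_diff_left algebra_simps)
qed

lemma nonreal_hol_domain: "Im z \<noteq> 0 \<Longrightarrow> z \<in> hol_domain Q"
  using holomorphic by (simp add: hol_domain_def)

text \<open>A Gram family is the defect family of its own relation \<open>B\<close>, and then the
  Gram identity with second point \<open>z\<^sub>0\<close> is the realisation formula at nonreal
  points. At real points of holomorphy the formula concerns a continuation and is obtained as a
  limit.\<close>

lemma minimal_realisation_span:
  assumes z\<^sub>0: "Im z\<^sub>0 > 0"
  shows "minimal_realisation Q z\<^sub>0 K B (\<Gamma> z\<^sub>0)"
proof -
  have z0: "Im z\<^sub>0 \<noteq> 0" using z\<^sub>0 by simp
  define F where "F z x = \<Gamma> z\<^sub>0 x + (z - z\<^sub>0) *\<^sub>C resolvent B z (\<Gamma> z\<^sub>0 x)" for z x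
  define V where "V z x = cadjoint (Q z\<^sub>0) x + (z - cnj z\<^sub>0) *\<^sub>C cadjoint (\<Gamma> z\<^sub>0) (F z x)" for z x
  have F_nonreal: "F z x = \<Gamma> z x" if "Im z \<noteq> 0" for z x
    unfolding F_def by (rule defect_family_\<Gamma> [OF z0 that])
  have V: "cinner (V z x) y = cinner x (Q z\<^sub>0 y) + (z - cnj z\<^sub>0) * cinner (F z x) (\<Gamma> z\<^sub>0 y)" for z x y
    by (simp add: V_def cinner_add_left cinner_scaleC_left cinner_cadjoint_left [OF \<Gamma>_bounded [OF z0]]
        cinner_cadjoint_left [OF Q_bounded [OF z0]])
  have V_nonreal: "V z x = Q z x" if z: "Im z \<noteq> 0" for z x
    by (rule cinner_ext) (simp add: V F_nonreal [OF z] gram [OF z z0])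
  have F_lim: "(\<lambda>n. \<Gamma> (approach z n) x) \<longlonglongrightarrow> F z x" if z: "z \<in> resolvent_set K B" for z x
  proof (rule realisation.family_continuous [OF z _ approach_tendsto])
    show "F z x \<in> K"
      unfolding F_def
      by (intro csubspace_add csubspace_scaleC csubspace_K \<Gamma>_K z0 realisation.resolvent_in_H z)
    fix n
    have "(F z x - \<Gamma> z\<^sub>0 x, z *\<^sub>C F z x - z\<^sub>0 *\<^sub>C \<Gamma> z\<^sub>0 x) \<in> B"
      unfolding F_def by (rule realisation.defect_relation [OF z \<Gamma>_K [OF z0]])
    from realisation.A_diff [OF \<Gamma>_B [OF approach_nonreal z0, of z n x] this]
    show "(\<Gamma> (approach z n) x - F z x, approach z n *\<^sub>C \<Gamma> (approach z n) x - z *\<^sub>C F z x) \<in> B"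
      by (simp only: diff_diff_eq2 diff_add_cancel)
  qed
  have "hol_value Q z x = V z x" if z: "z \<in> hol_domain Q \<inter> resolvent_set K B" for z x
  proof (cases "Im z = 0")
    case True
    \<comment> \<open>The value at a real point is a definite description, so every continuation has
      to be shown to take the same value: it agrees with \<open>Q\<close> along the approaching
      nonreal points, where \<open>Q\<close> tends to \<open>V z\<close>.\<close>
    have unique: "G z = V z" if G: "op_continuation_at Q G z" for G
    proof (intro ext cinner_ext)
      fix x y
      have hol: "op_holomorphic_at G z" and ev: "\<forall>\<^sub>F w in nhds z. Im w \<noteq> 0 \<longrightarrow> G w = Q w"
        using G by (simp_all add: op_continuation_at_def)
      have "(\<lambda>n. G (approach z n) x) \<longlonglongrightarrow> G z x"
        by (rule op_holomorphic_seq [OF hol approach_tendsto approach_neq])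
      then have lim1: "(\<lambda>n. cinner (G (approach z n) x) y) \<longlonglongrightarrow> cinner (G z x) y"
        by (rule tendsto_cinner_left)
      have "(\<lambda>n. cinner x (Q z\<^sub>0 y) + (approach z n - cnj z\<^sub>0) * cinner (\<Gamma> (approach z n) x) (\<Gamma> z\<^sub>0 y))
          \<longlonglongrightarrow> cinner x (Q z\<^sub>0 y) + (z - cnj z\<^sub>0) * cinner (F z x) (\<Gamma> z\<^sub>0 y)"
        using z by (intro tendsto_intros approach_tendsto F_lim) simp
      then have lim2: "(\<lambda>n. cinner (Q (approach z n) x) y) \<longlonglongrightarrow> cinner (V z x) y"
        unfolding V [symmetric] by (simp add: gram [OF approach_nonreal z0])
      have "\<forall>\<^sub>F n in sequentially. Im (approach z n) \<noteq> 0 \<longrightarrow> G (approach z n) = Q (approach z n)"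
        by (rule eventually_compose_filterlim [OF ev approach_tendsto])
      then have "\<forall>\<^sub>F n in sequentially. cinner (G (approach z n) x) y = cinner (Q (approach z n) x) y"
        by (rule eventually_mono) (simp add: approach_nonreal)
      then have "(\<lambda>n. cinner (G (approach z n) x) y) \<longlonglongrightarrow> cinner (V z x) y"
        using lim2 by (simp add: tendsto_cong)
      then show "cinner (G z x) y = cinner (V z x) y" by (rule LIMSEQ_unique [OF lim1])
    qed
    obtain G where G: "op_continuation_at Q G z" using z True by (auto simp: hol_domain_def)
    have "(THE S. \<exists>G. op_continuation_at Q G z \<and> S = G z) = V z"
    proof (rule the_equality)
      show "\<exists>G. op_continuation_at Q G z \<and> V z = G z"
        by (intro exI [of _ G] conjI G unique [OF G, symmetric])
      show "S = V z" if "\<exists>G. op_continuation_at Q G z \<and> S = G z" for S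
        using that unique by metis
    qed
    then show ?thesis using True by (simp add: hol_value_def)
  next
    case False
    then show ?thesis by (simp add: hol_value_def V_nonreal)
  qed
  then have val: "\<forall>z\<in>hol_domain Q \<inter> resolvent_set K B. \<forall>x. hol_value Q z x = cadjoint (Q z\<^sub>0) x +
      (z - cnj z\<^sub>0) *\<^sub>C cadjoint (\<Gamma> z\<^sub>0) (\<Gamma> z\<^sub>0 x + (z - z\<^sub>0) *\<^sub>C resolvent B z (\<Gamma> z\<^sub>0 x))"
    by (simp add: V_def F_def)
  have "K = closed_cspan {F z x |z x. z \<in> resolvent_set K B}"
  proof
    have sub: "{\<Gamma> z x |z x. Im z \<noteq> 0} \<subseteq> {F z x |z x. z \<in> resolvent_set K B}"
    proof clarify
      fix z x assume z: "Im z \<noteq> 0"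
      show "\<exists>z' x'. \<Gamma> z x = F z' x' \<and> z' \<in> resolvent_set K B"
        by (intro exI [of _ z] exI [of _ x] conjI)
          (simp_all add: F_nonreal [OF z] realisation.nonreal_resolvent_set [OF z])
    qed
    show "K \<subseteq> closed_cspan {F z x |z x. z \<in> resolvent_set K B}"
      by (subst K_def)
        (rule closed_cspan_minimal [OF closed_csubspace_closed_cspan subset_trans [OF sub closed_cspan_superset]])
    have "F z x \<in> K" if "z \<in> resolvent_set K B" for z x
      unfolding F_def
      by (intro csubspace_add csubspace_scaleC csubspace_K \<Gamma>_K z0 realisation.resolvent_in_H that)
    then show "closed_cspan {F z x |z x. z \<in> resolvent_set K B} \<subseteq> K"
      by (intro closed_cspan_minimal closed_csubspace_K) blast
  qed
  moreover have "range (\<Gamma> z\<^sub>0) \<subseteq> K" using \<Gamma>_K [OF z0] by blast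
  ultimately show ?thesis
    unfolding minimal_realisation_def F_def
    using val z\<^sub>0 nonreal_hol_domain [OF z0] realisation.nonreal_resolvent_set [OF z0]
      closed_csubspace_K self_adjoint_B \<Gamma>_bounded [OF z0] by simp
qed

end

subsection \<open>Generalised values in terms of Gram families\<close>

locale minimal_realisation_of =
  fixes Q :: "complex \<Rightarrow> 'g \<Rightarrow> 'g::complex_hilbert" and z\<^sub>0 :: complex
    and H :: "'h::complex_hilbert set" and A and \<gamma> :: "'g \<Rightarrow> 'h"
  assumes nonreal_hol: "Im z \<noteq> 0 \<Longrightarrow> op_holomorphic_at Q z"
    and realisation: "minimal_realisation Q z\<^sub>0 H A \<gamma>"
begin

lemma base: "Im z\<^sub>0 > 0" "Im z\<^sub>0 \<noteq> 0"
  using realisation by (simp_all add: minimal_realisation_def)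

sublocale self_adjoint_relation H A
  using realisation by unfold_locales (simp_all add: minimal_realisation_def)

lemma \<gamma>_bounded: "bounded_clinear \<gamma>" and \<gamma>_mem: "\<gamma> x \<in> H"
  using realisation unfolding minimal_realisation_def by blast+

definition F where "F z x = \<gamma> x + (z - z\<^sub>0) *\<^sub>C resolvent A z (\<gamma> x)"

lemma F_base: "F z\<^sub>0 x = \<gamma> x"
  by (simp add: F_def)

lemma F_rel_base: "z \<in> resolvent_set H A \<Longrightarrow> (F z x - \<gamma> x, z *\<^sub>C F z x - z\<^sub>0 *\<^sub>C \<gamma> x) \<in> A"
  unfolding F_def by (rule defect_relation [OF _ \<gamma>_mem])

sublocale resolvent_family H A F
proof
  fix z x assume z: "Im z \<noteq> 0"
  show "F z x \<in> H"
    unfolding F_def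
    by (intro csubspace_add csubspace_scaleC csubspace_H \<gamma>_mem resolvent_in_H nonreal_resolvent_set z)
  fix w assume w: "Im w \<noteq> 0"
  show "(F z x - F w x, z *\<^sub>C F z x - w *\<^sub>C F w x) \<in> A"
    using A_diff [OF F_rel_base [OF nonreal_resolvent_set [OF z], of x]
        F_rel_base [OF nonreal_resolvent_set [OF w], of x]]
    by (simp only: diff_diff_eq2 diff_add_cancel)
qed

lemma Q_formula:
  assumes z: "Im z \<noteq> 0"
  shows "(z - cnj z\<^sub>0) * cinner (F z x) (\<gamma> y) = cinner (Q z x) y - cinner x (Q z\<^sub>0 y)"
proof -
  have "z \<in> hol_domain Q \<inter> resolvent_set H A"
    using z nonreal_hol [OF z] nonreal_resolvent_set [OF z] by (simp add: hol_domain_def)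
  then have "hol_value Q z x = cadjoint (Q z\<^sub>0) x + (z - cnj z\<^sub>0) *\<^sub>C cadjoint \<gamma> (F z x)"
    using realisation unfolding minimal_realisation_def F_def by blast
  then have "Q z x = cadjoint (Q z\<^sub>0) x + (z - cnj z\<^sub>0) *\<^sub>C cadjoint \<gamma> (F z x)"
    using z by (simp add: hol_value_def)
  then show ?thesis
    by (simp add: cinner_add_left cinner_scaleC_left cinner_cadjoint_left [OF \<gamma>_bounded]
        cinner_cadjoint_left [OF op_holomorphic_bounded [OF nonreal_hol [OF base(2)]]])
qed

text \<open>The realisation formula only gives products with the base vectors
  \<open>\<gamma> y\<close>; symmetry of \<open>A\<close> between differences from the base point
  carries it to an arbitrary second point.\<close>

lemma cinner_F_split:
  assumes z: "Im z \<noteq> 0" and w: "Im w \<noteq> 0"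
  shows "(z - cnj w) * cinner (F z x) (F w y) = cinner (Q z x) y - cinner x (Q w y)"
proof -
  have sym: "cinner (z *\<^sub>C F z x - z\<^sub>0 *\<^sub>C F z\<^sub>0 x) (F w y - F z\<^sub>0 y) =
      cinner (F z x - F z\<^sub>0 x) (w *\<^sub>C F w y - z\<^sub>0 *\<^sub>C F z\<^sub>0 y)"
    by (rule symmetric [OF F_rel [OF z base(2)] F_rel [OF w base(2)]])
  have comb: "(z - w') * a = (z - z0') * b + (z1 - w') * c - (z1 - z0') * d"
    if "z * a - z1 * c - (z * b - z1 * d) = w' * a - w' * c - (z0' * b - z0' * d)"
    for z w' z0' z1 a b c d :: complex
    using that by (simp add: algebra_simps)
  have "(z - cnj w) * cinner (F z x) (F w y) = (z - cnj z\<^sub>0) * cinner (F z x) (\<gamma> y)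
      + (z\<^sub>0 - cnj w) * cinner (\<gamma> x) (F w y) - (z\<^sub>0 - cnj z\<^sub>0) * cinner (\<gamma> x) (\<gamma> y)"
    by (rule comb)
      (use sym in \<open>simp add: cinner_diff_left cinner_diff_right cinner_scaleC_left cinner_scaleC_right
        right_diff_distrib F_base\<close>)
  moreover have "(z\<^sub>0 - cnj w) * cinner (\<gamma> x) (F w y) = cinner (Q z\<^sub>0 x) y - cinner x (Q w y)"
  proof -
    have "(z\<^sub>0 - cnj w) * cinner (\<gamma> x) (F w y) = - cnj ((w - cnj z\<^sub>0) * cinner (F w y) (\<gamma> x))"
      by (simp add: cinner_commute [of "\<gamma> x"] left_diff_distrib)
    also have "\<dots> = cinner (Q z\<^sub>0 x) y - cinner x (Q w y)"
      unfolding Q_formula [OF w] by (simp add: cinner_commute [of "Q z\<^sub>0 x"] cinner_commute [of x])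
    finally show ?thesis .
  qed
  moreover have "(z\<^sub>0 - cnj z\<^sub>0) * cinner (\<gamma> x) (\<gamma> y) = cinner (Q z\<^sub>0 x) y - cinner x (Q z\<^sub>0 y)"
    using Q_formula [OF base(2), of x y] by (simp add: F_base)
  ultimately show ?thesis unfolding Q_formula [OF z] by simp
qed

sublocale gram: gram_family Q F
  by unfold_locales (simp_all add: nonreal_hol cinner_F_split)

text \<open>The nonreal members of the family already span the state space, since orthogonality to
  them extends to the whole resolvent set.\<close>

lemma L_eq: "L = H"
  unfolding L_def
proof (rule closed_cspan_eqI [OF H])
  show "{F z x |z x. Im z \<noteq> 0} \<subseteq> H" using F_mem by blast
  fix u assume u: "u \<in> H" and orth: "\<And>v. v \<in> {F z x |z x. Im z \<noteq> 0} \<Longrightarrow> cinner u v = 0"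
  have "H = closed_cspan {\<gamma> x + (z - z\<^sub>0) *\<^sub>C resolvent A z (\<gamma> x) |z x. z \<in> resolvent_set H A}"
    using realisation unfolding minimal_realisation_def by blast
  then have span: "u \<in> closed_cspan {\<gamma> x + (z - z\<^sub>0) *\<^sub>C resolvent A z (\<gamma> x) |z x. z \<in> resolvent_set H A}"
    using u by simp
  have "cinner u u = 0"
  proof (rule closed_cspan_orthogonal [OF _ span], clarify)
    fix z x assume z: "z \<in> resolvent_set H A"
    show "cinner u (\<gamma> x + (z - z\<^sub>0) *\<^sub>C resolvent A z (\<gamma> x)) = 0"
    proof (rule defect_orthogonal [OF \<gamma>_mem z])
      fix w assume "Im w \<noteq> 0"
      then have "cinner u (F w x) = 0" by (intro orth) blast
      then show "cinner u (\<gamma> x + (w - z\<^sub>0) *\<^sub>C resolvent A w (\<gamma> x)) = 0" by (simp add: F_def)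
    qed
  qed
  then show "u = 0" by simp
qed

text \<open>The vector \<open>h\<close> is the defect vector at \<alpha>, namely
  \<open>\<gamma> c + (\<alpha> - z\<^sub>0) *\<^sub>C f\<close> for an element \<open>f\<close> of
  the possibly multivalued inverse of \<open>A - \<alpha>\<close> at \<open>\<gamma> c\<close>.
  Division by \<open>\<alpha> - z\<^sub>0\<close> recovers \<open>f\<close> from
  \<open>h\<close>.\<close>

lemma value_via_relation:
  assumes \<alpha>: "\<alpha> \<noteq> z\<^sub>0"
  shows "(c, d) \<in> value_via Q z\<^sub>0 H A \<gamma> \<alpha> \<longleftrightarrow>
    (\<exists>h\<in>H. (h - \<gamma> c, \<alpha> *\<^sub>C h - z\<^sub>0 *\<^sub>C \<gamma> c) \<in> A \<and>
      d = cadjoint (Q z\<^sub>0) c + (\<alpha> - cnj z\<^sub>0) *\<^sub>C cadjoint \<gamma> h)" (is "_ \<longleftrightarrow> ?rhs")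
proof
  assume "(c, d) \<in> value_via Q z\<^sub>0 H A \<gamma> \<alpha>"
  then obtain f where f: "(f, \<gamma> c) \<in> rel_shift A \<alpha>" and mem: "\<gamma> c + (\<alpha> - z\<^sub>0) *\<^sub>C f \<in> H"
    and d: "d = cadjoint (Q z\<^sub>0) c + (\<alpha> - cnj z\<^sub>0) *\<^sub>C cadjoint \<gamma> (\<gamma> c + (\<alpha> - z\<^sub>0) *\<^sub>C f)"
    unfolding value_via_def rel_sum_def rel_scale_def graph_on_def by auto
  let ?h = "\<gamma> c + (\<alpha> - z\<^sub>0) *\<^sub>C f"
  have "((\<alpha> - z\<^sub>0) *\<^sub>C f, (\<alpha> - z\<^sub>0) *\<^sub>C (\<gamma> c + \<alpha> *\<^sub>C f)) \<in> A"
    using f unfolding rel_shift_iff by (rule A_scaleC)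
  moreover have "(\<alpha> - z\<^sub>0) *\<^sub>C (\<gamma> c + \<alpha> *\<^sub>C f) = \<alpha> *\<^sub>C ?h - z\<^sub>0 *\<^sub>C \<gamma> c"
    by (simp add: scaleC_linear algebra_simps)
  ultimately show ?rhs using mem d by (intro bexI [of _ ?h]) simp_all
next
  assume ?rhs
  then obtain h where h: "h \<in> H" "(h - \<gamma> c, \<alpha> *\<^sub>C h - z\<^sub>0 *\<^sub>C \<gamma> c) \<in> A"
    and d: "d = cadjoint (Q z\<^sub>0) c + (\<alpha> - cnj z\<^sub>0) *\<^sub>C cadjoint \<gamma> h" by blast
  define f where "f = (1 / (\<alpha> - z\<^sub>0)) *\<^sub>C (h - \<gamma> c)"
  have hf: "\<gamma> c + (\<alpha> - z\<^sub>0) *\<^sub>C f = h" using \<alpha> by (simp add: f_def scaleC_scaleC)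
  have "\<alpha> *\<^sub>C h - z\<^sub>0 *\<^sub>C \<gamma> c = (\<alpha> - z\<^sub>0) *\<^sub>C (\<gamma> c + \<alpha> *\<^sub>C f)"
    unfolding hf [symmetric] by (simp add: scaleC_linear algebra_simps)
  then have "(f, (1 / (\<alpha> - z\<^sub>0)) *\<^sub>C ((\<alpha> - z\<^sub>0) *\<^sub>C (\<gamma> c + \<alpha> *\<^sub>C f))) \<in> A"
    using A_scaleC [OF h(2), of "1 / (\<alpha> - z\<^sub>0)"] by (simp only: f_def)
  then have f: "(f, \<gamma> c) \<in> rel_shift A \<alpha>" using \<alpha> by (simp add: rel_shift_iff scaleC_scaleC)
  have "(\<gamma> c, (\<alpha> - z\<^sub>0) *\<^sub>C f) \<in> rel_scale (\<alpha> - z\<^sub>0) ((rel_shift A \<alpha>)\<inverse>)"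
    unfolding rel_scale_def using f by blast
  moreover have "(\<gamma> c, \<gamma> c) \<in> Id_on H" by (rule Id_onI [OF \<gamma>_mem])
  ultimately have "(\<gamma> c, \<gamma> c + (\<alpha> - z\<^sub>0) *\<^sub>C f) \<in>
      rel_sum (Id_on H) (rel_scale (\<alpha> - z\<^sub>0) ((rel_shift A \<alpha>)\<inverse>))"
    unfolding rel_sum_def by blast
  then have "(\<gamma> c, h) \<in> rel_sum (Id_on H) (rel_scale (\<alpha> - z\<^sub>0) ((rel_shift A \<alpha>)\<inverse>))"
    unfolding hf .
  then have "(c, cadjoint \<gamma> h) \<in> graph_on UNIV \<gamma> O
      rel_sum (Id_on H) (rel_scale (\<alpha> - z\<^sub>0) ((rel_shift A \<alpha>)\<inverse>)) O graph_on H (cadjoint \<gamma>)"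
    using h(1) unfolding graph_on_def by (intro relcompI [of c "\<gamma> c"] relcompI [of "\<gamma> c" h]) auto
  then show "(c, d) \<in> value_via Q z\<^sub>0 H A \<gamma> \<alpha>"
    unfolding value_via_def rel_sum_def [of "graph_on UNIV (cadjoint (Q z\<^sub>0))"] rel_scale_def [of "\<alpha> - cnj z\<^sub>0"] d
    by (fastforce simp: graph_on_def)
qed

text \<open>The equation at \<open>z = z\<^sub>0\<close> determines \<open>d\<close>. Given it, the
  equations at all other points are equivalent to \<open>(h - F z\<^sub>0 c, \<alpha> *\<^sub>C h -
  z\<^sub>0 *\<^sub>C F z\<^sub>0 c) \<in> A\<close>: one direction is symmetry of \<open>A\<close>,
  the other is the test of \<open>mem_A_if_family\<close>, with the products of
  \<open>F z\<^sub>0 c\<close> read off from the Gram identity.\<close>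

lemma value_via_iff:
  fixes \<alpha> :: real
  shows "(c, d) \<in> value_via Q z\<^sub>0 H A \<gamma> \<alpha> \<longleftrightarrow>
    (\<exists>h\<in>H. \<forall>z y. Im z \<noteq> 0 \<longrightarrow> (\<alpha> - cnj z) * cinner h (F z y) = cinner d y - cinner c (Q z y))"
    (is "_ \<longleftrightarrow> ?rhs")
proof -
  have neq: "complex_of_real \<alpha> \<noteq> z\<^sub>0" using base(2) by auto
  note g = cinner_F_split [OF base(2)]
  have d_iff: "d = cadjoint (Q z\<^sub>0) c + (\<alpha> - cnj z\<^sub>0) *\<^sub>C cadjoint \<gamma> h \<longleftrightarrow>
      (\<forall>y. (\<alpha> - cnj z\<^sub>0) * cinner h (F z\<^sub>0 y) = cinner d y - cinner c (Q z\<^sub>0 y))" (is "?l \<longleftrightarrow> ?r") for h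
  proof -
    have e: "cinner (cadjoint (Q z\<^sub>0) c + (\<alpha> - cnj z\<^sub>0) *\<^sub>C cadjoint \<gamma> h) y =
        cinner c (Q z\<^sub>0 y) + (\<alpha> - cnj z\<^sub>0) * cinner h (F z\<^sub>0 y)" for y
      by (simp add: cinner_add_left cinner_scaleC_left cinner_cadjoint_left [OF \<gamma>_bounded] F_base
          cinner_cadjoint_left [OF op_holomorphic_bounded [OF nonreal_hol [OF base(2)]]])
    show ?thesis
    proof
      assume ?l
      then have "cinner d y = cinner c (Q z\<^sub>0 y) + (\<alpha> - cnj z\<^sub>0) * cinner h (F z\<^sub>0 y)" for y
        unfolding e [symmetric] by (rule arg_cong)
      then show ?r by simp
    next
      assume r: ?r
      show ?l by (rule cinner_ext) (simp add: e r)
    qed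
  qed
  have val: "(c, d) \<in> value_via Q z\<^sub>0 H A \<gamma> \<alpha> \<longleftrightarrow>
      (\<exists>h\<in>H. (h - F z\<^sub>0 c, \<alpha> *\<^sub>C h - z\<^sub>0 *\<^sub>C F z\<^sub>0 c) \<in> A \<and>
        (\<forall>y. (\<alpha> - cnj z\<^sub>0) * cinner h (F z\<^sub>0 y) = cinner d y - cinner c (Q z\<^sub>0 y)))"
    by (simp only: value_via_relation [OF neq] d_iff F_base)
  show ?thesis
  proof
    assume "(c, d) \<in> value_via Q z\<^sub>0 H A \<gamma> \<alpha>"
    then obtain h where h: "h \<in> H" "(h - F z\<^sub>0 c, \<alpha> *\<^sub>C h - z\<^sub>0 *\<^sub>C F z\<^sub>0 c) \<in> A"
      and d: "\<And>y. (\<alpha> - cnj z\<^sub>0) * cinner h (F z\<^sub>0 y) = cinner d y - cinner c (Q z\<^sub>0 y)"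
      unfolding val by blast
    have "(\<alpha> - cnj z) * cinner h (F z y) = cinner d y - cinner c (Q z y)" if z: "Im z \<noteq> 0" for z y
    proof -
      have sym: "cinner (\<alpha> *\<^sub>C h - z\<^sub>0 *\<^sub>C F z\<^sub>0 c) (F z y - F z\<^sub>0 y) =
          cinner (h - F z\<^sub>0 c) (z *\<^sub>C F z y - z\<^sub>0 *\<^sub>C F z\<^sub>0 y)"
        by (rule symmetric [OF h(2) F_rel [OF z base(2)]])
      have comb: "(al - z') * hz = (al - z0') * h0 + (z1 - z') * a - (z1 - z0') * b"
        if "al * hz - z1 * a - (al * h0 - z1 * b) = z' * hz - z' * a - (z0' * h0 - z0' * b)"
        for al z' z0' z1 hz h0 a b :: complex
        using that by (simp add: algebra_simps)
      have "(\<alpha> - cnj z) * cinner h (F z y) = (\<alpha> - cnj z\<^sub>0) * cinner h (F z\<^sub>0 y)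
          + (z\<^sub>0 - cnj z) * cinner (F z\<^sub>0 c) (F z y) - (z\<^sub>0 - cnj z\<^sub>0) * cinner (F z\<^sub>0 c) (F z\<^sub>0 y)"
        by (rule comb)
          (use sym in \<open>simp add: cinner_diff_left cinner_diff_right cinner_scaleC_left
            cinner_scaleC_right right_diff_distrib\<close>)
      then show ?thesis unfolding d g [OF z] g [OF base(2)] by simp
    qed
    then show ?rhs using h(1) by blast
  next
    assume ?rhs
    then obtain h where hH: "h \<in> H"
      and h: "\<And>z y. Im z \<noteq> 0 \<Longrightarrow> (\<alpha> - cnj z) * cinner h (F z y) = cinner d y - cinner c (Q z y)"
      by blast
    have "(h - F z\<^sub>0 c, \<alpha> *\<^sub>C h - z\<^sub>0 *\<^sub>C F z\<^sub>0 c) \<in> A"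
    proof (rule mem_A_if_family)
      show "h - F z\<^sub>0 c \<in> L" "\<alpha> *\<^sub>C h - z\<^sub>0 *\<^sub>C F z\<^sub>0 c \<in> L"
        unfolding L_eq by (intro csubspace_diff csubspace_scaleC csubspace_H hH F_mem base)+
      fix z w y assume z: "Im z \<noteq> 0" and w: "Im w \<noteq> 0"
      have comb: "al * hz - z1 * a - (al * hw - z1 * b) = z' * hz - z' * a - (w' * hw - w' * b)"
        if "(al - z') * hz = d - e" "(al - w') * hw = d - e'" "(z1 - z') * a = q - e" "(z1 - w') * b = q - e'"
        for al z' w' z1 hz hw a b d e e' q :: complex
      proof -
        have "al * hz - z1 * a - (al * hw - z1 * b) - (z' * hz - z' * a - (w' * hw - w' * b)) =
          (al - z') * hz - (al - w') * hw - (z1 - z') * a + (z1 - w') * b" by (simp add: algebra_simps)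
        also have "\<dots> = 0" unfolding that by simp
        finally show ?thesis by simp
      qed
      show "cinner (\<alpha> *\<^sub>C h - z\<^sub>0 *\<^sub>C F z\<^sub>0 c) (F z y - F w y) =
          cinner (h - F z\<^sub>0 c) (z *\<^sub>C F z y - w *\<^sub>C F w y)"
        using comb [OF h [OF z, of y] h [OF w, of y] g [OF z, of c y] g [OF w, of c y]]
        by (simp add: cinner_diff_left cinner_diff_right cinner_scaleC_left cinner_scaleC_right
            right_diff_distrib)
    qed
    then show "(c, d) \<in> value_via Q z\<^sub>0 H A \<gamma> \<alpha>"
      unfolding val using hH h [OF base(2)] by blast
  qed
qed

end

context gram_family
begin

text \<open>Division by \<open>z - cnj w\<close> settles all entries but those with
  \<open>z = cnj w\<close>, where the identity carries no information on the product and continuity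
  is used.\<close>

lemma gram_unique:
  assumes \<Gamma>': "gram_family Q \<Gamma>'" and z: "Im z \<noteq> 0" and w: "Im w \<noteq> 0"
  shows "cinner (\<Gamma> z x) (\<Gamma> w y) = cinner (\<Gamma>' z x) (\<Gamma>' w y)"
proof -
  interpret other: gram_family Q \<Gamma>' by (rule \<Gamma>')
  have neq: "cinner (\<Gamma> u x) (\<Gamma> w y) = cinner (\<Gamma>' u x) (\<Gamma>' w y)" if u: "Im u \<noteq> 0" "u \<noteq> cnj w" for u
  proof -
    have "(u - cnj w) * cinner (\<Gamma> u x) (\<Gamma> w y) = (u - cnj w) * cinner (\<Gamma>' u x) (\<Gamma>' w y)"
      by (simp only: gram [OF u(1) w] other.gram [OF u(1) w])
    then show ?thesis using u(2) by simp
  qed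
  show ?thesis
  proof (cases "z = cnj w")
    case True
    have "(\<lambda>n. cinner (\<Gamma> (approach z n) x) (\<Gamma> w y)) \<longlonglongrightarrow> cinner (\<Gamma> z x) (\<Gamma> w y)"
      by (rule tendsto_cinner_left [OF \<Gamma>_approach [OF z]])
    moreover have "(\<lambda>n. cinner (\<Gamma>' (approach z n) x) (\<Gamma>' w y)) \<longlonglongrightarrow> cinner (\<Gamma>' z x) (\<Gamma>' w y)"
      by (rule tendsto_cinner_left [OF other.\<Gamma>_approach [OF z]])
    moreover have "cinner (\<Gamma> (approach z n) x) (\<Gamma> w y) = cinner (\<Gamma>' (approach z n) x) (\<Gamma>' w y)" for n
      by (rule neq [OF approach_nonreal]) (simp only: True [symmetric] approach_neq not_False_eq_True)
    ultimately show ?thesis by (simp add: LIMSEQ_unique)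
  next
    case False
    then show ?thesis by (rule neq [OF z])
  qed
qed

lemma gram_family_transfer:
  assumes \<Gamma>': "gram_family Q \<Gamma>'"
  shows "\<exists>k. \<forall>z y. Im z \<noteq> 0 \<longrightarrow> cinner k (\<Gamma>' z y) = cinner h (\<Gamma> z y)"
proof -
  \<comment> \<open>A Gram family is unrestricted at real points, so it is replaced there by zero to
    make the two Gram matrices equal on the full index set.\<close>
  define a where "a i = (if Im (fst i) = 0 then 0 else \<Gamma> (fst i) (snd i))" for i :: "complex \<times> 'g"
  define b where "b i = (if Im (fst i) = 0 then 0 else \<Gamma>' (fst i) (snd i))" for i :: "complex \<times> 'g"
  have "cinner (a i) (a j) = cinner (b i) (b j)" for i j
    unfolding a_def b_def using gram_unique [OF \<Gamma>', of "fst i" "fst j"] by simp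
  then obtain k where k: "\<And>i. cinner k (b i) = cinner h (a i)" using gram_transfer by blast
  have "cinner k (\<Gamma>' z y) = cinner h (\<Gamma> z y)" if "Im z \<noteq> 0" for z y
    using k [of "(z, y)"] that by (simp add: a_def b_def)
  then show ?thesis by blast
qed

text \<open>The definition only admits realisations in one fixed \<open>ell2\<close> space. A
  witness \<open>h\<close> moves between any two families with the same Gram matrix: from such a
  realisation to \<Gamma>, and conversely from \<Gamma> to a copy of it built inside that
  \<open>ell2\<close> space.\<close>

theorem generalised_value_iff:
  fixes \<alpha> :: real
  shows "(c, d) \<in> generalised_value Q \<alpha> \<longleftrightarrow>
    (\<exists>h. \<forall>z y. Im z \<noteq> 0 \<longrightarrow> (\<alpha> - cnj z) * cinner h (\<Gamma> z y) = cinner d y - cinner c (Q z y))"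
    (is "_ \<longleftrightarrow> ?rhs")
proof
  assume "(c, d) \<in> generalised_value Q \<alpha>"
  then obtain z\<^sub>0 and H :: "(complex \<times> 'g) ell2 set" and A \<gamma> where
    real: "minimal_realisation Q z\<^sub>0 H A \<gamma>" and val: "(c, d) \<in> value_via Q z\<^sub>0 H A \<gamma> \<alpha>"
    unfolding generalised_value_def by blast
  interpret R: minimal_realisation_of Q z\<^sub>0 H A \<gamma>
    by unfold_locales (use holomorphic real in simp_all)
  obtain h where h: "\<And>z y. Im z \<noteq> 0 \<Longrightarrow> (\<alpha> - cnj z) * cinner h (R.F z y) = cinner d y - cinner c (Q z y)"
    using val unfolding R.value_via_iff by blast
  obtain k where "\<And>z y. Im z \<noteq> 0 \<Longrightarrow> cinner k (\<Gamma> z y) = cinner h (R.F z y)"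
    using R.gram.gram_family_transfer [OF gram_family_axioms, of h] by blast
  then have "\<forall>z y. Im z \<noteq> 0 \<longrightarrow> (\<alpha> - cnj z) * cinner k (\<Gamma> z y) = cinner d y - cinner c (Q z y)"
    using h by simp
  then show ?rhs by blast
next
  assume ?rhs
  then obtain h where h: "\<And>z y. Im z \<noteq> 0 \<Longrightarrow> (\<alpha> - cnj z) * cinner h (\<Gamma> z y) = cinner d y - cinner c (Q z y)"
    by blast
  obtain b :: "complex \<times> 'g \<Rightarrow> (complex \<times> 'g) ell2"
    where b: "\<And>i j. cinner (b i) (b j) = cinner (\<Gamma> (fst i) (snd i)) (\<Gamma> (fst j) (snd j))"
    using gram_matrix_in_ell2 [of "\<lambda>i. \<Gamma> (fst i) (snd i)"] by blast
  define \<Gamma>' where "\<Gamma>' z y = b (z, y)" for z y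
  have fam: "gram_family Q \<Gamma>'"
    by unfold_locales (simp_all add: holomorphic \<Gamma>'_def b gram)
  interpret E: gram_family Q \<Gamma>' by (rule fam)
  have real: "minimal_realisation Q \<i> E.K E.B (\<Gamma>' \<i>)" by (rule E.minimal_realisation_span) simp
  interpret R: minimal_realisation_of Q \<i> E.K E.B "\<Gamma>' \<i>"
    by unfold_locales (use holomorphic real in simp_all)
  have F: "R.F z y = \<Gamma>' z y" if "Im z \<noteq> 0" for z y
    unfolding R.F_def by (rule E.defect_family_\<Gamma>) (use that in simp_all)
  obtain k where k: "\<And>z y. Im z \<noteq> 0 \<Longrightarrow> cinner k (\<Gamma>' z y) = cinner h (\<Gamma> z y)"
    using gram_family_transfer [OF fam, of h] by blast
  \<comment> \<open>The witness has to lie in the state space; projecting it there leaves its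
    products with the family unchanged.\<close>
  obtain p where p: "p \<in> E.K" and orth: "\<forall>v\<in>E.K. cinner (k - p) v = 0"
    using orth_decomposition [OF E.closed_csubspace_K, of k] by blast
  have "(\<alpha> - cnj z) * cinner p (R.F z y) = cinner d y - cinner c (Q z y)" if z: "Im z \<noteq> 0" for z y
  proof -
    have "cinner (k - p) (\<Gamma>' z y) = 0" using orth E.\<Gamma>_K [OF z] by blast
    then have "cinner p (\<Gamma>' z y) = cinner h (\<Gamma> z y)" by (simp add: cinner_diff_left k [OF z])
    then show ?thesis by (simp add: F [OF z] h [OF z])
  qed
  then have "(c, d) \<in> value_via Q \<i> E.K E.B (\<Gamma>' \<i>) \<alpha>"
    unfolding R.value_via_iff using p by blast
  then show "(c, d) \<in> generalised_value Q \<alpha>"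
    unfolding generalised_value_def using real by blast
qed

end

section \<open>Operator-valued Herglotz-Nevanlinna functions\<close>

lemma op_holomorphic_add:
  assumes F: "op_holomorphic_at F z" and G: "op_holomorphic_at G z"
  shows "op_holomorphic_at (\<lambda>z x. F z x + G z x) z"
proof -
  obtain e where e: "e > 0" "\<And>w. w \<in> ball z e \<Longrightarrow> bounded_clinear (F w) \<and> op_differentiable F w"
    using F unfolding op_holomorphic_at_def by blast
  obtain e' where e': "e' > 0" "\<And>w. w \<in> ball z e' \<Longrightarrow> bounded_clinear (G w) \<and> op_differentiable G w"
    using G unfolding op_holomorphic_at_def by blast
  have diff: "op_differentiable (\<lambda>z x. F z x + G z x) w" if w: "w \<in> ball z e" "w \<in> ball z e'" for w
  proof -
    obtain D where D: "bounded_clinear D"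
      and limD: "((\<lambda>v. onorm (\<lambda>x. (1 / (v - w)) *\<^sub>C (F v x - F w x) - D x)) \<longlongrightarrow> 0) (at w)"
      using e(2) [OF w(1)] unfolding op_differentiable_def by blast
    obtain E where E: "bounded_clinear E"
      and limE: "((\<lambda>v. onorm (\<lambda>x. (1 / (v - w)) *\<^sub>C (G v x - G w x) - E x)) \<longlongrightarrow> 0) (at w)"
      using e'(2) [OF w(2)] unfolding op_differentiable_def by blast
    define f where "f v x = (1 / (v - w)) *\<^sub>C (F v x - F w x) - D x" for v x
    define g where "g v x = (1 / (v - w)) *\<^sub>C (G v x - G w x) - E x" for v x
    have eq: "(1 / (v - w)) *\<^sub>C (F v x + G v x - (F w x + G w x)) - (D x + E x) = f v x + g v x" for v x
    proof -
      have "(F v x + G v x) - (F w x + G w x) = (F v x - F w x) + (G v x - G w x)" by simp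
      then show ?thesis unfolding f_def g_def by (simp only: scaleC_add_right) simp
    qed
    have ev: "\<forall>\<^sub>F v in at w. v \<in> ball z e \<inter> ball z e'"
      using w by (intro eventually_at_in_open') auto
    have "((\<lambda>v. onorm (f v) + onorm (g v)) \<longlongrightarrow> 0 + 0) (at w)"
      unfolding f_def [abs_def] g_def [abs_def] by (intro tendsto_add limD limE)
    then have lim: "((\<lambda>v. onorm (f v) + onorm (g v)) \<longlongrightarrow> 0) (at w)" by simp
    have "((\<lambda>v. onorm (\<lambda>x. f v x + g v x)) \<longlongrightarrow> 0) (at w)"
    proof (rule Lim_null_comparison [OF _ lim])
      show "\<forall>\<^sub>F v in at w. norm (onorm (\<lambda>x. f v x + g v x)) \<le> onorm (f v) + onorm (g v)"
        using ev
      proof eventually_elim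
        fix v assume v: "v \<in> ball z e \<inter> ball z e'"
        have "bounded_clinear (f v)"
          unfolding f_def using e(2) [OF w(1)] e(2) [of v] v
          by (intro bounded_clinear_op_diff bounded_clinear_op_scaleC D) simp_all
        moreover have "bounded_clinear (g v)"
          unfolding g_def using e'(2) [OF w(2)] e'(2) [of v] v
          by (intro bounded_clinear_op_diff bounded_clinear_op_scaleC E) simp_all
        ultimately have bl: "bounded_linear (f v)" "bounded_linear (g v)"
          by (simp_all add: bounded_clinear_def)
        have "0 \<le> onorm (\<lambda>x. f v x + g v x)"
          by (rule onorm_pos_le [OF bounded_linear_add [OF bl]])
        then show "norm (onorm (\<lambda>x. f v x + g v x)) \<le> onorm (f v) + onorm (g v)"
          using onorm_triangle [OF bl] by simp
      qed
    qed
    then show ?thesis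
      unfolding op_differentiable_def
      by (intro exI [of _ "\<lambda>x. D x + E x"] conjI bounded_clinear_op_add D E) (simp only: eq)
  qed
  show ?thesis
    unfolding op_holomorphic_at_def
  proof (intro exI [of _ "min e e'"] conjI ballI)
    show "0 < min e e'" using e e' by simp
    fix w assume "w \<in> ball z (min e e')"
    then have w: "w \<in> ball z e" "w \<in> ball z e'" by simp_all
    show "bounded_clinear (\<lambda>x. F w x + G w x)"
      using e(2) [OF w(1)] e'(2) [OF w(2)] by (intro bounded_clinear_op_add) simp_all
    show "op_differentiable (\<lambda>z x. F z x + G z x) w" by (rule diff [OF w])
  qed
qed

lemma op_holomorphic_eventually:
  assumes "op_holomorphic_at F z"
  shows "\<forall>\<^sub>F w in at z. op_holomorphic_at F w"
proof -
  obtain e where e: "e > 0" "\<And>w. w \<in> ball z e \<Longrightarrow> bounded_clinear (F w) \<and> op_differentiable F w"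
    using assms unfolding op_holomorphic_at_def by blast
  have ball: "op_holomorphic_at F w" if w: "w \<in> ball z e" for w
  proof -
    obtain d where "d > 0" "ball w d \<subseteq> ball z e" using open_contains_ball_eq [OF open_ball] w by blast
    then show ?thesis unfolding op_holomorphic_at_def using e(2) by blast
  qed
  have "\<forall>\<^sub>F w in at z. w \<in> ball z e" using e(1) by (intro eventually_at_in_open') auto
  then show ?thesis by (rule eventually_mono) (rule ball)
qed

text \<open>Polarisation with \<open>x + y\<close> and \<open>x + \<i> *\<^sub>C y\<close>: over
  complex scalars the quadratic form determines the operator.\<close>

lemma quadratic_form_nonzero:
  fixes T :: "'g::complex_inner \<Rightarrow> 'g"
  assumes T: "bounded_clinear T" and nz: "T \<noteq> (\<lambda>x. 0)"
  shows "\<exists>x. cinner (T x) x \<noteq> 0"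
proof (rule ccontr)
  assume "\<not> ?thesis"
  then have zero: "cinner (T x) x = 0" for x by blast
  have "cinner (T x) y = 0" for x y
  proof -
    have 1: "cinner (T x) y + cinner (T y) x = 0"
      using zero [of "x + y"] zero [of x] zero [of y]
      by (simp add: bounded_clinear_add [OF T] cinner_add_left cinner_add_right add.commute)
    have 2: "- \<i> * cinner (T x) y + \<i> * cinner (T y) x = 0"
      using zero [of "x + \<i> *\<^sub>C y"] zero [of x] zero [of y]
      by (simp add: bounded_clinear_add [OF T] bounded_clinear_scaleC [OF T] cinner_add_left
          cinner_add_right cinner_scaleC_left cinner_scaleC_right add.commute)
    have "\<i> * (cinner (T y) x - cinner (T x) y) = 0" using 2 by (simp add: algebra_simps)
    then show ?thesis using 1 by simp
  qed
  then have "T x = 0" for x using cinner_self_eq_0 by blast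
  then show False using nz by blast
qed

text \<open>
  Approach the pole along a ray on which the leading term of the quadratic form has a prescribed
  argument.
\<close>

lemma pole_sign:
  fixes Q :: "complex \<Rightarrow> 'g \<Rightarrow> 'g::complex_hilbert"
  assumes pole: "op_pole_at Q z" and s: "s = 1 \<or> s = (- 1 :: real)"
  shows "\<exists>x w. w \<longlonglongrightarrow> z \<and> (\<forall>n. w n \<noteq> z) \<and> (\<forall>\<^sub>F n in sequentially. s * Im (cinner (Q (w n) x) x) > 0)"
proof -
  obtain k F where F: "op_holomorphic_at F z" and nz: "F z \<noteq> (\<lambda>x. 0)" and k: "(k::nat) > 0"
    and ev: "\<forall>\<^sub>F w in at z. \<forall>x. Q w x = (1 / (w - z) ^ k) *\<^sub>C F w x"
    using pole unfolding op_pole_at_def by blast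
  obtain x where x: "cinner (F z x) x \<noteq> 0"
    using quadratic_form_nonzero [OF op_holomorphic_bounded [OF F] nz] by blast
  define a where "a = cinner (F z x) x"
  have a: "a \<noteq> 0" using x by (simp add: a_def)
  have s0: "s \<noteq> 0" "s * s = 1" using s by auto
  \<comment> \<open>The choice makes \<open>a / c\<close> equal to \<open>\<i>\<close> times
    \<open>s * cmod a\<close>, so the leading term of the quadratic form is purely imaginary with
    sign \<open>s\<close>.\<close>
  define c where "c = a / (complex_of_real (s * cmod a) * \<i>)"
  have c: "c \<noteq> 0" using a s0 by (simp add: c_def)
  \<comment> \<open>A \<open>k\<close>-th root of \<open>c\<close>: along the ray in direction
    \<open>u\<close> the denominator \<open>(w n - z) ^ k\<close> is a positive multiple of
    \<open>c\<close>.\<close>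
  define u where "u = exp (Ln c / of_nat k)"
  have uk: "u ^ k = c"
    using k c by (simp add: u_def exp_of_nat_mult [symmetric])
  have u: "u \<noteq> 0" by (simp add: u_def)
  define r where "r n = inverse (real (Suc n))" for n
  have r: "r n > 0" for n by (simp add: r_def)
  have rlim: "r \<longlonglongrightarrow> 0" unfolding r_def [abs_def] by (rule LIMSEQ_inverse_real_of_nat)
  define w where "w n = z + complex_of_real (r n) * u" for n
  have wz: "w n \<noteq> z" for n using u r [of n] by (simp add: w_def)
  have "(\<lambda>n. z + complex_of_real (r n) * u) \<longlonglongrightarrow> z + complex_of_real 0 * u"
    by (intro tendsto_intros rlim)
  then have wlim: "w \<longlonglongrightarrow> z" by (simp add: w_def [abs_def])
  have "filterlim w (at z) sequentially" using wlim wz by (simp add: filterlim_at)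
  then have evn: "\<forall>\<^sub>F n in sequentially. \<forall>x. Q (w n) x = (1 / (w n - z) ^ k) *\<^sub>C F (w n) x"
    by (rule eventually_compose_filterlim [OF ev])
  have "(\<lambda>n. cinner (F (w n) x) x) \<longlonglongrightarrow> a"
    unfolding a_def by (rule tendsto_cinner_left [OF op_holomorphic_seq [OF F wlim wz]])
  then have "(\<lambda>n. s * Im (1 / c * cinner (F (w n) x) x)) \<longlonglongrightarrow> s * Im (1 / c * a)"
    by (intro tendsto_intros)
  moreover have "s * Im (1 / c * a) = cmod a"
    using a s by (auto simp: c_def)
  ultimately have "\<forall>\<^sub>F n in sequentially. 0 < s * Im (1 / c * cinner (F (w n) x) x)"
    using a by (intro order_tendstoD(1) [where y = "cmod a"]) simp_all
  then have "\<forall>\<^sub>F n in sequentially. s * Im (cinner (Q (w n) x) x) > 0"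
    using evn
  proof eventually_elim
    fix n assume pos: "0 < s * Im (1 / c * cinner (F (w n) x) x)"
      and Q: "\<forall>x. Q (w n) x = (1 / (w n - z) ^ k) *\<^sub>C F (w n) x"
    have "1 / (w n - z) ^ k = complex_of_real (1 / r n ^ k) * (1 / c)"
      by (simp add: w_def power_mult_distrib uk)
    then have "cinner (Q (w n) x) x = complex_of_real (1 / r n ^ k) * (1 / c * cinner (F (w n) x) x)"
      using Q by (simp add: cinner_scaleC_left)
    then have "s * Im (cinner (Q (w n) x) x) = (1 / r n ^ k) * (s * Im (1 / c * cinner (F (w n) x) x))"
      by (simp only: Im_complex_of_real Re_complex_of_real times_complex.sel) simp
    then show "s * Im (cinner (Q (w n) x) x) > 0" using pos r [of n] by simp
  qed
  then show ?thesis using wlim wz by blast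
qed

text \<open>A finite limit, multiplied by \<open>(w - z) ^ k\<close>, would make the quadratic form
  of the leading coefficient vanish. This tells a pole from a point near which \<open>Q\<close>
  agrees with a holomorphic function.\<close>

lemma pole_no_limit:
  fixes Q :: "complex \<Rightarrow> 'g \<Rightarrow> 'g::complex_hilbert"
  assumes pole: "op_pole_at Q z"
  shows "\<exists>x. \<forall>l. \<not> ((\<lambda>w. cinner (Q w x) x) \<longlongrightarrow> l) (at z)"
proof -
  obtain k F where F: "op_holomorphic_at F z" and nz: "F z \<noteq> (\<lambda>x. 0)" and k: "(k::nat) > 0"
    and ev: "\<forall>\<^sub>F w in at z. \<forall>x. Q w x = (1 / (w - z) ^ k) *\<^sub>C F w x"
    using pole unfolding op_pole_at_def by blast
  obtain x where x: "cinner (F z x) x \<noteq> 0"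
    using quadratic_form_nonzero [OF op_holomorphic_bounded [OF F] nz] by blast
  have "\<not> ((\<lambda>w. cinner (Q w x) x) \<longlongrightarrow> l) (at z)" for l
  proof
    assume l: "((\<lambda>w. cinner (Q w x) x) \<longlongrightarrow> l) (at z)"
    have "((\<lambda>w. (w - z) ^ k * cinner (Q w x) x) \<longlongrightarrow> (z - z) ^ k * l) (at z)"
      by (intro tendsto_intros l)
    then have "((\<lambda>w. (w - z) ^ k * cinner (Q w x) x) \<longlongrightarrow> 0) (at z)"
      using k by (simp add: zero_power)
    moreover have "\<forall>\<^sub>F w in at z. (w - z) ^ k * cinner (Q w x) x = cinner (F w x) x"
      using ev eventually_neq_at_within [of z z UNIV]
      by eventually_elim (simp add: cinner_scaleC_left)
    ultimately have lim0: "((\<lambda>w. cinner (F w x) x) \<longlongrightarrow> 0) (at z)" by (rule Lim_transform_eventually)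
    have "((\<lambda>w. cinner (F w x) x) \<longlongrightarrow> cinner (F z x) x) (at z)"
      by (rule tendsto_cinner_left [OF op_holomorphic_tendsto [OF F]])
    then have "cinner (F z x) x = 0" by (rule tendsto_unique [OF at_neq_bot _ lim0])
    then show False using x by simp
  qed
  then show ?thesis by blast
qed

text \<open>The quotient representation at \<open>z\<close> is valid on a punctured neighbourhood,
  hence also near each of its points, where it has limits.\<close>

lemma pole_isolated:
  fixes Q :: "complex \<Rightarrow> 'g \<Rightarrow> 'g::complex_hilbert"
  assumes pole: "op_pole_at Q z"
  shows "\<forall>\<^sub>F w in at z. \<not> op_pole_at Q w"
proof -
  obtain k F where F: "op_holomorphic_at F z"
    and ev: "\<forall>\<^sub>F w in at z. \<forall>x. Q w x = (1 / (w - z) ^ k) *\<^sub>C F w x"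
    using pole unfolding op_pole_at_def by blast
  have "\<forall>\<^sub>F w in at z. \<forall>\<^sub>F v in at w. \<forall>x. Q v x = (1 / (v - z) ^ k) *\<^sub>C F v x"
  proof -
    obtain S where S: "open S" "z \<in> S" "\<And>w. w \<in> S \<Longrightarrow> w \<noteq> z \<Longrightarrow> \<forall>x. Q w x = (1 / (w - z) ^ k) *\<^sub>C F w x"
      using ev unfolding eventually_at_topological by blast
    have "\<forall>\<^sub>F v in at w. \<forall>x. Q v x = (1 / (v - z) ^ k) *\<^sub>C F v x" if "w \<in> S - {z}" for w
    proof -
      have "open (S - {z})" using S(1) by (rule open_delete)
      then have "\<forall>\<^sub>F v in at w. v \<in> S - {z}" using that by (intro eventually_at_in_open') auto
      then show ?thesis by (rule eventually_mono) (use S(3) in blast)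
    qed
    moreover have "\<forall>\<^sub>F w in at z. w \<in> S - {z}" by (rule eventually_at_in_open [OF S(1,2)])
    ultimately show ?thesis by (rule eventually_mono [rotated])
  qed
  then show ?thesis
    using op_holomorphic_eventually [OF F] eventually_neq_at_within [of z z UNIV]
  proof eventually_elim
    fix w assume eq: "\<forall>\<^sub>F v in at w. \<forall>x. Q v x = (1 / (v - z) ^ k) *\<^sub>C F v x"
      and Fw: "op_holomorphic_at F w" and wz: "w \<noteq> z"
    have "((\<lambda>v. cinner (Q v x) x) \<longlongrightarrow> 1 / (w - z) ^ k * cinner (F w x) x) (at w)" for x
    proof (rule Lim_transform_eventually)
      show "((\<lambda>v. 1 / (v - z) ^ k * cinner (F v x) x) \<longlongrightarrow> 1 / (w - z) ^ k * cinner (F w x) x) (at w)"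
        using wz by (intro tendsto_intros op_holomorphic_tendsto [OF Fw]) auto
      show "\<forall>\<^sub>F v in at w. 1 / (v - z) ^ k * cinner (F v x) x = cinner (Q v x) x"
        using eq by eventually_elim (simp add: cinner_scaleC_left)
    qed
    then show "\<not> op_pole_at Q w" using pole_no_limit by blast
  qed
qed

text \<open>The one-by-one case of the kernel condition: the only entry, and hence the eigenvalue,
  is \<open>Im (cinner (Q z x) x) / Im z\<close>.\<close>

lemma nevanlinna_Im_nonneg:
  fixes Q :: "complex \<Rightarrow> 'g \<Rightarrow> 'g::complex_hilbert"
  assumes N: "nevanlinna_N0 Q" and z: "Im z > 0" and hol: "op_holomorphic_at Q z"
  shows "Im (cinner (Q z x) x) \<ge> 0"
proof -
  define e where "e = Im (cinner (Q z x) x) / Im z"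
  define M where "M = mat 1 1 (\<lambda>(i::nat, j::nat). cinner (nevanlinna_kernel Q z z x) x)"
  have dom: "z \<in> hol_domain Q" using z hol by (simp add: hol_domain_def)
  have "cinner (cadjoint (Q z) x) x = cnj (cinner (Q z x) x)"
    by (simp add: cinner_cadjoint_left [OF op_holomorphic_bounded [OF hol]] cinner_commute [of x "Q z x"])
  then have k: "cinner (nevanlinna_kernel Q z z x) x = complex_of_real e"
    using z by (simp add: nevanlinna_kernel_def cinner_scaleC_left cinner_diff_left complex_diff_cnj e_def)
  have M: "M \<in> carrier_mat 1 1" by (simp add: M_def)
  have "eigenvector M (vec 1 (\<lambda>_. 1)) (complex_of_real e)"
    unfolding eigenvector_def
  proof (intro conjI)
    show "vec 1 (\<lambda>_. 1) \<in> carrier_vec (dim_row M)" by (simp add: M_def)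
    show "vec 1 (\<lambda>_. 1 :: complex) \<noteq> 0\<^sub>v (dim_row M)"
    proof
      assume "vec 1 (\<lambda>_. 1 :: complex) = 0\<^sub>v (dim_row M)"
      then have "vec 1 (\<lambda>_. 1 :: complex) $ 0 = 0\<^sub>v (dim_row M) $ 0" by simp
      then show False by (simp add: M_def)
    qed
    show "M *\<^sub>v vec 1 (\<lambda>_. 1) = complex_of_real e \<cdot>\<^sub>v vec 1 (\<lambda>_. 1)"
      by (rule eq_vecI) (simp_all add: M_def k scalar_prod_def)
  qed
  then have "eigenvalue M (complex_of_real e)" unfolding eigenvalue_def by blast
  moreover have "\<forall>e::real. eigenvalue (mat 1 1 (\<lambda>(i, j). cinner (nevanlinna_kernel Q z z x) x))
      (complex_of_real e) \<longrightarrow> \<not> e < 0"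
    using N z dom unfolding nevanlinna_N0_def
    by (elim conjE allE [of _ "1::nat"] allE [of _ "\<lambda>_::nat. z"] allE [of _ "\<lambda>_::nat. x"]) simp
  ultimately have "\<not> e < 0" unfolding M_def by blast
  then show ?thesis using z by (simp add: e_def field_simps not_less)
qed

text \<open>Near a pole the imaginary part of the quadratic form takes either sign, against the
  Nevanlinna sign. In the upper half-plane positivity is available only at points of holomorphy,
  which the neighbouring points are because poles are isolated; in the lower half-plane the sign is
  reflected by \<open>cadjoint (Q z) = Q (cnj z)\<close>.\<close>

lemma nevanlinna_holomorphic:
  fixes Q :: "complex \<Rightarrow> 'g \<Rightarrow> 'g::complex_hilbert"
  assumes N: "nevanlinna_N0 Q" and z: "Im z \<noteq> 0"
  shows "op_holomorphic_at Q z"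
proof -
  have alt: "op_holomorphic_at Q v \<or> op_pole_at Q v" if "Im v \<noteq> 0" for v
    using N that unfolding nevanlinna_N0_def by blast
  have upper: "op_holomorphic_at Q v" if v: "Im v > 0" for v
  proof (rule ccontr)
    assume "\<not> op_holomorphic_at Q v"
    then have pole: "op_pole_at Q v" using alt [of v] v by simp
    obtain x w where w: "w \<longlonglongrightarrow> v" "\<And>n. w n \<noteq> v"
      and neg: "\<forall>\<^sub>F n in sequentially. - 1 * Im (cinner (Q (w n) x) x) > 0"
      using pole_sign [OF pole, of "- 1"] by blast
    have "filterlim w (at v) sequentially" using w by (simp add: filterlim_at)
    then have "\<forall>\<^sub>F n in sequentially. \<not> op_pole_at Q (w n)"
      by (rule eventually_compose_filterlim [OF pole_isolated [OF pole]])
    moreover have "\<forall>\<^sub>F n in sequentially. Im (w n) > 0"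
      using tendsto_Im [OF w(1)] v by (rule order_tendstoD(1))
    ultimately have "\<forall>\<^sub>F n in sequentially. False"
      using neg
    proof eventually_elim
      fix n assume "\<not> op_pole_at Q (w n)" "Im (w n) > 0" "- 1 * Im (cinner (Q (w n) x) x) > 0"
      moreover from this have "op_holomorphic_at Q (w n)" using alt [of "w n"] by simp
      ultimately show False using nevanlinna_Im_nonneg [OF N, of "w n" x] by simp
    qed
    then show False by simp
  qed
  have lower: "op_holomorphic_at Q v" if v: "Im v < 0" for v
  proof (rule ccontr)
    assume "\<not> op_holomorphic_at Q v"
    then have pole: "op_pole_at Q v" using alt [of v] v by simp
    obtain x w where w: "w \<longlonglongrightarrow> v" "\<And>n. w n \<noteq> v"
      and pos: "\<forall>\<^sub>F n in sequentially. 1 * Im (cinner (Q (w n) x) x) > 0"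
      using pole_sign [OF pole, of 1] by blast
    have "\<forall>\<^sub>F n in sequentially. Im (w n) < 0"
      using tendsto_Im [OF w(1)] v by (rule order_tendstoD(2))
    then have "\<forall>\<^sub>F n in sequentially. False"
      using pos
    proof eventually_elim
      fix n assume wn: "Im (w n) < 0" and p: "1 * Im (cinner (Q (w n) x) x) > 0"
      have hol: "op_holomorphic_at Q (cnj (w n))" using wn by (intro upper) simp
      then have "cnj (w n) \<in> hol_domain Q" using wn by (simp add: hol_domain_def)
      moreover have "\<forall>z\<in>hol_domain Q. Im z \<noteq> 0 \<longrightarrow> cadjoint (Q z) = Q (cnj z)"
        using N unfolding nevanlinna_N0_def by blast
      ultimately have "cadjoint (Q (cnj (w n))) = Q (w n)" using wn by fastforce
      then have "cinner (Q (w n) x) x = cnj (cinner (Q (cnj (w n)) x) x)"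
        using cinner_cadjoint_left [OF op_holomorphic_bounded [OF hol], of x x]
          cinner_commute [of x "Q (cnj (w n)) x"] by simp
      then show False using p nevanlinna_Im_nonneg [OF N _ hol, of x] wn by simp
    qed
    then show False by simp
  qed
  show ?thesis using z upper [of z] lower [of z] by linarith
qed

section \<open>Self-adjoint extensions and Krein's formula\<close>

lemma orth_proj:
  fixes H :: "'a::complex_hilbert set"
  assumes H: "closed_csubspace H"
  shows "orth_proj H x \<in> H \<and> (\<forall>z\<in>H. cinner (x - orth_proj H x) z = 0)"
  unfolding orth_proj_def
proof (rule theI')
  obtain y where y: "y \<in> H" "\<forall>z\<in>H. cinner (x - y) z = 0"
    using orth_decomposition [OF H, of x] by blast
  show "\<exists>!y. y \<in> H \<and> (\<forall>z\<in>H. cinner (x - y) z = 0)"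
  proof (rule ex1I [of _ y])
    show "y \<in> H \<and> (\<forall>z\<in>H. cinner (x - y) z = 0)" using y by blast
    fix y' assume y': "y' \<in> H \<and> (\<forall>z\<in>H. cinner (x - y') z = 0)"
    have mem: "y' - y \<in> H" using y y' H by (auto simp: closed_csubspace_def intro: csubspace_diff)
    have "cinner (y' - y) (y' - y) = cinner (x - y) (y' - y) - cinner (x - y') (y' - y)"
      by (simp add: cinner_diff_left)
    also have "\<dots> = 0" using y y' mem by simp
    finally show "y' = y" by simp
  qed
qed

lemma orth_proj_mem: "closed_csubspace H \<Longrightarrow> orth_proj H x \<in> H" for H :: "'a::complex_hilbert set"
  using orth_proj by blast

lemma cinner_orth_proj: "closed_csubspace H \<Longrightarrow> z \<in> H \<Longrightarrow> cinner (orth_proj H x) z = cinner x z"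
  for H :: "'a::complex_hilbert set"
  using orth_proj [of H x] by (simp add: cinner_diff_left)

lemma orth_proj_unique:
  fixes H :: "'a::complex_hilbert set"
  assumes H: "closed_csubspace H" and y: "y \<in> H" "\<And>z. z \<in> H \<Longrightarrow> cinner y z = cinner x z"
  shows "orth_proj H x = y"
proof -
  have mem: "orth_proj H x - y \<in> H"
    using H orth_proj_mem [OF H, of x] y(1) by (auto simp: closed_csubspace_def intro: csubspace_diff)
  have "cinner (orth_proj H x - y) (orth_proj H x - y) = 0"
    by (subst cinner_diff_left) (simp add: cinner_orth_proj [OF H mem] y(2) [OF mem])
  then show ?thesis by simp
qed

lemma closed_csubspace_UNIV: "closed_csubspace UNIV"
  by (simp add: closed_csubspace_def csubspace_UNIV)

locale krein_extension =
  fixes H :: "'k::complex_hilbert set"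
    and S A Atilde :: "('k \<times> 'k) set"
    and z\<^sub>0 :: complex
    and \<gamma> :: "'g::complex_hilbert \<Rightarrow> 'k"
    and m \<tau> :: "complex \<Rightarrow> 'g \<Rightarrow> 'g"
  assumes subspace_H: "closed_csubspace H"
    and A: "self_adjoint_rel H A" "S \<subseteq> A"
    and simple: "simple_operator H S A"
    and z0: "Im z\<^sub>0 > 0"
    and gamma: "bounded_clinear \<gamma>" "bij_betw \<gamma> UNIV (defect_space H S z\<^sub>0)"
    and m: "Q_function H A z\<^sub>0 \<gamma> m"
    and tau: "nevanlinna_N0 \<tau>"
    and Atilde: "self_adjoint_rel UNIV Atilde" "minimal_extension Atilde z\<^sub>0 \<gamma>"
    and krein: "\<And>z x. Im z \<noteq> 0 \<Longrightarrow> x \<in> H \<Longrightarrow>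
      orth_proj H (resolvent Atilde z x) =
        resolvent A z x -
        defect_family A z\<^sub>0 \<gamma> z
          (inv_into UNIV (\<lambda>u. m z u + \<tau> z u) (cadjoint (defect_family A z\<^sub>0 \<gamma> (cnj z)) x))"
begin

sublocale rel: self_adjoint_relation H A
  by unfold_locales (rule subspace_H, rule A(1))

sublocale ext: self_adjoint_relation UNIV Atilde
  by unfold_locales (rule closed_csubspace_UNIV, rule Atilde(1))

abbreviation "g \<equiv> defect_family A z\<^sub>0 \<gamma>"
abbreviation "RA \<equiv> resolvent A"
abbreviation "RT \<equiv> resolvent Atilde"
abbreviation "S_adj \<equiv> rel_adjoint H S"

lemma z0_nonreal: "Im z\<^sub>0 \<noteq> 0"
  using z0 by simp

lemma rho: "Im z \<noteq> 0 \<Longrightarrow> z \<in> resolvent_set H A"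
  by (rule rel.nonreal_resolvent_set)

lemma rhoT: "Im z \<noteq> 0 \<Longrightarrow> z \<in> resolvent_set UNIV Atilde"
  by (rule ext.nonreal_resolvent_set)

lemma Im_cnj: "Im z \<noteq> 0 \<Longrightarrow> Im (cnj z) \<noteq> 0"
  by simp

section \<open>Defect spaces of \<open>S\<close> and the defect family of \<open>A\<close>\<close>

lemma defect_space_iff: "u \<in> defect_space H S z \<longleftrightarrow> (u, z *\<^sub>C u) \<in> S_adj"
  by (simp add: rel_ker_def rel_shift_iff)

lemma S_adj_mem: "(u, v) \<in> S_adj \<Longrightarrow> u \<in> H"
  unfolding rel_adjoint_def by blast

lemma A_S_adj: "(u, v) \<in> A \<Longrightarrow> (u, v) \<in> S_adj"
  unfolding rel_adjoint_def using rel.A_sub rel.symmetric A(2) by fastforce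

lemma csubspace_S_adj: "csubspace S_adj"
proof (rule csubspaceI)
  have mem: "p \<in> S_adj \<longleftrightarrow> fst p \<in> H \<and> snd p \<in> H \<and>
      (\<forall>s\<in>S. cinner (snd s) (fst p) = cinner (fst s) (snd p))" for p
    unfolding rel_adjoint_def by (cases p) (simp add: case_prod_beta)
  show "0 \<in> S_adj" unfolding mem using csubspace_0 [OF rel.csubspace_H] by auto
  show "x + y \<in> S_adj" if "x \<in> S_adj" "y \<in> S_adj" for x y
    using that csubspace_add [OF rel.csubspace_H] unfolding mem by (auto simp: cinner_add_right)
  show "a *\<^sub>C x \<in> S_adj" if "x \<in> S_adj" for a x
    using that csubspace_scaleC [OF rel.csubspace_H] unfolding mem
    by (auto simp: cinner_scaleC_right scaleC_prod_def)
qed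

lemma \<gamma>_mem: "\<gamma> x \<in> H"
proof -
  have "\<gamma> x \<in> defect_space H S z\<^sub>0" using gamma(2) by (auto simp: bij_betw_def)
  then show ?thesis unfolding defect_space_iff by (rule S_adj_mem)
qed

lemma g_rel: "z \<in> resolvent_set H A \<Longrightarrow> (g z x - \<gamma> x, z *\<^sub>C g z x - z\<^sub>0 *\<^sub>C \<gamma> x) \<in> A"
  unfolding defect_family_def by (rule rel.defect_relation [OF _ \<gamma>_mem])

sublocale fam: resolvent_family H A g
proof
  fix z x assume z: "Im z \<noteq> 0"
  show "g z x \<in> H"
    unfolding defect_family_def
    by (intro csubspace_add csubspace_scaleC rel.csubspace_H \<gamma>_mem rel.resolvent_in_H rho z)
  fix w assume w: "Im w \<noteq> 0"
  show "(g z x - g w x, z *\<^sub>C g z x - w *\<^sub>C g w x) \<in> A"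
    using rel.A_diff [OF g_rel [OF rho [OF z], of x] g_rel [OF rho [OF w], of x]]
    by (simp only: diff_diff_eq2 diff_add_cancel)
qed

lemma g_bounded:
  assumes z: "Im z \<noteq> 0"
  shows "bounded_clinear (g z)"
proof -
  obtain K where K: "K > 0" "\<And>x. norm (\<gamma> x) \<le> K * norm x"
    using bounded_clinear_bound [OF gamma(1)] by blast
  obtain L where L: "L > 0" "\<And>y. y \<in> H \<Longrightarrow> norm (RA z y) \<le> L * norm y"
    using rel.resolvent_bound [OF rho [OF z]] by blast
  show ?thesis
  proof (rule bounded_clinearI)
    fix x y a
    show "g z (x + y) = g z x + g z y"
      by (simp add: defect_family_def bounded_clinear_add [OF gamma(1)]
          rel.resolvent_add [OF rho [OF z] \<gamma>_mem \<gamma>_mem] scaleC_add_right)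
    show "g z (a *\<^sub>C x) = a *\<^sub>C g z x"
      by (simp add: defect_family_def bounded_clinear_scaleC [OF gamma(1)]
          rel.resolvent_scaleC [OF rho [OF z] \<gamma>_mem] scaleC_add_right scaleC_scaleC mult.commute)
    have "norm (g z x) \<le> norm (\<gamma> x) + cmod (z - z\<^sub>0) * norm (RA z (\<gamma> x))"
      unfolding defect_family_def using norm_triangle_ineq [of "\<gamma> x"] by (metis norm_scaleC)
    also have "\<dots> \<le> norm (\<gamma> x) + cmod (z - z\<^sub>0) * (L * norm (\<gamma> x))"
      by (intro add_left_mono mult_left_mono L \<gamma>_mem) simp
    also have "\<dots> = (1 + cmod (z - z\<^sub>0) * L) * norm (\<gamma> x)" by (simp add: algebra_simps)
    also have "\<dots> \<le> (1 + cmod (z - z\<^sub>0) * L) * (K * norm x)"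
      using L by (intro mult_left_mono K) simp
    finally show "norm (g z x) \<le> ((1 + cmod (z - z\<^sub>0) * L) * K) * norm x" by (simp add: mult.assoc)
  qed
qed

lemma cinner_g_adj: "Im z \<noteq> 0 \<Longrightarrow> cinner (cadjoint (g z) h) y = cinner h (g z y)"
  by (rule cinner_cadjoint_left [OF g_bounded])

text \<open>The defect space is the orthogonal complement in \<open>H\<close> of the range of
  \<open>S - cnj z\<^sub>0\<close>, hence closed; this opens the way to a lower bound for
  \<gamma>.\<close>

lemma closed_range_\<gamma>: "closed (range \<gamma>)"
proof -
  have "range \<gamma> = defect_space H S z\<^sub>0" using gamma(2) by (simp add: bij_betw_def)
  also have "\<dots> = H \<inter> {x. \<forall>p\<in>(\<lambda>(u, v). v - cnj z\<^sub>0 *\<^sub>C u) ` S. cinner x p = 0}"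
  proof (intro Set.set_eqI iffI)
    fix x assume "x \<in> defect_space H S z\<^sub>0"
    then have x: "(x, z\<^sub>0 *\<^sub>C x) \<in> S_adj" by (simp add: defect_space_iff)
    have "cinner x (v - cnj z\<^sub>0 *\<^sub>C u) = 0" if "(u, v) \<in> S" for u v
    proof -
      have "cinner v x = cinner u (z\<^sub>0 *\<^sub>C x)" using x that unfolding rel_adjoint_def by blast
      then have "cinner (v - cnj z\<^sub>0 *\<^sub>C u) x = 0"
        by (simp add: cinner_diff_left cinner_scaleC_left cinner_scaleC_right)
      then show ?thesis by (rule iffD1 [OF cinner_eq_0_commute])
    qed
    then show "x \<in> H \<inter> {x. \<forall>p\<in>(\<lambda>(u, v). v - cnj z\<^sub>0 *\<^sub>C u) ` S. cinner x p = 0}"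
      using S_adj_mem [OF x] by auto
  next
    fix x assume x: "x \<in> H \<inter> {x. \<forall>p\<in>(\<lambda>(u, v). v - cnj z\<^sub>0 *\<^sub>C u) ` S. cinner x p = 0}"
    have "cinner v x = cinner u (z\<^sub>0 *\<^sub>C x)" if "(u, v) \<in> S" for u v
    proof -
      have "cinner x (v - cnj z\<^sub>0 *\<^sub>C u) = 0" using x that by force
      then have "cinner (v - cnj z\<^sub>0 *\<^sub>C u) x = 0" by (rule iffD1 [OF cinner_eq_0_commute])
      then show ?thesis by (simp add: cinner_diff_left cinner_scaleC_left cinner_scaleC_right)
    qed
    then have "(x, z\<^sub>0 *\<^sub>C x) \<in> S_adj"
      using x csubspace_scaleC [OF rel.csubspace_H] unfolding rel_adjoint_def by blast
    then show "x \<in> defect_space H S z\<^sub>0" by (simp add: defect_space_iff)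
  qed
  finally have eq: "range \<gamma> = H \<inter> {x. \<forall>p\<in>(\<lambda>(u, v). v - cnj z\<^sub>0 *\<^sub>C u) ` S. cinner x p = 0}" .
  have "closed H" using subspace_H by (simp add: closed_csubspace_def)
  moreover have "closed {x. \<forall>p\<in>(\<lambda>(u, v). v - cnj z\<^sub>0 *\<^sub>C u) ` S. cinner x p = 0}"
    using closed_csubspace_orthogonal [of "(\<lambda>(u, v). v - cnj z\<^sub>0 *\<^sub>C u) ` S"]
    unfolding closed_csubspace_def by (rule conjunct2)
  ultimately show ?thesis unfolding eq by (rule closed_Int)
qed

text \<open>The bounded inverse theorem gives the bound for \<gamma>, and writing
  \<open>\<gamma> x\<close> as \<open>g z x\<close> minus a resolvent of a multiple of
  \<open>g z x\<close> carries it to every nonreal point.\<close>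

lemma g_below:
  assumes z: "Im z \<noteq> 0"
  obtains c where "c > 0" "\<And>x. c * norm x \<le> norm (g z x)"
proof -
  have inj: "inj \<gamma>" using gamma(2) by (simp add: bij_betw_def)
  obtain c where c: "c > 0" "\<And>x. c * norm x \<le> norm (\<gamma> x)"
    using closed_range_bounded_below [OF gamma(1) inj closed_range_\<gamma>] by blast
  obtain L where L: "L > 0" "\<And>y. y \<in> H \<Longrightarrow> norm (RA z\<^sub>0 y) \<le> L * norm y"
    using rel.resolvent_bound [OF rho [OF z0_nonreal]] by blast
  define C where "C = 1 + L * cmod (z - z\<^sub>0)"
  have "0 \<le> L * cmod (z - z\<^sub>0)" using L(1) by simp
  then have C: "C > 0" by (simp add: C_def)
  have "c / C * norm x \<le> norm (g z x)" for x
  proof -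
    have gz: "(z - z\<^sub>0) *\<^sub>C g z x \<in> H" by (intro csubspace_scaleC rel.csubspace_H fam.F_mem z)
    have "RA z\<^sub>0 ((z - z\<^sub>0) *\<^sub>C g z x) = g z x - \<gamma> x"
      by (rule rel.resolvent_of_difference [OF rho [OF z0_nonreal] g_rel [OF rho [OF z]]])
    then have "\<gamma> x = g z x - RA z\<^sub>0 ((z - z\<^sub>0) *\<^sub>C g z x)" by simp
    then have "norm (\<gamma> x) \<le> norm (g z x) + norm (RA z\<^sub>0 ((z - z\<^sub>0) *\<^sub>C g z x))"
      by (metis norm_triangle_ineq4)
    also have "\<dots> \<le> norm (g z x) + L * norm ((z - z\<^sub>0) *\<^sub>C g z x)"
      by (intro add_left_mono L gz)
    also have "\<dots> = C * norm (g z x)" by (simp add: C_def algebra_simps)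
    finally have "c * norm x \<le> C * norm (g z x)" using c(2) [of x] by linarith
    then show ?thesis using C by (simp add: field_simps)
  qed
  then show ?thesis using that [of "c / C"] c C by simp
qed

text \<open>The vector is transported to the base point:
  \<open>u + (z\<^sub>0 - z) *\<^sub>C RA z\<^sub>0 u\<close> lies in the defect space at
  \<open>z\<^sub>0\<close>, so it equals some \<open>\<gamma> x\<close>, and transporting back gives
  \<open>g z x\<close>.\<close>

lemma defect_space_g:
  assumes z: "z \<in> resolvent_set H A" and u: "u \<in> defect_space H S z"
  shows "\<exists>x. u = g z x"
proof -
  have uS: "(u, z *\<^sub>C u) \<in> S_adj" using u by (simp add: defect_space_iff)
  have uH: "u \<in> H" by (rule S_adj_mem [OF uS])
  define k where "k = RA z\<^sub>0 u"
  have k: "((z\<^sub>0 - z) *\<^sub>C k, (z\<^sub>0 - z) *\<^sub>C (u + z\<^sub>0 *\<^sub>C k)) \<in> A"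
    unfolding k_def by (intro rel.A_scaleC rel.resolvent_mem rho z0_nonreal uH)
  define x' where "x' = u + (z\<^sub>0 - z) *\<^sub>C k"
  have eq: "z\<^sub>0 *\<^sub>C x' = z *\<^sub>C u + (z\<^sub>0 - z) *\<^sub>C (u + z\<^sub>0 *\<^sub>C k)"
    by (simp add: x'_def scaleC_linear algebra_simps)
  have "(u, z *\<^sub>C u) + ((z\<^sub>0 - z) *\<^sub>C k, (z\<^sub>0 - z) *\<^sub>C (u + z\<^sub>0 *\<^sub>C k)) \<in> S_adj"
    by (intro csubspace_add csubspace_S_adj uS A_S_adj k)
  moreover have "(x', z\<^sub>0 *\<^sub>C x') = (u, z *\<^sub>C u) + ((z\<^sub>0 - z) *\<^sub>C k, (z\<^sub>0 - z) *\<^sub>C (u + z\<^sub>0 *\<^sub>C k))"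
    by (simp only: eq) (simp add: x'_def)
  ultimately have "(x', z\<^sub>0 *\<^sub>C x') \<in> S_adj" by (simp only:)
  then have "x' \<in> range \<gamma>" using gamma(2) by (simp add: defect_space_iff bij_betw_def)
  then obtain x where x: "x' = \<gamma> x" by blast
  have "(x' - u, z\<^sub>0 *\<^sub>C x' - z *\<^sub>C u) = ((z\<^sub>0 - z) *\<^sub>C k, (z\<^sub>0 - z) *\<^sub>C (u + z\<^sub>0 *\<^sub>C k))"
    by (simp only: eq) (simp add: x'_def)
  then have "(x' - u, z\<^sub>0 *\<^sub>C x' - z *\<^sub>C u) \<in> A" using k by (simp only:)
  then have "RA z ((z\<^sub>0 - z) *\<^sub>C x') = x' - u" by (rule rel.resolvent_of_difference [OF z])
  then have "(z\<^sub>0 - z) *\<^sub>C RA z (\<gamma> x) = \<gamma> x - u"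
    by (simp add: rel.resolvent_scaleC [OF z \<gamma>_mem] x)
  then have "g z x = u" by (simp add: defect_family_def scaleC_diff_left algebra_simps)
  then show ?thesis by blast
qed

text \<open>Simplicity of \<open>S\<close>, reduced from all defect spaces over the resolvent set to
  the family at nonreal points.\<close>

lemma g_total:
  assumes u: "u \<in> H" and orth: "\<And>z x. Im z \<noteq> 0 \<Longrightarrow> cinner u (g z x) = 0"
  shows "u = 0"
proof -
  have span: "u \<in> closed_cspan (\<Union>z\<in>resolvent_set H A. defect_space H S z)"
    using u simple by (simp add: simple_operator_def)
  have "cinner u u = 0"
  proof (rule closed_cspan_orthogonal [OF _ span], elim UN_E)
    fix z v assume z: "z \<in> resolvent_set H A" and "v \<in> defect_space H S z"
    then obtain x where v: "v = g z x" using defect_space_g by blast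
    show "cinner u v = 0"
      unfolding v defect_family_def
      by (rule rel.defect_orthogonal [OF \<gamma>_mem z]) (rule orth [unfolded defect_family_def])
  qed
  then show ?thesis by simp
qed

lemma fam_L: "fam.L = H"
  unfolding fam.L_def
proof (rule closed_cspan_eqI [OF subspace_H])
  show "{g z x |z x. Im z \<noteq> 0} \<subseteq> H" using fam.F_mem by blast
  show "u = 0" if u: "u \<in> H" and orth: "\<And>x. x \<in> {g z x |z x. Im z \<noteq> 0} \<Longrightarrow> cinner u x = 0" for u
    by (rule g_total [OF u]) (rule orth, blast)
qed

section \<open>Holomorphy of the Q-function\<close>

lemma m_bounded: "Im z \<noteq> 0 \<Longrightarrow> bounded_clinear (m z)"
  using m rho unfolding Q_function_def by blast

lemma m_gram:
  assumes z: "Im z \<noteq> 0" and w: "Im w \<noteq> 0"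
  shows "(z - cnj w) * cinner (g z x) (g w y) = cinner (m z x) y - cinner x (m w y)"
proof -
  have "m z x - cadjoint (m w) x = (z - cnj w) *\<^sub>C cadjoint (g w) (g z x)"
    using m rho [OF z] rho [OF w] unfolding Q_function_def by blast
  then have "cinner (m z x - cadjoint (m w) x) y = cinner ((z - cnj w) *\<^sub>C cadjoint (g w) (g z x)) y"
    by (rule arg_cong)
  then show ?thesis
    by (simp add: cinner_diff_left cinner_scaleC_left cinner_g_adj [OF w]
        cinner_cadjoint_left [OF m_bounded [OF w]])
qed

text \<open>The derivative is \<open>G (g z x)\<close> with \<open>G\<close> the adjoint of
  \<open>g (cnj z)\<close>: the Q-function identity with second point \<open>cnj z\<close> turns the
  difference quotient into \<open>G (g w x)\<close>, and \<open>g w - g z\<close> is of order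
  \<open>w - z\<close> in operator norm.\<close>

lemma m_differentiable:
  assumes z: "Im z \<noteq> 0"
  shows "op_differentiable m z"
proof -
  have zc: "Im (cnj z) \<noteq> 0" using z by simp
  define G where "G = cadjoint (g (cnj z))"
  have G: "bounded_clinear G" unfolding G_def by (rule bounded_clinear_cadjoint [OF g_bounded [OF zc]])
  obtain K where K: "K > 0" "\<And>x. norm (G x) \<le> K * norm x" using bounded_clinear_bound [OF G] by blast
  obtain L where L: "L > 0" "\<And>x. norm (g z x) \<le> L * norm x" using bounded_clinear_bound [OF g_bounded [OF z]] by blast
  have GG: "bounded_clinear (\<lambda>x. G (g w x - g z x))" if w: "Im w \<noteq> 0" for w
  proof -
    have d: "bounded_clinear (\<lambda>x. g w x - g z x)"
      by (rule bounded_clinear_op_diff [OF g_bounded [OF w] g_bounded [OF z]])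
    show ?thesis
      using G d bounded_linear_compose [of G "\<lambda>x. g w x - g z x"] unfolding bounded_clinear_def by simp
  qed
  have quot: "(1 / (w - z)) *\<^sub>C (m w x - m z x) - G (g z x) = G (g w x - g z x)"
    if w: "Im w \<noteq> 0" "w \<noteq> z" for w x
  proof (rule cinner_ext)
    fix y
    have "cinner (m w x) y - cinner (m z x) y = (w - z) * cinner (g w x) (g (cnj z) y)"
      using m_gram [OF w(1) zc, of x y] m_gram [OF z zc, of x y] by simp
    then have "cinner ((1 / (w - z)) *\<^sub>C (m w x - m z x)) y = cinner (g w x) (g (cnj z) y)"
      using w(2) by (simp add: cinner_diff_left cinner_scaleC_left)
    then show "cinner ((1 / (w - z)) *\<^sub>C (m w x - m z x) - G (g z x)) y = cinner (G (g w x - g z x)) y"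
      by (simp only: cinner_diff_left G_def cinner_g_adj [OF zc])
  qed
  have est: "norm (G (g w x - g z x)) \<le> cmod (w - z) * (2 / \<bar>Im z\<bar> * K * L) * norm x"
    if w: "cmod (w - z) < \<bar>Im z\<bar> / 2" for w x
  proof -
    \<comment> \<open>Within half the distance to the real axis, \<open>\<bar>Im w\<bar>\<close> is
      at least half of \<open>\<bar>Im z\<bar>\<close>, so the resolvents at \<open>w\<close> have
      the common bound \<open>2 / \<bar>Im z\<bar>\<close>.\<close>
    have "\<bar>Im w - Im z\<bar> \<le> cmod (w - z)" using abs_Im_le_cmod [of "w - z"] by simp
    then have Imw: "\<bar>Im z\<bar> / 2 \<le> \<bar>Im w\<bar>" using w by linarith
    then have wn: "Im w \<noteq> 0" using z by auto
    have "RA w ((z - w) *\<^sub>C g z x) = g z x - g w x"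
      by (rule rel.resolvent_of_difference [OF rho [OF wn] fam.F_rel [OF z wn]])
    then have "\<bar>Im w\<bar> * norm (g w x - g z x) \<le> cmod (w - z) * norm (g z x)"
      using rel.resolvent_bound_nonreal [OF wn csubspace_scaleC [OF rel.csubspace_H fam.F_mem [OF z]], of "z - w" x]
      by (simp add: norm_minus_commute)
    then have "\<bar>Im z\<bar> / 2 * norm (g w x - g z x) \<le> cmod (w - z) * norm (g z x)"
      using mult_right_mono [OF Imw norm_ge_zero [of "g w x - g z x"]] by linarith
    also have "\<dots> \<le> cmod (w - z) * (L * norm x)" by (intro mult_left_mono L) simp
    finally have le: "norm (g w x - g z x) \<le> 2 / \<bar>Im z\<bar> * (cmod (w - z) * (L * norm x))"
      using z by (simp add: field_simps)
    have "norm (G (g w x - g z x)) \<le> K * norm (g w x - g z x)" by (rule K)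
    also have "\<dots> \<le> K * (2 / \<bar>Im z\<bar> * (cmod (w - z) * (L * norm x)))"
      using K(1) le by (intro mult_left_mono) simp_all
    finally show ?thesis by (simp add: mult_ac)
  qed
  define C where "C = 2 / \<bar>Im z\<bar> * K * L"
  have C: "C \<ge> 0" using K L by (simp add: C_def)
  have "((\<lambda>w. onorm (\<lambda>x. (1 / (w - z)) *\<^sub>C (m w x - m z x) - G (g z x))) \<longlongrightarrow> 0) (at z)"
  proof (rule Lim_null_comparison)
    show "\<forall>\<^sub>F w in at z. norm (onorm (\<lambda>x. (1 / (w - z)) *\<^sub>C (m w x - m z x) - G (g z x))) \<le> cmod (w - z) * C"
      unfolding eventually_at
    proof (intro exI [of _ "\<bar>Im z\<bar> / 2"] conjI ballI impI)
      show "0 < \<bar>Im z\<bar> / 2" using z by simp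
      fix w assume w: "w \<noteq> z \<and> dist w z < \<bar>Im z\<bar> / 2"
      then have near: "cmod (w - z) < \<bar>Im z\<bar> / 2" by (simp add: dist_norm)
      have "\<bar>Im w - Im z\<bar> \<le> cmod (w - z)" using abs_Im_le_cmod [of "w - z"] by simp
      then have wn: "Im w \<noteq> 0" using near z by auto
      have "onorm (\<lambda>x. G (g w x - g z x)) \<le> cmod (w - z) * C"
      proof (rule onorm_bound)
        show "0 \<le> cmod (w - z) * C" using C by simp
        show "norm (G (g w x - g z x)) \<le> cmod (w - z) * C * norm x" for x
          unfolding C_def by (rule est [OF near])
      qed
      moreover have "0 \<le> onorm (\<lambda>x. G (g w x - g z x))"
        using GG [OF wn] unfolding bounded_clinear_def by (intro onorm_pos_le) simp
      ultimately show "norm (onorm (\<lambda>x. (1 / (w - z)) *\<^sub>C (m w x - m z x) - G (g z x))) \<le> cmod (w - z) * C"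
        using w by (simp add: quot [OF wn])
    qed
    show "((\<lambda>w. cmod (w - z) * C) \<longlongrightarrow> 0) (at z)"
      by (rule tendsto_mult_left_zero [OF tendsto_norm_zero [OF LIM_zero [OF tendsto_ident_at]]])
  qed
  moreover have "bounded_clinear (\<lambda>x. G (g z x))"
    using G g_bounded [OF z] bounded_linear_compose [of G "g z"] unfolding bounded_clinear_def by simp
  ultimately show ?thesis unfolding op_differentiable_def by blast
qed

lemma m_holomorphic:
  assumes z: "Im z \<noteq> 0"
  shows "op_holomorphic_at m z"
  unfolding op_holomorphic_at_def
proof (intro exI [of _ "\<bar>Im z\<bar>"] conjI ballI)
  show "0 < \<bar>Im z\<bar>" using z by simp
  fix w assume "w \<in> ball z \<bar>Im z\<bar>"
  then have "cmod (z - w) < \<bar>Im z\<bar>" by (simp add: dist_norm)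
  moreover have "\<bar>Im z - Im w\<bar> \<le> cmod (z - w)" using abs_Im_le_cmod [of "z - w"] by simp
  ultimately have w: "Im w \<noteq> 0" by auto
  show "bounded_clinear (m w)" "op_differentiable m w" by (rule m_bounded [OF w], rule m_differentiable [OF w])
qed

section \<open>Invertibility of \<open>m + \<tau>\<close> off the real line\<close>

abbreviation "q \<equiv> \<lambda>z x. m z x + \<tau> z x"

lemma tau_holomorphic: "Im z \<noteq> 0 \<Longrightarrow> op_holomorphic_at \<tau> z"
  by (rule nevanlinna_holomorphic [OF tau])

lemma q_holomorphic: "Im z \<noteq> 0 \<Longrightarrow> op_holomorphic_at q z"
  by (rule op_holomorphic_add [OF m_holomorphic tau_holomorphic])

lemma q_bounded: "Im z \<noteq> 0 \<Longrightarrow> bounded_clinear (q z)"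
  by (rule op_holomorphic_bounded [OF q_holomorphic])

lemma tau_symmetric:
  assumes z: "Im z \<noteq> 0"
  shows "cinner (\<tau> z x) y = cinner x (\<tau> (cnj z) y)"
proof -
  have "z \<in> hol_domain \<tau>" using z tau_holomorphic [OF z] by (simp add: hol_domain_def)
  then have "cadjoint (\<tau> z) = \<tau> (cnj z)" using tau z unfolding nevanlinna_N0_def by blast
  then show ?thesis using cinner_cadjoint [OF op_holomorphic_bounded [OF tau_holomorphic [OF z]], of x y] by simp
qed

lemma q_symmetric:
  assumes z: "Im z \<noteq> 0"
  shows "cinner (q z x) y = cinner x (q (cnj z) y)"
  using m_gram [OF z, of "cnj z" x y] z tau_symmetric [OF z, of x y]
  by (simp add: cinner_add_left cinner_add_right)

text \<open>The imaginary part of the form of \<open>m z\<close> is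
  \<open>Im z * (norm (g z x))\<^sup>2\<close>, which is coercive since \<open>g z\<close> is
  bounded below, and \<tau> contributes an imaginary part of the same sign.\<close>

lemma q_bij:
  assumes z: "Im z \<noteq> 0"
  shows "bij (q z)"
proof -
  obtain c where c: "c > 0" "\<And>x. c * norm x \<le> norm (g z x)" using g_below [OF z] by blast
  have Im_m: "Im (cinner (m z x) x) = Im z * (norm (g z x))\<^sup>2" for x
  proof -
    have "Im ((z - cnj z) * complex_of_real ((norm (g z x))\<^sup>2)) =
        Im (cinner (m z x) x - cnj (cinner (m z x) x))"
      using m_gram [OF z z, of x x] by (simp only: cinner_self cinner_commute [of x "m z x"])
    then show ?thesis by (simp del: of_real_power)
  qed
  have Im_tau: "0 \<le> Im z * Im (cinner (\<tau> z x) x)" for x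
  proof (cases "Im z > 0")
    case True
    then show ?thesis
      using nevanlinna_Im_nonneg [OF tau True tau_holomorphic [OF z], of x] by simp
  next
    case False
    then have neg: "Im z < 0" using z by simp
    have "Im (cinner (\<tau> (cnj z) x) x) \<ge> 0"
      by (rule nevanlinna_Im_nonneg [OF tau _ tau_holomorphic]) (use neg in simp_all)
    then have "Im (cinner (\<tau> z x) x) \<le> 0"
      using tau_symmetric [OF z, of x x] by (simp add: cinner_commute [of x "\<tau> (cnj z) x"])
    then show ?thesis using neg by (simp add: mult_nonpos_nonpos)
  qed
  show ?thesis
  proof (rule coercive_bij [OF q_bounded [OF z]])
    show "0 < \<bar>Im z\<bar> * c\<^sup>2" using z c by simp
    fix x
    have "(c * norm x)\<^sup>2 \<le> (norm (g z x))\<^sup>2" using c by (intro power_mono) auto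
    then have "(Im z)\<^sup>2 * (c\<^sup>2 * (norm x)\<^sup>2) \<le> (Im z)\<^sup>2 * (norm (g z x))\<^sup>2"
      by (intro mult_left_mono) (simp_all add: power_mult_distrib)
    also have "\<dots> \<le> Im z * Im (cinner (q z x) x)"
      using Im_tau [of x] by (simp add: cinner_add_left Im_m power2_eq_square algebra_simps)
    also have "\<dots> \<le> \<bar>Im z\<bar> * \<bar>Im (cinner (q z x) x)\<bar>" by (simp only: abs_mult [symmetric] abs_ge_self)
    also have "\<dots> \<le> \<bar>Im z\<bar> * cmod (cinner (q z x) x)" by (intro mult_left_mono abs_Im_le_cmod) simp
    also have "(Im z)\<^sup>2 * (c\<^sup>2 * (norm x)\<^sup>2) = \<bar>Im z\<bar> * (\<bar>Im z\<bar> * (c\<^sup>2 * (norm x)\<^sup>2))"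
      by (simp add: power2_eq_square flip: mult.assoc)
    finally have "\<bar>Im z\<bar> * (\<bar>Im z\<bar> * (c\<^sup>2 * (norm x)\<^sup>2)) \<le> \<bar>Im z\<bar> * cmod (cinner (q z x) x)" .
    then have "\<bar>Im z\<bar> * (c\<^sup>2 * (norm x)\<^sup>2) \<le> cmod (cinner (q z x) x)"
      by (rule mult_left_le_imp_le) (use z in simp)
    then show "\<bar>Im z\<bar> * c\<^sup>2 * (norm x)\<^sup>2 \<le> cmod (cinner (q z x) x)"
      by (simp only: mult.assoc)
  qed
qed

text \<open>A preimage exists already in the range of \<open>g z\<close>, because the adjoint of
  \<open>g z\<close> composed with \<open>g z\<close> is coercive.\<close>

lemma g_adj_onto:
  assumes z: "Im z \<noteq> 0"
  shows "\<exists>h\<in>H. cadjoint (g z) h = x"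
proof -
  define N where "N x = cadjoint (g z) (g z x)" for x
  obtain c where c: "c > 0" "\<And>x. c * norm x \<le> norm (g z x)" using g_below [OF z] by blast
  have "bounded_clinear N"
    using bounded_clinear_cadjoint [OF g_bounded [OF z]] g_bounded [OF z]
      bounded_linear_compose [of "cadjoint (g z)" "g z"]
    unfolding bounded_clinear_def N_def [abs_def] by simp
  moreover have "c\<^sup>2 * (norm x)\<^sup>2 \<le> cmod (cinner (N x) x)" for x
  proof -
    have "(c * norm x)\<^sup>2 \<le> (norm (g z x))\<^sup>2" using c by (intro power_mono) auto
    also have "\<dots> = cmod (cinner (N x) x)"
      by (simp add: N_def cinner_g_adj [OF z] cinner_self norm_power)
    finally show ?thesis by (simp add: power_mult_distrib)
  qed
  ultimately have "bij N" using c(1) by (intro coercive_bij [of N "c\<^sup>2"]) simp_all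
  then obtain y where "N y = x" by (metis bij_pointE)
  then show ?thesis unfolding N_def using fam.F_mem [OF z] by blast
qed

end

context krein_extension
begin

section \<open>Recovering \<Gamma> from Krein's formula\<close>

lemma q_inv: "Im z \<noteq> 0 \<Longrightarrow> q z (inv_into UNIV (q z) y) = y"
  by (rule surj_f_inv_f [OF bij_is_surj [OF q_bij]])

lemma inv_q: "Im z \<noteq> 0 \<Longrightarrow> inv_into UNIV (q z) (q z x) = x"
  by (rule inv_f_f [OF bij_is_inj [OF q_bij]])

lemma krein_cinner:
  assumes z: "Im z \<noteq> 0" and h: "h \<in> H" and x: "cadjoint (g (cnj z)) h = q z x" and k: "k \<in> H"
  shows "cinner (RT z h) k = cinner (RA z h) k - cinner (g z x) k"
proof -
  have proj: "orth_proj H (RT z h) = RA z h - g z x" using krein [OF z h] by (simp only: x inv_q [OF z])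
  have "cinner (RT z h) k = cinner (orth_proj H (RT z h)) k"
    by (rule cinner_orth_proj [OF subspace_H k, symmetric])
  also have "\<dots> = cinner (RA z h) k - cinner (g z x) k" by (simp only: proj cinner_diff_left)
  finally show ?thesis .
qed

lemma self_cinner:
  assumes z: "Im z \<noteq> 0" and h: "h \<in> H"
  shows "(z - cnj z) * cinner (RT z h) (RT z h) = cinner (RT z h) h - cinner h (RT z h)"
    and "(z - cnj z) * cinner (RA z h) (RA z h) = cinner (RA z h) h - cinner h (RA z h)"
proof -
  have T: "(RT z h, h + z *\<^sub>C RT z h) \<in> Atilde" by (rule ext.resolvent_mem [OF rhoT [OF z]]) simp
  show "(z - cnj z) * cinner (RT z h) (RT z h) = cinner (RT z h) h - cinner h (RT z h)"
    using ext.symmetric [OF T T]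
    by (simp add: cinner_add_left cinner_add_right cinner_scaleC_left cinner_scaleC_right algebra_simps)
  have A: "(RA z h, h + z *\<^sub>C RA z h) \<in> A" by (rule rel.resolvent_mem [OF rho [OF z] h])
  show "(z - cnj z) * cinner (RA z h) (RA z h) = cinner (RA z h) h - cinner h (RA z h)"
    using rel.symmetric [OF A A]
    by (simp add: cinner_add_left cinner_add_right cinner_scaleC_left cinner_scaleC_right algebra_simps)
qed

text \<open>
  On the range of \<open>S - z\<close> the compression of the resolvent of the extension is the resolvent of \<open>A\<close>,
  and by the resolvent identity the two resolvents have the same norm there.
\<close>

lemma resolvents_agree:
  assumes z: "Im z \<noteq> 0" and h: "h \<in> H" and zero: "cadjoint (g (cnj z)) h = 0"
  shows "RT z h = RA z h"
proof -
  have q0: "cadjoint (g (cnj z)) h = q z 0" by (simp only: zero bounded_clinear_zero [OF q_bounded [OF z]])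
  have kr: "cinner (RT z h) k = cinner (RA z h) k" if "k \<in> H" for k
    using krein_cinner [OF z h q0 that] by (simp add: bounded_clinear_zero [OF g_bounded [OF z]])
  have RAh: "RA z h \<in> H" by (rule rel.resolvent_in_H [OF rho [OF z] h])
  have kr': "cinner k (RT z h) = cinner k (RA z h)" if "k \<in> H" for k
    using kr [OF that] by (metis cinner_commute)
  have "z - cnj z \<noteq> 0" using z by (simp add: complex_eq_iff)
  moreover have "(z - cnj z) * cinner (RT z h) (RT z h) = (z - cnj z) * cinner (RA z h) (RA z h)"
    by (simp only: self_cinner [OF z h] kr [OF h] kr' [OF h])
  ultimately have eq: "cinner (RT z h) (RT z h) = cinner (RA z h) (RA z h)" by simp
  have "cinner (RT z h - RA z h) (RT z h - RA z h) = 0"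
    by (simp add: cinner_diff_left cinner_diff_right eq kr [OF RAh] kr' [OF RAh])
  then show ?thesis by simp
qed

text \<open>An argument in \<open>H\<close> for which the vector
  \<open>inv_into UNIV (q z) (cadjoint (g (cnj z)) h)\<close> in Krein's formula is exactly
  \<open>x\<close>. By the preceding lemma the choice does not affect the difference of the two
  resolvents.\<close>

definition lift :: "complex \<Rightarrow> 'g \<Rightarrow> 'k" where
  "lift z x = (SOME h. h \<in> H \<and> cadjoint (g (cnj z)) h = q z x)"

text \<open>
  The defect family of the orthogonal sum of \<open>A\<close> and of the relation realising \<open>\<tau>\<close> in the orthogonal
  complement of \<open>H\<close>, read off from the resolvents of \<open>Atilde\<close>.
\<close>

definition \<Gamma> :: "complex \<Rightarrow> 'g \<Rightarrow> 'k" where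
  "\<Gamma> z x = RA z (lift z x) - RT z (lift z x)"

lemma lift:
  assumes z: "Im z \<noteq> 0"
  shows "lift z x \<in> H" "cadjoint (g (cnj z)) (lift z x) = q z x"
proof -
  have "\<exists>h. h \<in> H \<and> cadjoint (g (cnj z)) h = q z x"
    using g_adj_onto [OF Im_cnj [OF z], of "q z x"] by blast
  then have "lift z x \<in> H \<and> cadjoint (g (cnj z)) (lift z x) = q z x"
    unfolding lift_def by (rule someI_ex)
  then show "lift z x \<in> H" "cadjoint (g (cnj z)) (lift z x) = q z x" by blast+
qed

text \<open>Two arguments with the same adjoint image differ by a vector on which the resolvents
  agree, so the chosen lift may be replaced by any \<open>h\<close>.\<close>

lemma resolvent_\<Gamma>:
  assumes z: "Im z \<noteq> 0" and h: "h \<in> H" and x: "cadjoint (g (cnj z)) h = q z x"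
  shows "RT z h = RA z h - \<Gamma> z x"
proof -
  let ?l = "lift z x"
  have d: "h - ?l \<in> H" by (intro csubspace_diff rel.csubspace_H h lift [OF z])
  have "cadjoint (g (cnj z)) (h - ?l) = 0"
    using bounded_clinear_diff [OF bounded_clinear_cadjoint [OF g_bounded [OF Im_cnj [OF z]]], of h ?l]
    by (simp add: x lift [OF z])
  then have "RT z (h - ?l) = RA z (h - ?l)" by (rule resolvents_agree [OF z d])
  then have "RT z h - RT z ?l = RA z h - RA z ?l"
    by (simp add: ext.resolvent_diff [OF rhoT [OF z]] rel.resolvent_diff [OF rho [OF z] h lift(1) [OF z]])
  then show ?thesis by (simp add: \<Gamma>_def algebra_simps)
qed

text \<open>Krein's formula at the lift of \<open>x\<close>: \<open>g z x\<close> is the component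
  of \<open>\<Gamma> z x\<close> in \<open>H\<close>.\<close>

lemma \<Gamma>_compression:
  assumes z: "Im z \<noteq> 0" and k: "k \<in> H"
  shows "cinner (\<Gamma> z x) k = cinner (g z x) k"
  using krein_cinner [OF z lift [OF z] k, of x]
  by (simp add: \<Gamma>_def cinner_diff_left)

lemma \<Gamma>_compression_right:
  assumes z: "Im z \<noteq> 0" and k: "k \<in> H"
  shows "cinner k (\<Gamma> z x) = cinner k (g z x)"
  using \<Gamma>_compression [OF z k, of x] by (metis cinner_commute)

text \<open>The adjoint of the resolvent identity for the defect family, obtained from symmetry of
  \<open>A\<close> between the resolvent pair of \<open>h\<close> and the difference of the family
  at \<open>w\<close> and \<open>cnj z\<close>.\<close>

lemma resolvent_g_split:
  assumes z: "Im z \<noteq> 0" and w: "Im w \<noteq> 0" and h: "h \<in> H"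
  shows "(z - cnj w) * cinner (RA z h) (g w y) + cinner h (g w y) = cinner h (g (cnj z) y)"
proof -
  have A: "(RA z h, h + z *\<^sub>C RA z h) \<in> A" by (rule rel.resolvent_mem [OF rho [OF z] h])
  show ?thesis
    using rel.symmetric [OF A fam.F_rel [OF w Im_cnj [OF z], of y]]
    by (simp add: cinner_add_left cinner_diff_right cinner_scaleC_left cinner_scaleC_right algebra_simps)
qed

text \<open>The products of two resolvents of \<open>A\<close>, and of two resolvents of
  \<open>Atilde\<close>, follow from the resolvent identity; each mixed product has one factor in
  \<open>H\<close> and so depends only on the compression, which Krein's formula provides.\<close>

lemma \<Gamma>_gram:
  assumes z: "Im z \<noteq> 0" and w: "Im w \<noteq> 0"
  shows "(z - cnj w) * cinner (\<Gamma> z x) (\<Gamma> w y) = cinner (q z x) y - cinner x (q w y)"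
proof -
  define h where "h = lift z x"
  define k where "k = lift w y"
  have h: "h \<in> H" "cadjoint (g (cnj z)) h = q z x" unfolding h_def by (rule lift [OF z])+
  have k: "k \<in> H" "cadjoint (g (cnj w)) k = q w y" unfolding k_def by (rule lift [OF w])+
  define u u' v v' where "u = RT z h" and "u' = RA z h" and "v = RT w k" and "v' = RA w k"
  note defs = u_def u'_def v_def v'_def
  have uH: "u' \<in> H" and vH: "v' \<in> H"
    unfolding defs by (intro rel.resolvent_in_H rho z w h k)+
  have ux: "\<Gamma> z x = u' - u" and vy: "\<Gamma> w y = v' - v" by (simp_all add: defs \<Gamma>_def h_def k_def)
  have T: "(u, h + z *\<^sub>C u) \<in> Atilde" "(v, k + w *\<^sub>C v) \<in> Atilde"
    unfolding defs by (rule ext.resolvent_mem [OF rhoT [OF z]], simp, rule ext.resolvent_mem [OF rhoT [OF w]], simp)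
  have A: "(u', h + z *\<^sub>C u') \<in> A" "(v', k + w *\<^sub>C v') \<in> A"
    unfolding defs by (rule rel.resolvent_mem [OF rho [OF z] h(1)], rule rel.resolvent_mem [OF rho [OF w] k(1)])
  have 1: "(z - cnj w) * cinner u v = cinner u k - cinner h v"
    using ext.symmetric [OF T]
    by (simp add: cinner_add_left cinner_add_right cinner_scaleC_left cinner_scaleC_right algebra_simps)
  have 2: "(z - cnj w) * cinner u' v' = cinner u' k - cinner h v'"
    using rel.symmetric [OF A]
    by (simp add: cinner_add_left cinner_add_right cinner_scaleC_left cinner_scaleC_right algebra_simps)
  have 3: "cinner u' v = cinner u' v' - cinner u' (g w y)" "cinner h v = cinner h v' - cinner h (g w y)"
    using \<Gamma>_compression_right [OF w uH, of y] \<Gamma>_compression_right [OF w h(1), of y]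
    unfolding vy by (simp_all add: cinner_diff_right algebra_simps)
  have 4: "cinner u v' = cinner u' v' - cinner (g z x) v'" "cinner u k = cinner u' k - cinner (g z x) k"
    using \<Gamma>_compression [OF z vH, of x] \<Gamma>_compression [OF z k(1), of x]
    unfolding ux by (simp_all add: cinner_diff_left algebra_simps)
  \<comment> \<open>This identity and the next evaluate the adjoints of the defect family at the
    lifts, where they equal \<open>q z x\<close> and \<open>q w y\<close>.\<close>
  have 5: "(z - cnj w) * cinner u' (g w y) + cinner h (g w y) = cinner (q z x) y"
    using resolvent_g_split [OF z w h(1), of y] cinner_g_adj [OF Im_cnj [OF z], of h y]
    unfolding defs h(2) by simp
  have 6: "(z - cnj w) * cinner (g z x) v' - cinner (g z x) k = - cinner x (q w y)"
  proof -
    have "(w - cnj z) * cinner v' (g z x) + cinner k (g z x) = cinner (q w y) x"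
      using resolvent_g_split [OF w z k(1), of x] cinner_g_adj [OF Im_cnj [OF w], of k x]
      unfolding defs k(2) by simp
    then have "cnj ((w - cnj z) * cinner v' (g z x) + cinner k (g z x)) = cnj (cinner (q w y) x)"
      by (rule arg_cong)
    then have "(cnj w - z) * cinner (g z x) v' + cinner (g z x) k = cinner x (q w y)"
      by (simp only: complex_cnj_add complex_cnj_mult complex_cnj_diff complex_cnj_cnj cinner_commute [symmetric])
    moreover have "(z - cnj w) * cinner (g z x) v' = - ((cnj w - z) * cinner (g z x) v')"
      by (simp add: left_diff_distrib)
    ultimately show ?thesis by (simp add: algebra_simps)
  qed
  have "(z - cnj w) * cinner (\<Gamma> z x) (\<Gamma> w y) =
      (z - cnj w) * (cinner u' (g w y) + cinner (g z x) v') - (z - cnj w) * cinner u' v' + (z - cnj w) * cinner u v"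
    unfolding ux vy by (simp add: cinner_diff_left cinner_diff_right 3(1) 4(1) algebra_simps)
  also have "\<dots> = ((z - cnj w) * cinner u' (g w y) + cinner h (g w y)) +
      ((z - cnj w) * cinner (g z x) v' - cinner (g z x) k)"
    unfolding 1 2 3(2) 4(2) by (simp add: distrib_left)
  also have "\<dots> = cinner (q z x) y - cinner x (q w y)" unfolding 5 6 by simp
  finally show ?thesis .
qed

text \<open>Arguments \<open>h\<close> and \<open>k\<close> are chosen so that the resolvents of
  \<open>A\<close> at \<open>z\<close> and \<open>w\<close> take the same value on them. In the
  difference of the corresponding pairs of \<open>Atilde\<close> the contributions of
  \<open>A\<close> cancel and only \<Gamma> remains.\<close>

lemma \<Gamma>_rel:
  assumes z: "Im z \<noteq> 0" and w: "Im w \<noteq> 0" and eq: "q z x = q w x'"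
  shows "(\<Gamma> z x - \<Gamma> w x', z *\<^sub>C \<Gamma> z x - w *\<^sub>C \<Gamma> w x') \<in> Atilde"
proof -
  define h where "h = lift z x"
  have h: "h \<in> H" "cadjoint (g (cnj z)) h = q z x" unfolding h_def by (rule lift [OF z])+
  define u' where "u' = RA z h"
  have A: "(u', h + z *\<^sub>C u') \<in> A" unfolding u'_def by (rule rel.resolvent_mem [OF rho [OF z] h(1)])
  \<comment> \<open>The resolvent identity for \<open>A\<close> gives
    \<open>RA w k = RA z h\<close>, and the adjoint of \<open>g (cnj w)\<close> takes at
    \<open>k\<close> the value that the adjoint of \<open>g (cnj z)\<close> takes at
    \<open>h\<close>; the hypothesis makes it \<open>q w x'\<close>.\<close>
  define k where "k = h + (z - w) *\<^sub>C u'"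
  have kH: "k \<in> H" unfolding k_def by (intro csubspace_add csubspace_scaleC rel.csubspace_H h rel.A_sub(1) [OF A])
  have "cadjoint (g (cnj w)) k = q w x'"
  proof (rule cinner_ext)
    fix y
    have "cinner (cadjoint (g (cnj w)) k) y = cinner h (g (cnj z) y)"
      unfolding cinner_g_adj [OF Im_cnj [OF w]] k_def
      using resolvent_g_split [OF z Im_cnj [OF w] h(1), of y]
      by (simp add: cinner_add_left cinner_scaleC_left u'_def add.commute)
    also have "\<dots> = cinner (q z x) y" using cinner_g_adj [OF Im_cnj [OF z], of h y] unfolding h(2) by simp
    finally show "cinner (cadjoint (g (cnj w)) k) y = cinner (q w x') y" by (simp only: eq)
  qed
  then have RTk: "RT w k = RA w k - \<Gamma> w x'" by (rule resolvent_\<Gamma> [OF w kH])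
  have RAk: "RA w k = u'"
    by (rule rel.resolvent_unique [OF rho [OF w]]) (use A in \<open>simp add: k_def scaleC_diff_left\<close>)
  have RTh: "RT z h = u' - \<Gamma> z x" unfolding u'_def by (rule resolvent_\<Gamma> [OF z h])
  have 1: "(RT w k, k + w *\<^sub>C RT w k) \<in> Atilde" by (rule ext.resolvent_mem [OF rhoT [OF w]]) simp
  have 2: "(RT z h, h + z *\<^sub>C RT z h) \<in> Atilde" by (rule ext.resolvent_mem [OF rhoT [OF z]]) simp
  have "(RT w k - RT z h, (k + w *\<^sub>C RT w k) - (h + z *\<^sub>C RT z h)) \<in> Atilde"
    by (rule ext.A_diff [OF 1 2])
  moreover have "RT w k - RT z h = \<Gamma> z x - \<Gamma> w x'" by (simp add: RTk RAk RTh)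
  moreover have "(k + w *\<^sub>C RT w k) - (h + z *\<^sub>C RT z h) = z *\<^sub>C \<Gamma> z x - w *\<^sub>C \<Gamma> w x'"
  proof -
    have kh: "k - h = z *\<^sub>C u' - w *\<^sub>C u'" by (simp add: k_def scaleC_diff_left)
    have "(k + w *\<^sub>C RT w k) - (h + z *\<^sub>C RT z h) = (k - h) + w *\<^sub>C RT w k - z *\<^sub>C RT z h"
      by simp
    also have "\<dots> = z *\<^sub>C \<Gamma> z x - w *\<^sub>C \<Gamma> w x'"
      unfolding RTk RAk RTh kh by (simp add: scaleC_diff_right)
    finally show ?thesis .
  qed
  ultimately show ?thesis by simp
qed

text \<open>Each vector \<open>\<gamma> x + (z - z\<^sub>0) *\<^sub>C RT z (\<gamma> x)\<close> of
  the minimality condition is a vector of \<open>H\<close> minus a multiple of some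
  \<open>\<Gamma> z y\<close>, so \<open>H\<close> and \<Gamma> together are total.\<close>

lemma eq_0_if_orthogonal:
  assumes H0: "\<And>k. k \<in> H \<Longrightarrow> cinner u k = 0" and \<Gamma>0: "\<And>z x. Im z \<noteq> 0 \<Longrightarrow> cinner u (\<Gamma> z x) = 0"
  shows "u = 0"
proof -
  have nonreal: "cinner u (\<gamma> x + (z - z\<^sub>0) *\<^sub>C RT z (\<gamma> x)) = 0" if z: "Im z \<noteq> 0" for z x
  proof -
    define y where "y = inv_into UNIV (q z) (cadjoint (g (cnj z)) (\<gamma> x))"
    have y: "cadjoint (g (cnj z)) (\<gamma> x) = q z y" unfolding y_def by (rule q_inv [OF z, symmetric])
    have "RT z (\<gamma> x) = RA z (\<gamma> x) - \<Gamma> z y" by (rule resolvent_\<Gamma> [OF z \<gamma>_mem y])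
    moreover have "cinner u (RA z (\<gamma> x)) = 0" by (intro H0 rel.resolvent_in_H rho z \<gamma>_mem)
    ultimately show ?thesis
      by (simp add: cinner_add_right cinner_scaleC_right cinner_diff_right H0 [OF \<gamma>_mem] \<Gamma>0 [OF z])
  qed
  have span: "u \<in> closed_cspan {\<gamma> x + (z - z\<^sub>0) *\<^sub>C RT z (\<gamma> x) |z x. z \<in> resolvent_set UNIV Atilde}"
    using Atilde(2) by (simp add: minimal_extension_def)
  have "cinner u u = 0"
  proof (rule closed_cspan_orthogonal [OF _ span], clarify)
    fix z x assume z: "z \<in> resolvent_set UNIV Atilde"
    show "cinner u (\<gamma> x + (z - z\<^sub>0) *\<^sub>C RT z (\<gamma> x)) = 0"
      by (rule ext.defect_orthogonal [OF UNIV_I z]) (rule nonreal)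
  qed
  then show ?thesis by simp
qed

section \<open>Gram families of \<open>m\<close>, \<open>m + \<tau>\<close> and \<tau>, and the
  family of \<open>Atilde\<close>\<close>

sublocale gram_m: gram_family m g
  by unfold_locales (simp_all add: m_holomorphic m_gram)

sublocale gram_q: gram_family q \<Gamma>
  by unfold_locales (rule q_holomorphic, assumption, rule \<Gamma>_gram)

sublocale gram_tau: gram_family \<tau> "\<lambda>z x. \<Gamma> z x - g z x"
proof
  fix z w x y assume z: "Im z \<noteq> 0"
  show "op_holomorphic_at \<tau> z" by (rule tau_holomorphic [OF z])
  assume w: "Im w \<noteq> 0"
  \<comment> \<open>As \<open>g z x\<close> is the component in \<open>H\<close>, each mixed product
    equals the Gram entry of the defect family, and the two Gram matrices subtract.\<close>
  have "cinner (\<Gamma> z x - g z x) (\<Gamma> w y - g w y) = cinner (\<Gamma> z x) (\<Gamma> w y) - cinner (g z x) (g w y)"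
    using \<Gamma>_compression [OF z fam.F_mem [OF w], of x y] \<Gamma>_compression_right [OF w fam.F_mem [OF z], of x y]
    by (simp add: cinner_diff_left cinner_diff_right)
  then have "(z - cnj w) * cinner (\<Gamma> z x - g z x) (\<Gamma> w y - g w y) =
      (cinner (q z x) y - cinner x (q w y)) - (cinner (m z x) y - cinner x (m w y))"
    by (simp only: right_diff_distrib \<Gamma>_gram [OF z w] m_gram [OF z w])
  then show "(z - cnj w) * cinner (\<Gamma> z x - g z x) (\<Gamma> w y - g w y) = cinner (\<tau> z x) y - cinner x (\<tau> w y)"
    by (simp add: cinner_add_left cinner_add_right)
qed

text \<open>The relation \<open>\<Gamma>_rel\<close> couples parameters with
  \<open>q z x = q w x'\<close>. Indexed by this common value, the vectors form a resolvent family
  for \<open>Atilde\<close>.\<close>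

definition \<Theta> :: "complex \<Rightarrow> 'g \<Rightarrow> 'k" where "\<Theta> z y = \<Gamma> z (inv_into UNIV (q z) y)"

lemma \<Theta>_q:
  assumes z: "Im z \<noteq> 0"
  shows "\<Theta> z (q z x) = \<Gamma> z x"
  unfolding \<Theta>_def by (simp only: inv_q [OF z])

sublocale tfam: resolvent_family UNIV Atilde \<Theta>
proof
  fix z w x assume z: "Im z \<noteq> 0"
  show "\<Theta> z x \<in> UNIV" by simp
  assume w: "Im w \<noteq> 0"
  show "(\<Theta> z x - \<Theta> w x, z *\<^sub>C \<Theta> z x - w *\<^sub>C \<Theta> w x) \<in> Atilde"
    unfolding \<Theta>_def by (rule \<Gamma>_rel [OF z w]) (simp only: q_inv [OF z] q_inv [OF w])
qed

lemma \<Gamma>_tfam_L: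
  assumes z: "Im z \<noteq> 0"
  shows "\<Gamma> z x \<in> tfam.L"
  using tfam.F_L [OF z, of "q z x"] by (simp only: \<Theta>_q [OF z])

lemma orthogonal_tfam_L:
  assumes orth: "\<And>z x. Im z \<noteq> 0 \<Longrightarrow> cinner u (\<Gamma> z x) = 0" and v: "v \<in> tfam.L"
  shows "cinner u v = 0"
  by (rule tfam.orthogonal_L [OF _ v]) (simp add: \<Theta>_def orth)

end

section \<open>Eigenvectors of the extension at a fixed real point\<close>

context krein_extension
begin

context
  fixes \<alpha> :: real
begin

definition eigenspace :: "'k set" where "eigenspace = rel_ker (rel_shift Atilde \<alpha>)"

text \<open>The criterion for the pair \<open>(c, 0)\<close> in the generalised value of
  \<open>q\<close>, with witness \<open>v\<close>.\<close>

definition has_value :: "'k \<Rightarrow> 'g \<Rightarrow> bool" where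
  "has_value v c \<longleftrightarrow> (\<forall>z y. Im z \<noteq> 0 \<longrightarrow> (\<alpha> - cnj z) * cinner v (\<Gamma> z y) = - cinner c (q z y))"

text \<open>The criterion for the pair \<open>(0, d)\<close> in the generalised value of
  \<open>m\<close>, with witness \<open>v\<close>.\<close>

definition has_pole :: "'k \<Rightarrow> 'g \<Rightarrow> bool" where
  "has_pole v d \<longleftrightarrow> (\<forall>z y. Im z \<noteq> 0 \<longrightarrow> (\<alpha> - cnj z) * cinner v (g z y) = cinner d y)"

definition Ker where "Ker = rel_ker (generalised_value q \<alpha>)"

definition Mul where "Mul = rel_mul (generalised_value m \<alpha>) \<inter> rel_mul (generalised_value \<tau> \<alpha>)"

lemma alpha_neq: "Im z \<noteq> 0 \<Longrightarrow> complex_of_real \<alpha> - cnj z \<noteq> 0" "Im z \<noteq> 0 \<Longrightarrow> complex_of_real \<alpha> - z \<noteq> 0"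
  by (auto simp: complex_eq_iff)

lemma eigenspace_iff: "v \<in> eigenspace \<longleftrightarrow> (v, complex_of_real \<alpha> *\<^sub>C v) \<in> Atilde"
  by (simp add: eigenspace_def rel_ker_def rel_shift_iff)

lemma Ker_iff: "c \<in> Ker \<longleftrightarrow> (\<exists>h. has_value h c)"
  by (simp add: Ker_def rel_ker_def gram_q.generalised_value_iff has_value_def)

lemma Mul_iff: "d \<in> Mul \<longleftrightarrow> (\<exists>h. has_pole h d) \<and>
    (\<exists>h. \<forall>z y. Im z \<noteq> 0 \<longrightarrow> (\<alpha> - cnj z) * cinner h (\<Gamma> z y - g z y) = cinner d y)"
  by (simp add: Mul_def rel_mul_def gram_m.generalised_value_iff gram_tau.generalised_value_iff has_pole_def)

lemma csubspace_eigenspace: "csubspace eigenspace"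
proof (rule csubspaceI)
  show "0 \<in> eigenspace" using ext.A_zero by (simp add: eigenspace_iff)
  show "x + y \<in> eigenspace" if "x \<in> eigenspace" "y \<in> eigenspace" for x y
    using ext.A_add [OF that [unfolded eigenspace_iff]] by (simp add: eigenspace_iff scaleC_add_right)
  show "a *\<^sub>C x \<in> eigenspace" if "x \<in> eigenspace" for a x
    using ext.A_scaleC [OF that [unfolded eigenspace_iff], of a]
    by (simp add: eigenspace_iff scaleC_scaleC mult.commute)
qed

lemma closed_eigenspace: "closed eigenspace"
  unfolding closed_sequential_limits
proof (intro allI impI, elim conjE)
  fix f l assume f: "\<forall>n. f n \<in> eigenspace" and lim: "f \<longlonglongrightarrow> l"
  have mem: "(f n, complex_of_real \<alpha> *\<^sub>C f n) \<in> Atilde" for n using f by (simp add: eigenspace_iff)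
  have lim2: "(\<lambda>n. (f n, complex_of_real \<alpha> *\<^sub>C f n)) \<longlonglongrightarrow> (l, complex_of_real \<alpha> *\<^sub>C l)"
    by (intro tendsto_Pair lim tendsto_scaleC_right)
  have cl: "closed Atilde" using ext.closed_csubspace_A by (simp add: closed_csubspace_def)
  have "(l, complex_of_real \<alpha> *\<^sub>C l) \<in> Atilde" by (rule closed_sequentially [OF cl mem lim2])
  then show "l \<in> eigenspace" by (simp add: eigenspace_iff)
qed

lemma has_value_add: "has_value v c \<Longrightarrow> has_value v' c' \<Longrightarrow> has_value (v + v') (c + c')"
  by (simp add: has_value_def cinner_add_left distrib_left)

lemma has_value_scaleC: "has_value v c \<Longrightarrow> has_value (a *\<^sub>C v) (a *\<^sub>C c)"
  by (simp add: has_value_def cinner_scaleC_left mult.left_commute)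

lemma has_pole_add: "has_pole v d \<Longrightarrow> has_pole v' d' \<Longrightarrow> has_pole (v + v') (d + d')"
  by (simp add: has_pole_def cinner_add_left distrib_left)

lemma has_pole_scaleC: "has_pole v d \<Longrightarrow> has_pole (a *\<^sub>C v) (a *\<^sub>C d)"
  by (simp add: has_pole_def cinner_scaleC_left mult.left_commute)

text \<open>The condition at one point fixes the products of \<open>c\<close> with the range of
  \<open>q z\<^sub>0\<close>, which is the whole space.\<close>

lemma has_value_unique:
  assumes "has_value v c" "has_value v c'"
  shows "c = c'"
proof (rule cinner_ext)
  fix y
  define y' where "y' = inv_into UNIV (q z\<^sub>0) y"
  have "(\<alpha> - cnj z\<^sub>0) * cinner v (\<Gamma> z\<^sub>0 y') = - cinner c (q z\<^sub>0 y')"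
    "(\<alpha> - cnj z\<^sub>0) * cinner v (\<Gamma> z\<^sub>0 y') = - cinner c' (q z\<^sub>0 y')"
    using assms z0_nonreal unfolding has_value_def by blast+
  then have "cinner c (q z\<^sub>0 (inv_into UNIV (q z\<^sub>0) y)) = cinner c' (q z\<^sub>0 (inv_into UNIV (q z\<^sub>0) y))"
    unfolding y'_def by simp
  then show "cinner c y = cinner c' y" unfolding q_inv [OF z0_nonreal] .
qed

lemma has_pole_unique:
  assumes "has_pole v d" "has_pole v d'"
  shows "d = d'"
proof (rule cinner_ext)
  fix y
  have "(\<alpha> - cnj z\<^sub>0) * cinner v (g z\<^sub>0 y) = cinner d y" "(\<alpha> - cnj z\<^sub>0) * cinner v (g z\<^sub>0 y) = cinner d' y"
    using assms z0_nonreal unfolding has_pole_def by blast+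
  then show "cinner d y = cinner d' y" by simp
qed

lemma combine_shifted:
  fixes al z' w' a b s :: complex
  assumes "(al - z') * a = s" "(al - w') * b = s"
  shows "al * a - al * b = z' * a - w' * b"
proof -
  have "al * a - al * b - (z' * a - w' * b) = (al - z') * a - (al - w') * b"
    by (simp add: left_diff_distrib)
  then show ?thesis by (simp only: assms diff_self right_minus_eq)
qed

lemma has_value_0_iff: "has_value v 0 \<longleftrightarrow> (\<forall>z y. Im z \<noteq> 0 \<longrightarrow> cinner v (\<Gamma> z y) = 0)"
  using alpha_neq(1) by (simp add: has_value_def)

text \<open>Symmetry of \<open>Atilde\<close> between \<open>v\<close> and the family makes
  \<open>(\<alpha> - cnj z) * cinner v (\<Gamma> z y)\<close> depend on \<open>q z y\<close> only;
  this functional is represented by \<open>- c\<close>.\<close>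

lemma eigenvector_value:
  assumes v: "v \<in> eigenspace"
  shows "\<exists>c. has_value v c"
proof -
  \<comment> \<open>The functional is represented at the base point in terms of \<open>y0\<close>;
    solving \<open>q (cnj z\<^sub>0) c = d\<close> moves \<open>q z\<^sub>0\<close> onto the other
    factor by symmetry.\<close>
  define d where "d = - ((\<alpha> - cnj z\<^sub>0) *\<^sub>C cadjoint (\<Gamma> z\<^sub>0) v)"
  define c where "c = inv_into UNIV (q (cnj z\<^sub>0)) d"
  have c: "q (cnj z\<^sub>0) c = d" unfolding c_def by (rule q_inv [OF Im_cnj [OF z0_nonreal]])
  have "(\<alpha> - cnj z) * cinner v (\<Gamma> z y) = - cinner c (q z y)" if z: "Im z \<noteq> 0" for z y
  proof -
    define y0 where "y0 = inv_into UNIV (q z\<^sub>0) (q z y)"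
    have y0: "q z\<^sub>0 y0 = q z y" unfolding y0_def by (rule q_inv [OF z0_nonreal])
    have "cinner (complex_of_real \<alpha> *\<^sub>C v) (\<Gamma> z y - \<Gamma> z\<^sub>0 y0) =
        cinner v (z *\<^sub>C \<Gamma> z y - z\<^sub>0 *\<^sub>C \<Gamma> z\<^sub>0 y0)"
      by (rule ext.symmetric [OF v [unfolded eigenspace_iff] \<Gamma>_rel [OF z z0_nonreal y0 [symmetric]]])
    then have "(\<alpha> - cnj z) * cinner v (\<Gamma> z y) = (\<alpha> - cnj z\<^sub>0) * cinner v (\<Gamma> z\<^sub>0 y0)"
      by (simp add: cinner_diff_right cinner_scaleC_left cinner_scaleC_right algebra_simps)
    moreover have "cinner c (q z y) = - ((\<alpha> - cnj z\<^sub>0) * cinner v (\<Gamma> z\<^sub>0 y0))"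
    proof -
      have "cinner c (q z y) = cinner (q (cnj z\<^sub>0) c) y0"
        using q_symmetric [OF Im_cnj [OF z0_nonreal], of c y0] by (simp only: complex_cnj_cnj y0)
      also have "\<dots> = - ((\<alpha> - cnj z\<^sub>0) * cinner v (\<Gamma> z\<^sub>0 y0))"
        unfolding c d_def
        by (simp add: cinner_minus_left cinner_scaleC_left
            cinner_cadjoint_left [OF gram_q.\<Gamma>_bounded [OF z0_nonreal]])
      finally show ?thesis .
    qed
    ultimately show ?thesis by simp
  qed
  then show ?thesis unfolding has_value_def by blast
qed

text \<open>The condition depends only on the projection of the witness onto the closed span of the
  family, and inside this span it is the membership test for \<open>Atilde\<close>.\<close>

lemma value_eigenvector:
  assumes h: "has_value h c"
  shows "\<exists>v\<in>eigenspace. has_value v c"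
proof -
  obtain v where v: "v \<in> tfam.L" and orth: "\<forall>u\<in>tfam.L. cinner (h - v) u = 0"
    using orth_decomposition [OF tfam.closed_csubspace_L, of h] by blast
  have val: "has_value v c"
    unfolding has_value_def
  proof (intro allI impI)
    fix z y assume z: "Im z \<noteq> 0"
    have "cinner (h - v) (\<Gamma> z y) = 0" using orth \<Gamma>_tfam_L [OF z] by blast
    then have "cinner v (\<Gamma> z y) = cinner h (\<Gamma> z y)" by (simp add: cinner_diff_left)
    then show "(\<alpha> - cnj z) * cinner v (\<Gamma> z y) = - cinner c (q z y)"
      using h z unfolding has_value_def by simp
  qed
  have theta: "(\<alpha> - cnj z) * cinner v (\<Theta> z y) = - cinner c y" if z: "Im z \<noteq> 0" for z y
  proof -
    have "(\<alpha> - cnj z) * cinner v (\<Theta> z y) = - cinner c (q z (inv_into UNIV (q z) y))"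
      unfolding \<Theta>_def using val z unfolding has_value_def by blast
    then show ?thesis unfolding q_inv [OF z] .
  qed
  have "(v, complex_of_real \<alpha> *\<^sub>C v) \<in> Atilde"
  proof (rule tfam.mem_A_if_family [OF v])
    show "complex_of_real \<alpha> *\<^sub>C v \<in> tfam.L" by (rule csubspace_scaleC [OF tfam.csubspace_L v])
    fix z w y assume z: "Im z \<noteq> 0" and w: "Im w \<noteq> 0"
    show "cinner (complex_of_real \<alpha> *\<^sub>C v) (\<Theta> z y - \<Theta> w y) = cinner v (z *\<^sub>C \<Theta> z y - w *\<^sub>C \<Theta> w y)"
      using combine_shifted [OF theta [OF z, of y] theta [OF w, of y]]
      by (simp add: cinner_diff_right cinner_scaleC_left cinner_scaleC_right)
  qed
  then show ?thesis using val by (auto simp: eigenspace_iff)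
qed

text \<open>As \<open>v\<close> is the resolvent of \<open>(\<alpha> - l) *\<^sub>C v\<close>,
  pairing with \<open>k\<close> moves the resolvent onto \<open>k\<close>, where it splits into the
  resolvent of \<open>A\<close> and a \<Gamma>-part that \<open>has_value\<close> evaluates. The
  term with \<open>c\<close> measures how far the component of \<open>v\<close> in \<open>H\<close>
  is from being an eigenvector of \<open>A\<close>.\<close>

lemma eigenvector_compression:
  fixes l :: complex
  assumes v: "v \<in> eigenspace" and c: "has_value v c" and l: "Im l \<noteq> 0" and k: "k \<in> H"
  shows "cinner v k = (\<alpha> - l) * cinner v (RA (cnj l) k) + cinner (g l c) k"
proof -
  have lc: "Im (cnj l) \<noteq> 0" using l by simp
  define x where "x = inv_into UNIV (q (cnj l)) (cadjoint (g l) k)"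
  have x: "q (cnj l) x = cadjoint (g l) k" unfolding x_def by (rule q_inv [OF lc])
  have RTk: "RT (cnj l) k = RA (cnj l) k - \<Gamma> (cnj l) x"
    by (rule resolvent_\<Gamma> [OF lc k]) (simp only: complex_cnj_cnj x)
  have "RT l (complex_of_real \<alpha> *\<^sub>C v - l *\<^sub>C v) = v"
    by (rule ext.resolvent_eq [OF rhoT [OF l] v [unfolded eigenspace_iff]])
  then have "cinner v k = cinner (complex_of_real \<alpha> *\<^sub>C v - l *\<^sub>C v) (RT (cnj l) k)"
    using ext.resolvent_adjoint [OF rhoT [OF l] rhoT [OF lc] UNIV_I UNIV_I,
        of "complex_of_real \<alpha> *\<^sub>C v - l *\<^sub>C v" k] by simp
  also have "\<dots> = (\<alpha> - l) * cinner v (RA (cnj l) k) - (\<alpha> - l) * cinner v (\<Gamma> (cnj l) x)"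
    unfolding RTk scaleC_diff_left [symmetric] cinner_scaleC_left cinner_diff_right
    by (rule refl)
  finally have "cinner v k = (\<alpha> - l) * cinner v (RA (cnj l) k) - (\<alpha> - l) * cinner v (\<Gamma> (cnj l) x)" .
  moreover have "(\<alpha> - cnj (cnj l)) * cinner v (\<Gamma> (cnj l) x) = - cinner c (q (cnj l) x)"
    using c lc unfolding has_value_def by blast
  moreover have "cinner c (q (cnj l) x) = cinner (g l c) k"
    unfolding x cinner_commute [of c] cinner_g_adj [OF l] by (rule cinner_commute [symmetric])
  ultimately show ?thesis by simp
qed

text \<open>With \<open>c = 0\<close> the compression identity treats the component of
  \<open>v\<close> in \<open>H\<close> as an eigenvector of \<open>A\<close>, so
  \<open>(\<alpha> - cnj z) * cinner v (g z y)\<close> is independent of \<open>z\<close>.\<close>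

lemma eigenvector_pole:
  assumes v: "v \<in> eigenspace" and v0: "has_value v 0"
  shows "\<exists>d. has_pole v d"
proof -
  define d where "d = (\<alpha> - cnj z\<^sub>0) *\<^sub>C cadjoint (g z\<^sub>0) v"
  have "(\<alpha> - cnj z) * cinner v (g z y) = cinner d y" if z: "Im z \<noteq> 0" for z y
  proof -
    have gH: "g z y \<in> H" by (rule fam.F_mem [OF z])
    have R: "(z - z\<^sub>0) *\<^sub>C RA z\<^sub>0 (g z y) = g z y - g z\<^sub>0 y"
      using rel.resolvent_of_difference [OF rho [OF z0_nonreal] fam.F_rel [OF z z0_nonreal, of y]]
      by (simp add: rel.resolvent_scaleC [OF rho [OF z0_nonreal] gH])
    have "cinner v (g z y) = (\<alpha> - cnj z\<^sub>0) * cinner v (RA z\<^sub>0 (g z y))"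
      using eigenvector_compression [OF v v0 Im_cnj [OF z0_nonreal] gH]
      by (simp add: bounded_clinear_zero [OF g_bounded [OF Im_cnj [OF z0_nonreal]]])
    then have "cnj (z - z\<^sub>0) * cinner v (g z y) = (\<alpha> - cnj z\<^sub>0) * cinner v ((z - z\<^sub>0) *\<^sub>C RA z\<^sub>0 (g z y))"
      by (simp only: cinner_scaleC_right mult.left_commute)
    then have "(\<alpha> - cnj z) * cinner v (g z y) = (\<alpha> - cnj z\<^sub>0) * cinner v (g z\<^sub>0 y)"
      unfolding R by (simp add: cinner_diff_right algebra_simps)
    then show ?thesis by (simp add: d_def cinner_scaleC_left cinner_g_adj [OF z0_nonreal])
  qed
  then show ?thesis unfolding has_pole_def by blast
qed

text \<open>A vanishing pole vector removes the component in \<open>H\<close> by simplicity, a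
  vanishing value gives orthogonality to \<Gamma>, and minimality leaves only zero.\<close>

lemma pole_eq_0:
  assumes v0: "has_value v 0" and pole: "has_pole v 0"
  shows "v = 0"
proof (rule eq_0_if_orthogonal)
  have vg: "cinner v (g z y) = 0" if z: "Im z \<noteq> 0" for z y
    using pole z alpha_neq(1) [OF z] unfolding has_pole_def by fastforce
  have "orth_proj H v = 0"
  proof (rule g_total [OF orth_proj_mem [OF subspace_H]])
    fix z x assume z: "Im z \<noteq> 0"
    show "cinner (orth_proj H v) (g z x) = 0"
      by (simp add: cinner_orth_proj [OF subspace_H fam.F_mem [OF z]] vg [OF z])
  qed
  then show "cinner v k = 0" if "k \<in> H" for k
    using cinner_orth_proj [OF subspace_H that, of v] by simp
  show "cinner v (\<Gamma> z x) = 0" if "Im z \<noteq> 0" for z x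
    using v0 that unfolding has_value_0_iff by blast
qed

text \<open>The defect family spans \<open>H\<close>, and the pole condition makes both sides of the
  membership test for \<open>A\<close> agree.\<close>

lemma pole_A:
  assumes p: "p \<in> H" and pole: "has_pole p d"
  shows "(p, complex_of_real \<alpha> *\<^sub>C p) \<in> A"
proof (rule fam.mem_A_if_family)
  show "p \<in> fam.L" "complex_of_real \<alpha> *\<^sub>C p \<in> fam.L"
    unfolding fam_L by (intro csubspace_scaleC rel.csubspace_H p)+
  fix z w y assume z: "Im z \<noteq> 0" and w: "Im w \<noteq> 0"
  have "(\<alpha> - cnj z) * cinner p (g z y) = cinner d y" "(\<alpha> - cnj w) * cinner p (g w y) = cinner d y"
    using pole z w unfolding has_pole_def by blast+
  from combine_shifted [OF this]
  show "cinner (complex_of_real \<alpha> *\<^sub>C p) (g z y - g w y) = cinner p (z *\<^sub>C g z y - w *\<^sub>C g w y)"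
    by (simp add: cinner_diff_right cinner_scaleC_left cinner_scaleC_right)
qed

lemma proj_pole: "has_pole h d \<Longrightarrow> has_pole (orth_proj H h) d"
  unfolding has_pole_def by (simp add: cinner_orth_proj [OF subspace_H fam.F_mem])

text \<open>Orthogonality of \<open>v\<close> to \<Gamma> turns the products with \<open>g\<close>
  into those of \<open>- v\<close> with \<open>\<Gamma> - g\<close>, so one vector serves both
  \<open>m\<close> and \<tau> up to sign.\<close>

lemma pole_vector_in_Mul:
  assumes v0: "has_value v 0" and pole: "has_pole v d"
  shows "d \<in> Mul"
  unfolding Mul_iff
proof (intro conjI exI allI impI)
  show "has_pole v d" by (rule pole)
  fix z y assume z: "Im z \<noteq> 0"
  have "cinner v (\<Gamma> z y) = 0" using v0 z unfolding has_value_0_iff by blast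
  moreover have "(\<alpha> - cnj z) * cinner v (g z y) = cinner d y" using pole z unfolding has_pole_def by blast
  ultimately show "(\<alpha> - cnj z) * cinner (- v) (\<Gamma> z y - g z y) = cinner d y"
    by (simp add: cinner_minus_left cinner_diff_right)
qed

text \<open>The witnesses for \<open>m\<close> and \<tau> are projected to \<open>H\<close> and to
  its complement and then subtracted, so that their equal products with \<Gamma> cancel. The result
  is orthogonal to the span of \<Gamma>, hence the membership test inside that span does not apply,
  and the eigenvector equation is checked through a resolvent.\<close>

lemma Mul_eigenvector:
  assumes d: "d \<in> Mul"
  shows "\<exists>v\<in>eigenspace. has_value v 0 \<and> has_pole v d"
proof -
  obtain h1 h2 where h1: "has_pole h1 d"
    and h2: "\<And>z y. Im z \<noteq> 0 \<Longrightarrow> (\<alpha> - cnj z) * cinner h2 (\<Gamma> z y - g z y) = cinner d y"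
    using d unfolding Mul_iff by blast
  define p1 where "p1 = orth_proj H h1"
  define p2 where "p2 = h2 - orth_proj H h2"
  have p1H: "p1 \<in> H" unfolding p1_def by (rule orth_proj_mem [OF subspace_H])
  have p1: "has_pole p1 d" unfolding p1_def by (rule proj_pole [OF h1])
  have p1A: "(p1, complex_of_real \<alpha> *\<^sub>C p1) \<in> A" by (rule pole_A [OF p1H p1])
  have p2H: "cinner p2 k = 0" if "k \<in> H" for k
    unfolding p2_def by (simp add: cinner_diff_left cinner_orth_proj [OF subspace_H that])
  have p2: "(\<alpha> - cnj z) * cinner p2 (\<Gamma> z y) = cinner d y" if z: "Im z \<noteq> 0" for z y
  proof -
    have "cinner (orth_proj H h2) (\<Gamma> z y) = cinner (orth_proj H h2) (g z y)"
      by (rule \<Gamma>_compression_right [OF z orth_proj_mem [OF subspace_H]])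
    also have "\<dots> = cinner h2 (g z y)" by (rule cinner_orth_proj [OF subspace_H fam.F_mem [OF z]])
    finally have "cinner p2 (\<Gamma> z y) = cinner h2 (\<Gamma> z y - g z y)"
      by (simp add: p2_def cinner_diff_left cinner_diff_right)
    then show ?thesis using h2 [OF z] by simp
  qed
  define v where "v = p1 - p2"
  have v\<Gamma>: "cinner v (\<Gamma> z y) = 0" if z: "Im z \<noteq> 0" for z y
  proof -
    have "(\<alpha> - cnj z) * cinner p1 (g z y) = cinner d y" using p1 z unfolding has_pole_def by blast
    then have "(\<alpha> - cnj z) * cinner p1 (\<Gamma> z y) = cinner d y"
      by (simp only: \<Gamma>_compression_right [OF z p1H])
    then have "(\<alpha> - cnj z) * cinner v (\<Gamma> z y) = 0"
      using p2 [OF z, of y] by (simp add: v_def cinner_diff_left right_diff_distrib)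
    then show ?thesis using alpha_neq(1) [OF z] by simp
  qed
  have vH: "cinner v k = cinner p1 k" if "k \<in> H" for k
    by (simp add: v_def cinner_diff_left p2H [OF that])
  have v0: "has_value v 0" unfolding has_value_0_iff using v\<Gamma> by blast
  have vp: "has_pole v d"
    using p1 unfolding has_pole_def by (simp add: vH [OF fam.F_mem])
  define l where "l = \<i>"
  have l: "Im l \<noteq> 0" "Im (cnj l) \<noteq> 0" by (simp_all add: l_def)
  define f where "f = (complex_of_real \<alpha> - l) *\<^sub>C v"
  \<comment> \<open>Against \<open>H\<close> only the component \<open>p1\<close> counts, an
    eigenvector of \<open>A\<close>; against \<Gamma> both terms vanish because the span of \<Gamma>
    is invariant under the resolvents of \<open>Atilde\<close>.\<close>
  have "RT l f - v = 0"
  proof (rule eq_0_if_orthogonal)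
    fix k assume k: "k \<in> H"
    define x where "x = inv_into UNIV (q (cnj l)) (cadjoint (g l) k)"
    have x: "q (cnj l) x = cadjoint (g l) k" unfolding x_def by (rule q_inv [OF l(2)])
    have RTk: "RT (cnj l) k = RA (cnj l) k - \<Gamma> (cnj l) x"
      by (rule resolvent_\<Gamma> [OF l(2) k]) (simp only: complex_cnj_cnj x)
    have RAk: "RA (cnj l) k \<in> H" by (rule rel.resolvent_in_H [OF rho [OF l(2)] k])
    have "cinner (RT l f) k = cinner f (RT (cnj l) k)"
      by (rule ext.resolvent_adjoint [OF rhoT [OF l(1)] rhoT [OF l(2)] UNIV_I UNIV_I])
    also have "\<dots> = (\<alpha> - l) * cinner p1 (RA (cnj l) k)"
      unfolding RTk f_def by (simp add: cinner_scaleC_left cinner_diff_right v\<Gamma> [OF l(2)] vH [OF RAk])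
    also have "\<dots> = cinner (complex_of_real \<alpha> *\<^sub>C p1 - l *\<^sub>C p1) (RA (cnj l) k)"
      by (simp add: cinner_diff_left cinner_scaleC_left left_diff_distrib)
    also have "\<dots> = cinner (RA l (complex_of_real \<alpha> *\<^sub>C p1 - l *\<^sub>C p1)) k"
      by (rule rel.resolvent_adjoint [OF rho [OF l(1)] rho [OF l(2)] _ k, symmetric])
        (intro csubspace_diff csubspace_scaleC rel.csubspace_H p1H)
    also have "RA l (complex_of_real \<alpha> *\<^sub>C p1 - l *\<^sub>C p1) = p1"
      by (rule rel.resolvent_eq [OF rho [OF l(1)] p1A])
    finally show "cinner (RT l f - v) k = 0" by (simp add: cinner_diff_left vH [OF k])
  next
    fix z x assume z: "Im z \<noteq> 0"
    have "cinner v (RT (cnj l) (\<Gamma> z x)) = 0"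
      by (rule orthogonal_tfam_L [OF v\<Gamma> tfam.resolvent_L [OF l(2) \<Gamma>_tfam_L [OF z]]])
    moreover have "cinner (RT l f) (\<Gamma> z x) = cinner f (RT (cnj l) (\<Gamma> z x))"
      by (rule ext.resolvent_adjoint [OF rhoT [OF l(1)] rhoT [OF l(2)] UNIV_I UNIV_I])
    ultimately show "cinner (RT l f - v) (\<Gamma> z x) = 0"
      by (simp add: cinner_diff_left f_def cinner_scaleC_left v\<Gamma> [OF z])
  qed
  then have Rf: "RT l f = v" by simp
  have "(RT l f, f + l *\<^sub>C RT l f) \<in> Atilde" by (rule ext.resolvent_mem [OF rhoT [OF l(1)] UNIV_I])
  then have "v \<in> eigenspace" unfolding Rf eigenspace_iff by (simp add: f_def scaleC_diff_left)
  then show ?thesis using v0 vp by blast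
qed

text \<open>An eigenvector \<open>v\<close> with value \<open>c\<close> is paired with the
  eigenvector \<open>p\<close> of \<open>A\<close> in \<open>H\<close> that carries
  \<open>d\<close>. In the compression identity the terms with \<open>cinner v p\<close> cancel, so
  \<open>g l c\<close> is orthogonal to \<open>p\<close>, and that product is
  \<open>cinner d c\<close> up to a nonzero factor.\<close>

lemma Ker_orthogonal_Mul:
  assumes c: "c \<in> Ker" and d: "d \<in> Mul"
  shows "cinner c d = 0"
proof -
  obtain h where "has_value h c" using c unfolding Ker_iff by blast
  then obtain v where v: "v \<in> eigenspace" "has_value v c" using value_eigenvector by blast
  obtain h1 where h1: "has_pole h1 d" using d unfolding Mul_iff by blast
  define p where "p = orth_proj H h1"
  have pH: "p \<in> H" unfolding p_def by (rule orth_proj_mem [OF subspace_H])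
  have pd: "has_pole p d" unfolding p_def by (rule proj_pole [OF h1])
  have pA: "(p, complex_of_real \<alpha> *\<^sub>C p) \<in> A" by (rule pole_A [OF pH pd])
  define l where "l = \<i>"
  have l: "Im l \<noteq> 0" "Im (cnj l) \<noteq> 0" by (simp_all add: l_def)
  have "RA (cnj l) (complex_of_real \<alpha> *\<^sub>C p - cnj l *\<^sub>C p) = p"
    by (rule rel.resolvent_eq [OF rho [OF l(2)] pA])
  then have "(complex_of_real \<alpha> - cnj l) *\<^sub>C RA (cnj l) p = p"
    by (simp add: rel.resolvent_scaleC [OF rho [OF l(2)] pH] flip: scaleC_diff_left)
  then have "cinner v p = cinner v ((complex_of_real \<alpha> - cnj l) *\<^sub>C RA (cnj l) p)" by simp
  also have "\<dots> = (\<alpha> - l) * cinner v (RA (cnj l) p)" by (simp add: cinner_scaleC_right)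
  finally have "cinner (g l c) p = 0" using eigenvector_compression [OF v l(1) pH] by simp
  then have "cinner p (g l c) = 0" by (rule iffD1 [OF cinner_eq_0_commute])
  moreover have "(\<alpha> - cnj l) * cinner p (g l c) = cinner d c"
    using pd l(1) unfolding has_pole_def by blast
  ultimately have "cinner d c = 0" by simp
  then show ?thesis by (rule iffD1 [OF cinner_eq_0_commute])
qed

lemma eigenvalue_iff: "is_eigenvalue Atilde \<alpha> \<longleftrightarrow> (\<exists>c\<in>Ker. c \<noteq> 0) \<or> (\<exists>d\<in>Mul. d \<noteq> 0)"
proof -
  have "is_eigenvalue Atilde \<alpha> \<longleftrightarrow> (\<exists>v\<in>eigenspace. v \<noteq> 0)"
    using csubspace_0 [OF csubspace_eigenspace] unfolding is_eigenvalue_def eigenspace_def by blast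
  also have "\<dots> \<longleftrightarrow> (\<exists>c\<in>Ker. c \<noteq> 0) \<or> (\<exists>d\<in>Mul. d \<noteq> 0)"
  proof
    assume "\<exists>v\<in>eigenspace. v \<noteq> 0"
    then obtain v where v: "v \<in> eigenspace" "v \<noteq> 0" by blast
    obtain c where c: "has_value v c" using eigenvector_value [OF v(1)] by blast
    show "(\<exists>c\<in>Ker. c \<noteq> 0) \<or> (\<exists>d\<in>Mul. d \<noteq> 0)"
    proof (cases "c = 0")
      case True
      then have v0: "has_value v 0" using c by simp
      obtain d where d: "has_pole v d" using eigenvector_pole [OF v(1) v0] by blast
      have "d \<noteq> 0"
      proof
        assume "d = 0"
        then have "has_pole v 0" using d by simp
        then show False using pole_eq_0 [OF v0] v(2) by simp
      qed
      then show ?thesis by (intro disjI2 bexI [of _ d] pole_vector_in_Mul [OF v0 d])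
    next
      case False
      have "c \<in> Ker" using c unfolding Ker_iff by blast
      then show ?thesis using False by (intro disjI1 bexI [of _ c])
    qed
  next
    assume "(\<exists>c\<in>Ker. c \<noteq> 0) \<or> (\<exists>d\<in>Mul. d \<noteq> 0)"
    then show "\<exists>v\<in>eigenspace. v \<noteq> 0"
    proof
      assume "\<exists>c\<in>Ker. c \<noteq> 0"
      then obtain c where "c \<in> Ker" and c0: "c \<noteq> 0" by blast
      then obtain h where "has_value h c" unfolding Ker_iff by blast
      note c = c0 this
      obtain v where v: "v \<in> eigenspace" "has_value v c" using value_eigenvector [OF c(2)] by blast
      have "v \<noteq> 0"
      proof
        assume "v = 0"
        then have "has_value v 0" by (simp add: has_value_def)
        then show False using has_value_unique [OF v(2)] c(1) by simp
      qed
      then show ?thesis by (intro bexI [of _ v] v(1))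
    next
      assume "\<exists>d\<in>Mul. d \<noteq> 0"
      then obtain d where d: "d \<in> Mul" "d \<noteq> 0" by blast
      obtain v where v: "v \<in> eigenspace" "has_pole v d" using Mul_eigenvector [OF d(1)] by blast
      have "v \<noteq> 0"
      proof
        assume "v = 0"
        then have "has_pole v 0" by (simp add: has_pole_def)
        then show False using has_pole_unique [OF v(2)] d(2) by simp
      qed
      then show ?thesis by (intro bexI [of _ v] v(1))
    qed
  qed
  finally show ?thesis .
qed

section \<open>The linear bijection of the eigenspace\<close>

definition pole_space :: "'k set" where "pole_space = {v \<in> eigenspace. has_value v 0}"

lemma closed_csubspace_pole_space: "closed_csubspace pole_space"
proof -
  define X where "X = {\<Gamma> z y |z y. Im z \<noteq> 0}"
  have X: "(\<forall>x\<in>X. cinner v x = 0) \<longleftrightarrow> has_value v 0" for v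
    unfolding has_value_0_iff X_def by auto
  have eq: "pole_space = eigenspace \<inter> {v. \<forall>x\<in>X. cinner v x = 0}"
    unfolding pole_space_def X by (simp only: Collect_conj_eq Collect_mem_eq)
  have "closed_csubspace {v. \<forall>x\<in>X. cinner v x = 0}" by (rule closed_csubspace_orthogonal)
  then have orth: "csubspace {v. \<forall>x\<in>X. cinner v x = 0}" "closed {v. \<forall>x\<in>X. cinner v x = 0}"
    by (simp_all only: closed_csubspace_def)
  have "csubspace (eigenspace \<inter> {v. \<forall>x\<in>X. cinner v x = 0})"
    using csubspace_eigenspace orth(1) by (simp only: csubspace_def Int_iff) blast
  then show ?thesis
    unfolding eq closed_csubspace_def by (intro conjI closed_Int closed_eigenspace orth(2))
qed

text \<open>The value \<open>C\<close> is linear on the eigenspace with kernel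
  \<open>pole_space\<close>, while the pole vector \<open>D\<close> makes sense only on that kernel.
  Composing \<open>D\<close> with the orthogonal projection onto the closed subspace
  \<open>pole_space\<close> extends it linearly.\<close>

lemma eigenspace_bijection:
  "\<exists>\<Psi>. clinear_on eigenspace \<Psi> \<and> bij_betw \<Psi> eigenspace (subspace_sum Ker Mul)"
proof -
  define C where "C v = (SOME c. has_value v c)" for v
  have C: "has_value v (C v)" if "v \<in> eigenspace" for v
    unfolding C_def by (rule someI_ex [OF eigenvector_value [OF that]])
  define D where "D v = (SOME d. has_pole v d)" for v
  have D: "has_pole v (D v)" if "v \<in> pole_space" for v
    unfolding D_def using that unfolding pole_space_def
    by (intro someI_ex [OF eigenvector_pole]) simp_all
  define P where "P = orth_proj pole_space"
  note cl = closed_csubspace_pole_space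
  have csp: "csubspace pole_space" using cl by (simp add: closed_csubspace_def)
  have P: "P v \<in> pole_space" for v unfolding P_def by (rule orth_proj_mem [OF cl])
  have P_add: "P (v + w) = P v + P w" for v w
    unfolding P_def
    by (rule orth_proj_unique [OF cl])
      (simp_all add: csubspace_add [OF csp] orth_proj_mem [OF cl] cinner_add_left cinner_orth_proj [OF cl])
  have P_scaleC: "P (a *\<^sub>C v) = a *\<^sub>C P v" for a v
    unfolding P_def
    by (rule orth_proj_unique [OF cl])
      (simp_all add: csubspace_scaleC [OF csp] orth_proj_mem [OF cl] cinner_scaleC_left cinner_orth_proj [OF cl])
  have P_id: "P v = v" if "v \<in> pole_space" for v
    unfolding P_def by (rule orth_proj_unique [OF cl that]) (rule refl)
  have sub: "v \<in> eigenspace" "has_value v 0" if "v \<in> pole_space" for v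
    using that unfolding pole_space_def by blast+
  define \<Psi> where "\<Psi> v = C v + D (P v)" for v
  have C_eq: "C v = c" if "v \<in> eigenspace" "has_value v c" for v c
    by (rule has_value_unique [OF C [OF that(1)] that(2)])
  have D_eq: "D v = d" if "v \<in> pole_space" "has_pole v d" for v d
    by (rule has_pole_unique [OF D [OF that(1)] that(2)])
  have \<Psi>_add: "\<Psi> (v + w) = \<Psi> v + \<Psi> w" if vw: "v \<in> eigenspace" "w \<in> eigenspace" for v w
  proof -
    have "C (v + w) = C v + C w"
      by (intro C_eq csubspace_add [OF csubspace_eigenspace] has_value_add C vw)
    moreover have "D (P (v + w)) = D (P v) + D (P w)"
      unfolding P_add by (intro D_eq csubspace_add [OF csp] has_pole_add D P)
    ultimately show ?thesis by (simp add: \<Psi>_def)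
  qed
  have \<Psi>_scaleC: "\<Psi> (a *\<^sub>C v) = a *\<^sub>C \<Psi> v" if v: "v \<in> eigenspace" for a v
  proof -
    have "C (a *\<^sub>C v) = a *\<^sub>C C v"
      by (intro C_eq csubspace_scaleC [OF csubspace_eigenspace] has_value_scaleC C v)
    moreover have "D (P (a *\<^sub>C v)) = a *\<^sub>C D (P v)"
      unfolding P_scaleC by (intro D_eq csubspace_scaleC [OF csp] has_pole_scaleC D P)
    ultimately show ?thesis by (simp add: \<Psi>_def scaleC_add_right)
  qed
  have C_Ker: "C v \<in> Ker" if "v \<in> eigenspace" for v
    unfolding Ker_iff using C [OF that] by blast
  have D_Mul: "D (P v) \<in> Mul" for v
    by (rule pole_vector_in_Mul [OF sub(2) [OF P] D [OF P]])
  have "inj_on \<Psi> eigenspace"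
  proof (rule inj_onI)
    fix v w assume v: "v \<in> eigenspace" and w: "w \<in> eigenspace" and eq: "\<Psi> v = \<Psi> w"
    define u where "u = v + (- 1) *\<^sub>C w"
    have wm: "(- 1) *\<^sub>C w \<in> eigenspace" by (rule csubspace_scaleC [OF csubspace_eigenspace w])
    have u: "u \<in> eigenspace" unfolding u_def by (rule csubspace_add [OF csubspace_eigenspace v wm])
    have "\<Psi> u = 0"
      unfolding u_def \<Psi>_add [OF v wm] \<Psi>_scaleC [OF w] eq by (simp add: scaleC_minus_one)
    then have sum: "C u + D (P u) = 0" by (simp add: \<Psi>_def)
    \<comment> \<open>Orthogonality of \<open>Ker\<close> and \<open>Mul\<close> makes both summands
      of a vanishing sum vanish.\<close>
    have "cinner (C u) (C u + D (P u)) = cinner (C u) (C u)"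
      by (simp add: cinner_add_right Ker_orthogonal_Mul [OF C_Ker [OF u] D_Mul])
    then have C0: "C u = 0" by (simp add: sum)
    then have D0: "D (P u) = 0" using sum by simp
    have u0: "has_value u 0" using C [OF u] by (simp add: C0)
    then have "u \<in> pole_space" using u by (simp add: pole_space_def)
    then have "has_pole u 0" using D [of u] D0 by (simp add: P_id)
    then have "u = 0" by (rule pole_eq_0 [OF u0])
    then show "v = w" by (simp add: u_def scaleC_minus_one)
  qed
  moreover have "\<Psi> ` eigenspace = subspace_sum Ker Mul"
  proof
    show "\<Psi> ` eigenspace \<subseteq> subspace_sum Ker Mul"
      unfolding subspace_sum_def \<Psi>_def using C_Ker D_Mul by blast
    show "subspace_sum Ker Mul \<subseteq> \<Psi> ` eigenspace"
    proof
      fix x assume "x \<in> subspace_sum Ker Mul"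
      then obtain c d where x: "x = c + d" and c: "c \<in> Ker" and d: "d \<in> Mul"
        unfolding subspace_sum_def by blast
      obtain h where "has_value h c" using c unfolding Ker_iff by blast
      then obtain v where v: "v \<in> eigenspace" "has_value v c" using value_eigenvector by blast
      obtain w where w: "w \<in> eigenspace" "has_value w 0" "has_pole w d" using Mul_eigenvector [OF d] by blast
      have wp: "w \<in> pole_space" using w by (simp add: pole_space_def)
      \<comment> \<open>This correction replaces the projection \<open>P v\<close> by
        \<open>w\<close> and, lying in \<open>pole_space\<close>, leaves the value \<open>c\<close>
        unchanged.\<close>
      define r where "r = w + (- 1) *\<^sub>C P v"
      have rp: "r \<in> pole_space"
        unfolding r_def by (intro csubspace_add csubspace_scaleC csp wp P)
      have u: "v + r \<in> eigenspace" by (rule csubspace_add [OF csubspace_eigenspace v(1) sub(1) [OF rp]])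
      have "has_value (v + r) (c + 0)" by (rule has_value_add [OF v(2) sub(2) [OF rp]])
      then have Cu: "C (v + r) = c" using C_eq [OF u] by simp
      have "P (v + r) = w" unfolding P_add P_id [OF rp] by (simp add: r_def scaleC_minus_one)
      then have "\<Psi> (v + r) = x" by (simp add: \<Psi>_def Cu x D_eq [OF wp w(3)])
      then show "x \<in> \<Psi> ` eigenspace" using u by blast
    qed
  qed
  ultimately have "bij_betw \<Psi> eigenspace (subspace_sum Ker Mul)" by (simp add: bij_betw_def)
  moreover have "clinear_on eigenspace \<Psi>"
    unfolding clinear_on_def using \<Psi>_add \<Psi>_scaleC by blast
  ultimately show ?thesis by blast
qed

end

end

theorem theorem4p8:
  fixes H :: "'k::complex_hilbert set"
    and S A Atilde :: "('k \<times> 'k) set"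
    and z\<^sub>0 :: complex
    and \<gamma> :: "'g::complex_hilbert \<Rightarrow> 'k"
    and m \<tau> :: "complex \<Rightarrow> 'g \<Rightarrow> 'g"
    and N :: "'n set"
  assumes H: "closed_csubspace H"
    and S: "closed_symmetric_operator H S"
    and defect: "defect_numbers H S N N"
    and A: "self_adjoint_rel H A" "S \<subseteq> A"
    and simple: "simple_operator H S A"
    and lambda0: "z\<^sub>0 \<in> resolvent_set H A" "Im z\<^sub>0 > 0"
    and dim_G: "has_hilbert_dim (UNIV :: 'g set) N"
    and gamma: "bounded_clinear \<gamma>" "bij_betw \<gamma> UNIV (defect_space H S z\<^sub>0)"
    and m: "Q_function H A z\<^sub>0 \<gamma> m"
    and tau: "nevanlinna_N0 \<tau>"
    and regular: "regular_fun (\<lambda>z x. m z x + \<tau> z x)"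
    and Atilde: "self_adjoint_rel UNIV Atilde" "S \<subseteq> Atilde" "minimal_extension Atilde z\<^sub>0 \<gamma>"
    and krein: "\<And>z x. Im z \<noteq> 0 \<Longrightarrow> x \<in> H \<Longrightarrow>
      orth_proj H (resolvent Atilde z x) =
        resolvent A z x -
        defect_family A z\<^sub>0 \<gamma> z
          (inv_into UNIV (\<lambda>u. m z u + \<tau> z u) (cadjoint (defect_family A z\<^sub>0 \<gamma> (cnj z)) x))"
  shows "\<forall>\<alpha>::real.
      let m\<tau> = \<lambda>z x. m z x + \<tau> z x;
          K = rel_ker (generalised_value m\<tau> \<alpha>);
          M = rel_mul (generalised_value m \<alpha>) \<inter> rel_mul (generalised_value \<tau> \<alpha>)
      in (is_eigenvalue Atilde \<alpha> \<longleftrightarrow>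
            generalised_zero m\<tau> \<alpha> \<or>
            (\<exists>g. generalised_pole m \<alpha> g \<and> generalised_pole \<tau> \<alpha> g)) \<and>
         (\<forall>x\<in>K. \<forall>y\<in>M. cinner x y = 0) \<and>
         (\<exists>\<Psi>. clinear_on (rel_ker (rel_shift Atilde \<alpha>)) \<Psi> \<and>
              bij_betw \<Psi> (rel_ker (rel_shift Atilde \<alpha>)) (subspace_sum K M))"
proof -
  interpret krein_extension H S A Atilde z\<^sub>0 \<gamma> m \<tau>
    by unfold_locales (fact H A simple lambda0(2) gamma m tau Atilde krein)+
  show ?thesis
    unfolding Let_def
  proof (intro allI conjI ballI)
    fix \<alpha> :: real
    show "is_eigenvalue Atilde \<alpha> \<longleftrightarrow> generalised_zero (\<lambda>z x. m z x + \<tau> z x) \<alpha> \<or>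
        (\<exists>g. generalised_pole m \<alpha> g \<and> generalised_pole \<tau> \<alpha> g)"
      unfolding eigenvalue_iff generalised_zero_def generalised_pole_def Ker_def Mul_def rel_ker_def rel_mul_def
      by blast
    show "cinner x y = 0" if "x \<in> rel_ker (generalised_value (\<lambda>z x. m z x + \<tau> z x) \<alpha>)"
      and "y \<in> rel_mul (generalised_value m \<alpha>) \<inter> rel_mul (generalised_value \<tau> \<alpha>)" for x y
      by (rule Ker_orthogonal_Mul [unfolded Ker_def Mul_def, OF that])
    show "\<exists>\<Psi>. clinear_on (rel_ker (rel_shift Atilde \<alpha>)) \<Psi> \<and> bij_betw \<Psi> (rel_ker (rel_shift Atilde \<alpha>))
        (subspace_sum (rel_ker (generalised_value (\<lambda>z x. m z x + \<tau> z x) \<alpha>))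
          (rel_mul (generalised_value m \<alpha>) \<inter> rel_mul (generalised_value \<tau> \<alpha>)))"
      by (rule eigenspace_bijection [unfolded eigenspace_def Ker_def Mul_def])
  qed
qed

end
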